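(* Let $\mathbb{D}^*=\mathbb{D}\setminus\{0\}$ and let $\omega:\mathbb{D}^*\to\mathbb{C}$ and $\psi:\mathbb{D}^*\to\mathbb{D}^*$ be holomorphic. The following are equivalent: (1) $C_{\omega,\psi}$ is hypercyclic on $H(\mathbb{D}^* )$. (2) $C_{\omega,\psi}$ satisfies the Frequent Hypercyclicity Criterion on $H(\mathbb{D}^* )$, and in particular is frequently hypercyclic, mixing and chaotic. (3) The multiplier $\omega$ is of the form $\omega(z)=z^n e^{W(z)}$ $(z\in\mathbb{D}^* )$, where $W\in H(\mathbb{D}^* )$ and $n\in\mathbb{N}$, and the symbol $\psi:\mathbb{D}^*\to\mathbb{D}^*$ is injective, not surjective, and satisfies $\lim_{z\to 0}\psi(z)=0$.
   Context: $\mathbb{N}=\{1,2,\dots\}$ and $\mathbb{D}=\{z\in\mathbb{C}:|z|<1\}$. For a domain $\Omega\subseteq\mathbb{C}$, $H(\Omega)$ is the space of holomorphic functions on $\Omega$ with the compact-open topology (a separable Fréchet space). For holomorphic $\omega:\Omega\to\mathbb{C}$ and $\psi:\Omega\to\Omega$, the weighted composition operator $C_{\omega,\psi}:H(\Omega)\to H(\Omega)$ is $C_{\omega,\psi}(f)(z)=\omega(z)\,f(\psi(z))$; $\omega$ is its multiplier and $\psi$ its symbol. An operator means a continuous linear self-map. Let $T$ be an operator on a separable Fréchet space $X$. $T$ is hypercyclic if for some $f\in X$ the orbit $\{T^nf: n=0,1,\dots\}$ is dense in $X$. $T$ is mixing if for each pair of non-empty open $U,V\subseteq X$ there is an integer $n$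 with $T^k(U)\cap V\ne\emptyset$ for each $k\ge n$. $T$ is chaotic if it is topologically transitive (for each pair of non-empty open $U,V\subseteq X$ there is $n$ with $T^n(U)\cap V\neq\emptyset$) and its set of periodic points $\{f\in X: T^rf=f \text{ for some } r\in\mathbb{N}\}$ is dense in $X$. $T$ is frequently hypercyclic if there is $f\in X$ so that $\liminf_{N\to\infty}\frac{\mathrm{card}\{0\le n\le N: T^nf\in U\}}{N+1}>0$ for each non-empty open $U\subseteq X$. $T$ satisfies the Frequent Hypercyclicity Criterion if there exist a dense subset $X_0$ of $X$ and a map $S:X_0\to X_0$ such that, for each $f\in X_0$: (i) $\sum_{n=1}^\infty T^n f$ converges unconditionally; (ii) $\sum_{n=1}^\infty S^n f$ converges unconditionally; (iii) $TSf=f$. *)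

theory Defs
  imports "HOL-Analysis.Analysis" "HOL-Library.Function_Algebras"
begin

text \<open>An element of \<open>H(\<Omega>)\<close> is represented by its extension by zero outside \<open>\<Omega>\<close>, so that equality
  of HOL functions is equality on \<open>\<Omega>\<close>, and the pointwise addition of Function_Algebras is the
  addition of \<open>H(\<Omega>)\<close>.\<close>

definition holo :: "complex set \<Rightarrow> (complex \<Rightarrow> complex) set" where
  "holo \<Omega> = {f. f holomorphic_on \<Omega> \<and> (\<forall>z. z \<notin> \<Omega> \<longrightarrow> f z = 0)}"

definition holo_topology :: "complex set \<Rightarrow> (complex \<Rightarrow> complex) topology" where
  "holo_topology \<Omega> = topology_generated_by
     {{f \<in> holo \<Omega>. f ` K \<subseteq> U} | K U. compact K \<and> K \<subseteq> \<Omega> \<and> open U}"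

lemma topspace_holo_topology: "topspace (holo_topology \<Omega>) = holo \<Omega>"
proof -
  have "{f \<in> holo \<Omega>. f ` {} \<subseteq> UNIV} \<in>
      {{f \<in> holo \<Omega>. f ` K \<subseteq> U} | K U. compact K \<and> K \<subseteq> \<Omega> \<and> open U}"
    using compact_empty open_UNIV by blast
  then show ?thesis
    unfolding holo_topology_def topology_generated_by_topspace by fastforce
qed

definition wcomp :: "complex set \<Rightarrow> (complex \<Rightarrow> complex) \<Rightarrow> (complex \<Rightarrow> complex) \<Rightarrow>
    (complex \<Rightarrow> complex) \<Rightarrow> (complex \<Rightarrow> complex)" where
  "wcomp \<Omega> \<omega> \<psi> f = (\<lambda>z. if z \<in> \<Omega> then \<omega> z * f (\<psi> z) else 0)"

lemma wcomp_in_holo: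
  assumes "\<omega> holomorphic_on \<Omega>" "\<psi> holomorphic_on \<Omega>" "\<psi> ` \<Omega> \<subseteq> \<Omega>" "f \<in> holo \<Omega>"
  shows "wcomp \<Omega> \<omega> \<psi> f \<in> holo \<Omega>"
proof -
  have "f \<circ> \<psi> holomorphic_on \<Omega>"
    using assms by (auto simp: holo_def intro: holomorphic_on_compose_gen)
  then have "(\<lambda>z. \<omega> z * (f \<circ> \<psi>) z) holomorphic_on \<Omega>"
    by (intro holomorphic_on_mult assms) (simp add: comp_def)
  then have "wcomp \<Omega> \<omega> \<psi> f holomorphic_on \<Omega>"
    by (rule holomorphic_transform) (simp add: wcomp_def)
  then show ?thesis
    by (simp add: holo_def wcomp_def)
qed

lemma wcomp_add: "wcomp \<Omega> \<omega> \<psi> (f + g) = wcomp \<Omega> \<omega> \<psi> f + wcomp \<Omega> \<omega> \<psi> g"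
  by (auto simp: wcomp_def fun_eq_iff algebra_simps)

text \<open>The dynamical notions below concern a self-map \<open>T\<close> of \<open>topspace X\<close>; the values of \<open>T\<close> outside
  \<open>topspace X\<close> are irrelevant.\<close>

definition dense_subset :: "'a topology \<Rightarrow> 'a set \<Rightarrow> bool" where
  "dense_subset X A \<longleftrightarrow> A \<subseteq> topspace X \<and> X closure_of A = topspace X"

definition hypercyclic :: "'a topology \<Rightarrow> ('a \<Rightarrow> 'a) \<Rightarrow> bool" where
  "hypercyclic X T \<longleftrightarrow> (\<exists>f \<in> topspace X. dense_subset X {(T ^^ n) f | n. True})"

definition mixing :: "'a topology \<Rightarrow> ('a \<Rightarrow> 'a) \<Rightarrow> bool" where
  "mixing X T \<longleftrightarrow> (\<forall>U V. openin X U \<and> U \<noteq> {} \<and> openin X V \<and> V \<noteq> {} \<longrightarrow>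
     (\<exists>n. \<forall>k\<ge>n. (T ^^ k) ` U \<inter> V \<noteq> {}))"

definition topologically_transitive :: "'a topology \<Rightarrow> ('a \<Rightarrow> 'a) \<Rightarrow> bool" where
  "topologically_transitive X T \<longleftrightarrow>
     (\<forall>U V. openin X U \<and> U \<noteq> {} \<and> openin X V \<and> V \<noteq> {} \<longrightarrow> (\<exists>n. (T ^^ n) ` U \<inter> V \<noteq> {}))"

definition chaotic :: "'a topology \<Rightarrow> ('a \<Rightarrow> 'a) \<Rightarrow> bool" where
  "chaotic X T \<longleftrightarrow> topologically_transitive X T \<and>
     dense_subset X {f \<in> topspace X. \<exists>r\<ge>1. (T ^^ r) f = f}"

definition frequently_hypercyclic :: "'a topology \<Rightarrow> ('a \<Rightarrow> 'a) \<Rightarrow> bool" where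
  "frequently_hypercyclic X T \<longleftrightarrow> (\<exists>f \<in> topspace X. \<forall>U. openin X U \<and> U \<noteq> {} \<longrightarrow>
     liminf (\<lambda>N. ereal (real (card {n. n \<le> N \<and> (T ^^ n) f \<in> U}) / real (N + 1))) > 0)"

text \<open>Unconditional convergence is convergence of the net of finite partial sums, as for
  \<^const>\<open>summable_on\<close>; that constant itself is not applicable, since it would use the topology
  of pointwise convergence given by the type class instance for functions.\<close>

definition unconditionally_convergent ::
    "'a::comm_monoid_add topology \<Rightarrow> (nat \<Rightarrow> 'a) \<Rightarrow> nat set \<Rightarrow> bool" where
  "unconditionally_convergent X g A \<longleftrightarrow> (\<exists>l. limitin X (sum g) l (finite_subsets_at_top A))"

definition frequent_hypercyclicity_criterion ::
    "'a::comm_monoid_add topology \<Rightarrow> ('a \<Rightarrow> 'a) \<Rightarrow> bool" where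
  "frequent_hypercyclicity_criterion X T \<longleftrightarrow>
     (\<exists>X0 S. dense_subset X X0 \<and> S ` X0 \<subseteq> X0 \<and>
       (\<forall>f\<in>X0. unconditionally_convergent X (\<lambda>n. (T ^^ n) f) {1..} \<and>
               unconditionally_convergent X (\<lambda>n. (S ^^ n) f) {1..} \<and>
               T (S f) = f))"

abbreviation punctured_disc :: "complex set" where
  "punctured_disc \<equiv> ball 0 1 - {0}"

end

theory Submission
  imports Defs "HOL-Complex_Analysis.Complex_Analysis"
begin

text \<open>
  Let \<open>T f = \<omega> * (f \<circ> \<psi>)\<close> on the punctured disc.

  The key is a normal form. Suppose that \<open>\<omega> z = z\<^sup>k * exp (W z)\<close> with an integer \<open>k\<close>, and that \<open>\<psi>\<close> extends over
  the puncture to a univalent self-map of the disc that fixes \<open>0\<close> and is not a rotation, so that its derivative \<open>l\<close>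
  at \<open>0\<close> satisfies \<open>0 < \<bar>l\<bar> < 1\<close>. Koenigs' function \<open>\<phi>\<close> is univalent with \<open>\<phi> \<circ> \<psi> = l * \<phi>\<close>. Solving the
  cohomological equation \<open>G - G \<circ> \<psi> = V\<close> (along forward orbits for the part of \<open>V\<close> that is holomorphic at \<open>0\<close>, and along
  backward orbits for the principal part at \<open>0\<close>) removes the exponential factor up to a constant:
  \<open>\<omega> * exp (G \<circ> \<psi>) = c * \<phi>\<^sup>k * exp G\<close> (\<open>multiplier_normal_form\<close>). Hence \<open>T\<close> maps \<open>e\<^sub>j = exp G * \<phi>\<^sup>j\<close> to
  \<open>c * l\<^sup>j * e\<^sub>j\<^sub>+\<^sub>k\<close> for every integer \<open>j\<close>: it is a weighted shift.

  If \<open>k \<ge> 1\<close>, the forward and the backward orbit of each \<open>e\<^sub>j\<close> pick up \<open>l\<close> to a power that is quadratic in time, so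
  they tend to zero faster than geometrically; two-sided orbits with this property are called
  homoclinic here. The span of the \<open>e\<^sub>j\<close> is dense, by a form of Runge's theorem for Laurent polynomials in the univalent
  function \<open>\<phi>\<close> (\<open>algebra_contains_holomorphic_punctured_disc\<close>). From a dense set of homoclinic points all the
  dynamical properties follow by superposition: mixing by adding two orbits, periodic points by summing an orbit over
  the multiples of a period, and a frequently hypercyclic vector by summing delayed orbits whose delays form
  separated sets of positive lower density (locale \<open>homoclinically_dense\<close>).

  Conversely, let \<open>f\<close> be a hypercyclic vector. A nonzero continuous linear functional takes dense values along its
  orbit. Functionals that annihilate the range of \<open>T\<close> therefore cannot exist, which shows that \<open>\<omega>\<close> has no
  zeros, that \<open>\<psi>\<close> is injective, and that \<open>\<psi>\<close> extends by \<open>0 \<mapsto> 0\<close>. A surjective \<open>\<psi>\<close> would be a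
  rotation, and then the logarithmic means of \<open>T\<^sup>n f\<close> over a circle would be monotone in \<open>n\<close> (\<open>not_rotation\<close>). So the normal
  form applies, \<open>k\<close> being the winding number of \<open>\<omega>\<close>. For \<open>k = 0\<close> the coefficient functional of \<open>e\<^sub>0\<close>
  is an eigenvector of the adjoint of \<open>T\<close>, and for \<open>k < 0\<close> it tends to zero along the orbit; both contradict density
  (\<open>winding_number_positive\<close>).
\<close>

section \<open>The compact-open topology\<close>

text \<open>The basic neighbourhoods of the compact-open topology, in terms of which density, convergence
  and openness become statements about uniform approximation on compact sets.\<close>

definition uniform_ball ::
    "complex set \<Rightarrow> (complex \<Rightarrow> complex) \<Rightarrow> complex set \<Rightarrow> real \<Rightarrow> (complex \<Rightarrow> complex) set" where
  "uniform_ball \<Omega> f K e = {g \<in> holo \<Omega>. \<forall>z\<in>K. dist (g z) (f z) < e}"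

lemma holo_continuous_on: "f \<in> holo \<Omega> \<Longrightarrow> K \<subseteq> \<Omega> \<Longrightarrow> continuous_on K f"
  by (auto simp: holo_def intro: holomorphic_on_imp_continuous_on continuous_on_subset)

lemma openin_holo_imp_uniform_ball:
  assumes "openin (holo_topology \<Omega>) U" "f \<in> U"
  obtains K e where "compact K" "K \<subseteq> \<Omega>" "e > 0" "uniform_ball \<Omega> f K e \<subseteq> U"
proof -
  have "generate_topology_on {{f \<in> holo \<Omega>. f ` K \<subseteq> U} | K U. compact K \<and> K \<subseteq> \<Omega> \<and> open U} U"
    using assms(1) unfolding holo_topology_def openin_topology_generated_by_iff .
  then have "f \<in> U \<Longrightarrow> \<exists>K e. compact K \<and> K \<subseteq> \<Omega> \<and> e > 0 \<and> uniform_ball \<Omega> f K e \<subseteq> U"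
  proof (induction rule: generate_topology_on.induct)
    case Empty
    then show ?case by simp
  next
    case (Int a b)
    then obtain K e L d where "compact K" "K \<subseteq> \<Omega>" "e > 0" "uniform_ball \<Omega> f K e \<subseteq> a"
      "compact L" "L \<subseteq> \<Omega>" "d > 0" "uniform_ball \<Omega> f L d \<subseteq> b"
      by (meson IntE)
    moreover from this have "uniform_ball \<Omega> f (K \<union> L) (min e d) \<subseteq> a \<inter> b"
      by (auto simp: uniform_ball_def)
    ultimately show ?case
      by (intro exI[of _ "K \<union> L"] exI[of _ "min e d"]) (auto simp: compact_Un)
  next
    case (UN \<K>)
    then obtain k where "k \<in> \<K>" "f \<in> k" by blast
    then show ?case using UN.IH[of k] by (meson Union_upper order_trans)
  next
    case (Basis s)
    then obtain K V where s: "s = {f \<in> holo \<Omega>. f ` K \<subseteq> V}" "compact K" "K \<subseteq> \<Omega>" "open V"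
      by blast
    then have "compact (f ` K)"
      using Basis.prems by (auto intro!: compact_continuous_image holo_continuous_on)
    moreover have "f ` K \<subseteq> V" using Basis.prems s by simp
    ultimately obtain e where e: "e > 0" "(\<Union>x\<in>f ` K. ball x e) \<subseteq> V"
      using compact_subset_open_imp_ball_epsilon_subset[of "f ` K" V] s(4) by auto
    then have "uniform_ball \<Omega> f K e \<subseteq> s"
      by (fastforce simp: uniform_ball_def s(1) dist_commute)
    with s e show ?case by blast
  qed
  then show ?thesis using that assms(2) by blast
qed

text \<open>Uniform closeness on a compact set is a compact-open condition: \<open>K\<close> is cut into finitely many compact
  pieces on each of which \<open>f\<close> is almost constant, and each piece must be mapped close to that constant.\<close>

lemma uniform_ball_contains_openin:
  assumes f: "f \<in> holo \<Omega>" and K: "compact K" "K \<subseteq> \<Omega>" and e: "e > 0"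
  shows "\<exists>V. openin (holo_topology \<Omega>) V \<and> f \<in> V \<and> V \<subseteq> uniform_ball \<Omega> f K e"
proof -
  have cont: "continuous_on K f" using f K holo_continuous_on by blast
  have "uniformly_continuous_on K f" using compact_uniformly_continuous[OF cont K(1)] .
  then obtain d where d: "d > 0" "\<And>x y. x \<in> K \<Longrightarrow> y \<in> K \<Longrightarrow> dist y x < d \<Longrightarrow> dist (f y) (f x) < e / 3"
    unfolding uniformly_continuous_on_def using e by (metis divide_pos_pos zero_less_numeral)
  have "\<forall>c\<in>(\<lambda>x. ball x (d/2)) ` K. open c" "K \<subseteq> \<Union>((\<lambda>x. ball x (d/2)) ` K)"
    using d(1) by auto
  then obtain P where P: "P \<subseteq> K" "finite P" "K \<subseteq> (\<Union>x\<in>P. ball x (d/2))"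
    using compactE_image[OF K(1), of K "\<lambda>x. ball x (d/2)"] by auto
  define s where "s x = {g \<in> holo \<Omega>. g ` (K \<inter> cball x (d/2)) \<subseteq> ball (f x) (e/2)}" for x
  define V where "V = holo \<Omega> \<inter> (\<Inter>x\<in>P. s x)"
  have op: "openin (holo_topology \<Omega>) (s x)" for x
  proof -
    have "compact (K \<inter> cball x (d/2))" "K \<inter> cball x (d/2) \<subseteq> \<Omega>" "open (ball (f x) (e/2))"
      using K by auto
    then show ?thesis
      unfolding holo_topology_def s_def by (intro topology_generated_by_Basis) blast
  qed
  have "openin (holo_topology \<Omega>) V"
  proof (cases "P = {}")
    case True
    then show ?thesis using openin_topspace[of "holo_topology \<Omega>"]
      by (simp add: V_def topspace_holo_topology)
  next
    case False
    then have "V = (\<Inter>x\<in>P. s x)" by (auto simp: V_def s_def)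
    then show ?thesis using op P(2) False by (auto intro!: openin_Inter)
  qed
  moreover have "f \<in> V"
  proof -
    have "f z \<in> ball (f x) (e/2)" if "x \<in> P" "z \<in> K" "dist x z \<le> d/2" for x z
    proof -
      have "dist x z < d" using that d(1) by simp
      then have "dist (f z) (f x) < e/3" using that P(1) d(2)[of x z] by (auto simp: dist_commute)
      then show ?thesis using e by (simp add: dist_commute)
    qed
    then show ?thesis using f by (auto simp: V_def s_def)
  qed
  moreover have "V \<subseteq> uniform_ball \<Omega> f K e"
  proof -
    have "dist (g z) (f z) < e" if g: "g \<in> V" and z: "z \<in> K" for g z
    proof -
      obtain x where x: "x \<in> P" "dist x z < d/2" using P(3) z by auto
      then have "dist (f x) (g z) < e/2" using g z by (auto simp: V_def s_def image_subset_iff)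
      moreover have "dist (f z) (f x) < e/3"
        using x z P(1) d(2)[of x z] d(1) by (auto simp: dist_commute)
      ultimately show ?thesis using dist_triangle[of "g z" "f z" "f x"] e
        by (simp add: dist_commute)
    qed
    then show ?thesis by (auto simp: uniform_ball_def V_def)
  qed
  ultimately show ?thesis by blast
qed

lemma dense_subset_holo_iff:
  "dense_subset (holo_topology \<Omega>) A \<longleftrightarrow> A \<subseteq> holo \<Omega> \<and>
     (\<forall>f\<in>holo \<Omega>. \<forall>K e. compact K \<and> K \<subseteq> \<Omega> \<and> e > 0 \<longrightarrow> (\<exists>g\<in>A. \<forall>z\<in>K. dist (g z) (f z) < e))"
  (is "?L \<longleftrightarrow> ?R")
proof
  assume L: ?L
  then have A: "A \<subseteq> holo \<Omega>" by (simp add: dense_subset_def topspace_holo_topology)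
  have "\<exists>g\<in>A. \<forall>z\<in>K. dist (g z) (f z) < e"
    if f: "f \<in> holo \<Omega>" and K: "compact K" "K \<subseteq> \<Omega>" and e: "e > 0" for f K e
  proof -
    obtain V where V: "openin (holo_topology \<Omega>) V" "f \<in> V" "V \<subseteq> uniform_ball \<Omega> f K e"
      using uniform_ball_contains_openin[OF f K e] by blast
    have "f \<in> holo_topology \<Omega> closure_of A"
      using L f by (simp add: dense_subset_def topspace_holo_topology)
    then obtain g where "g \<in> A" "g \<in> V" using V by (auto simp: in_closure_of)
    then show ?thesis using V by (auto simp: uniform_ball_def)
  qed
  with A show ?R by blast
next
  assume R: ?R
  have "f \<in> holo_topology \<Omega> closure_of A" if f: "f \<in> holo \<Omega>" for f
    unfolding in_closure_of
  proof (intro conjI allI impI)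
    show "f \<in> topspace (holo_topology \<Omega>)" using f by (simp add: topspace_holo_topology)
    fix T assume "f \<in> T \<and> openin (holo_topology \<Omega>) T"
    then obtain K e where K: "compact K" "K \<subseteq> \<Omega>" "e > 0" "uniform_ball \<Omega> f K e \<subseteq> T"
      using openin_holo_imp_uniform_ball by metis
    then obtain g where "g \<in> A" "\<forall>z\<in>K. dist (g z) (f z) < e" using R f by meson
    moreover from this have "g \<in> uniform_ball \<Omega> f K e" using R by (auto simp: uniform_ball_def)
    ultimately show "\<exists>y. y \<in> A \<and> y \<in> T" using K(4) by blast
  qed
  then show ?L using R closure_of_subset_topspace[of "holo_topology \<Omega>" A]
    by (auto simp: dense_subset_def topspace_holo_topology)
qed

lemma limitin_holo_topology:
  assumes l: "l \<in> holo \<Omega>" and g: "\<forall>\<^sub>F x in F. g x \<in> holo \<Omega>"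
    and lim: "\<And>K. compact K \<Longrightarrow> K \<subseteq> \<Omega> \<Longrightarrow> uniform_limit K g l F"
  shows "limitin (holo_topology \<Omega>) g l F"
  unfolding limitin_def
proof (intro conjI allI impI)
  show "l \<in> topspace (holo_topology \<Omega>)" using l by (simp add: topspace_holo_topology)
  fix U assume "openin (holo_topology \<Omega>) U \<and> l \<in> U"
  then obtain K e where K: "compact K" "K \<subseteq> \<Omega>" "e > 0" "uniform_ball \<Omega> l K e \<subseteq> U"
    using openin_holo_imp_uniform_ball by metis
  have "\<forall>\<^sub>F x in F. \<forall>z\<in>K. dist (g x z) (l z) < e"
    using lim[OF K(1,2)] K(3) by (simp add: uniform_limit_iff)
  then show "\<forall>\<^sub>F x in F. g x \<in> U"
    using g by eventually_elim (use K(4) in \<open>auto simp: uniform_ball_def\<close>)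
qed

lemma sum_fun_apply: "sum g A z = (\<Sum>i\<in>A. g i z)"
  for g :: "'i \<Rightarrow> 'a \<Rightarrow> 'b::comm_monoid_add"
  by (induction A rule: infinite_finite_induct) auto

lemma holo_add: "f \<in> holo \<Omega> \<Longrightarrow> g \<in> holo \<Omega> \<Longrightarrow> (\<lambda>z. f z + g z) \<in> holo \<Omega>"
  by (auto simp: holo_def intro: holomorphic_intros)

lemma holo_sum: "(\<And>i. i \<in> A \<Longrightarrow> g i \<in> holo \<Omega>) \<Longrightarrow> (\<lambda>z. \<Sum>i\<in>A. g i z) \<in> holo \<Omega>"
  by (auto simp: holo_def intro!: holomorphic_intros)

text \<open>Weierstrass's M-test in \<open>H(\<Omega>)\<close>, for an arbitrary index set.\<close>

lemma holomorphic_on_infsum: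
  assumes "open \<Omega>" and g: "\<And>i. i \<in> I \<Longrightarrow> g i holomorphic_on \<Omega>"
    and bound: "\<And>K. compact K \<Longrightarrow> K \<subseteq> \<Omega> \<Longrightarrow>
      \<exists>M. M summable_on I \<and> (\<forall>i\<in>I. \<forall>z\<in>K. norm (g i z) \<le> M i)"
  shows "(\<lambda>z. \<Sum>\<^sub>\<infinity>i\<in>I. g i z) holomorphic_on \<Omega>"
    and "\<And>K. compact K \<Longrightarrow> K \<subseteq> \<Omega> \<Longrightarrow>
      uniform_limit K (\<lambda>X z. \<Sum>i\<in>X. g i z) (\<lambda>z. \<Sum>\<^sub>\<infinity>i\<in>I. g i z) (finite_subsets_at_top I)"
proof -
  show lim: "uniform_limit K (\<lambda>X z. \<Sum>i\<in>X. g i z) (\<lambda>z. \<Sum>\<^sub>\<infinity>i\<in>I. g i z) (finite_subsets_at_top I)"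
    if K: "compact K" "K \<subseteq> \<Omega>" for K
  proof -
    obtain M where "M summable_on I" "\<forall>i\<in>I. \<forall>z\<in>K. norm (g i z) \<le> M i" using bound[OF K] by blast
    then show ?thesis by (intro Weierstrass_m_test_general[where M = M]) auto
  qed
  have "(\<lambda>z. \<Sum>\<^sub>\<infinity>i\<in>I. g i z) field_differentiable at z" if z: "z \<in> \<Omega>" for z
  proof -
    obtain r where r: "r > 0" "cball z r \<subseteq> \<Omega>" using \<open>open \<Omega>\<close> z open_contains_cball by blast
    have "\<forall>\<^sub>F X in finite_subsets_at_top I. continuous_on (cball z r) (\<lambda>z. \<Sum>i\<in>X. g i z) \<and>
            (\<lambda>z. \<Sum>i\<in>X. g i z) holomorphic_on ball z r"
    proof (rule eventually_finite_subsets_at_top_weakI)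
      fix X assume X: "finite X" "X \<subseteq> I"
      have "(\<lambda>z. \<Sum>i\<in>X. g i z) holomorphic_on \<Omega>"
        by (intro holomorphic_intros g) (use X in auto)
      then show "continuous_on (cball z r) (\<lambda>z. \<Sum>i\<in>X. g i z) \<and>
            (\<lambda>z. \<Sum>i\<in>X. g i z) holomorphic_on ball z r"
        by (meson ball_subset_cball holomorphic_on_imp_continuous_on holomorphic_on_subset order_trans r(2))
    qed
    then have "(\<lambda>z. \<Sum>\<^sub>\<infinity>i\<in>I. g i z) holomorphic_on ball z r"
      using holomorphic_uniform_limit[OF _ lim[OF compact_cball r(2)]] by auto
    then show ?thesis
      using r(1) by (meson centre_in_ball holomorphic_on_imp_differentiable_at open_ball)
  qed
  then show "(\<lambda>z. \<Sum>\<^sub>\<infinity>i\<in>I. g i z) holomorphic_on \<Omega>"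
    by (auto simp: holomorphic_on_def intro: field_differentiable_at_within)
qed

lemma holo_infsum:
  assumes "open \<Omega>" and g: "\<And>i. i \<in> I \<Longrightarrow> g i \<in> holo \<Omega>"
    and bound: "\<And>K. compact K \<Longrightarrow> K \<subseteq> \<Omega> \<Longrightarrow>
      \<exists>M. M summable_on I \<and> (\<forall>i\<in>I. \<forall>z\<in>K. norm (g i z) \<le> M i)"
  shows "(\<lambda>z. \<Sum>\<^sub>\<infinity>i\<in>I. g i z) \<in> holo \<Omega>"
proof -
  have "(\<lambda>z. \<Sum>\<^sub>\<infinity>i\<in>I. g i z) holomorphic_on \<Omega>"
    using g by (intro holomorphic_on_infsum(1) assms(1) bound) (auto simp: holo_def)
  then show ?thesis
    using g by (auto simp: holo_def intro!: infsum_0)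
qed

section \<open>Separated positions of positive lower density\<close>

text \<open>The ruler sequence 0, 1, 0, 2, 0, 1, 0, 3, ...: the exponent of 2 in \<open>n + 1\<close>. Each value is attained
  along an arithmetic progression, hence with positive density, while the average of the sequence stays bounded.\<close>

function ruler :: "nat \<Rightarrow> nat" where
  "ruler (2 * n) = 0"
| "ruler (2 * n + 1) = Suc (ruler n)"
  by (metis mult_2 oddE evenE, simp, presburger, simp)
termination by lexicographic_order

lemma ruler_sum_le: "(\<Sum>i<n. ruler i) \<le> n"
proof (induction n rule: less_induct)
  case (less n)
  have double: "(\<Sum>i<2*m. ruler i) = m + (\<Sum>i<m. ruler i)" for m
  proof (induction m)
    case (Suc m)
    then show ?case using ruler.simps(1)[of m] ruler.simps(2)[of m] by (simp del: ruler.simps)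
  qed simp
  have "n = 0 \<or> (n = 2 * (n div 2) \<and> n div 2 < n) \<or> n = 2 * (n div 2) + 1" by presburger
  then consider "n = 0" | m where "n = 2 * m" "m < n" | m where "n = 2 * m + 1" by blast
  then show ?case
  proof cases
    case 2
    then show ?thesis using less[of m] double[of m] by simp
  next
    case 3
    have "(\<Sum>i<m. ruler i) \<le> m"
      using less[of m] 3 by (cases "m = 0") auto
    then show ?thesis using 3 double[of m] ruler.simps(1)[of m] by (simp add: lessThan_Suc)
  qed simp
qed

lemma ruler_progression: "ruler (2 ^ Suc j * q + (2 ^ j - 1)) = j"
proof (induction j)
  case 0
  then show ?case using ruler.simps(1)[of q] by simp
next
  case (Suc j)
  obtain m where "(2::nat) ^ j = Suc m" using not0_implies_Suc[of "2 ^ j"] by auto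
  then have "2 ^ Suc (Suc j) * q + (2 ^ Suc j - 1) = 2 * (2 ^ Suc j * q + (2 ^ j - 1)) + (1::nat)"
    by (simp add: algebra_simps)
  then show ?case using ruler.simps(2) Suc.IH by presburger
qed

text \<open>The combinatorial core of frequent hypercyclicity. The positions \<open>r i\<close> carry labels \<open>\<nu> i\<close>; two
  positions are further apart than the gaps that both labels demand, and yet every label occurs with positive
  lower density, however fast the gaps \<open>N l\<close> grow with \<open>l\<close>. Labels are read off the ruler
  sequence through a function that postpones a label with a large gap to large, hence rare, ruler values, so that
  the average gap is bounded.\<close>

lemma exists_separated_positions:
  fixes N :: "nat \<Rightarrow> nat"
  assumes N: "\<And>l. N l \<ge> 1"
  obtains \<nu> r :: "nat \<Rightarrow> nat" where
    "\<And>i. r i \<ge> N (\<nu> i) + i"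
    "\<And>n m. n < m \<Longrightarrow> r m + 1 \<ge> r n + N (\<nu> n) + N (\<nu> m) + (m - n)"
    "\<And>l. \<exists>D\<ge>1. \<exists>i. strict_mono i \<and> (\<forall>q. \<nu> (i q) = l \<and> r (i q) \<le> D * (q + 1))"
proof -
  \<comment> \<open>Each label \<open>l\<close> is proposed infinitely often and accepted once the ruler value reaches its gap.\<close>
  define h where "h v = (let l = fst (prod_decode v) in if N l \<le> v then l else 0)" for v
  have Nh: "N (h v) \<le> v + N 0" for v by (simp add: h_def Let_def)
  define \<nu> where "\<nu> i = h (ruler i)" for i
  define b where "b i = N (\<nu> i)" for i
  have b: "b i \<ge> 1" for i using N[of "\<nu> i"] by (simp add: b_def)
  define r where "r i = (\<Sum>k<i. 2 * b k) + b i" for i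
  have sb: "(\<Sum>k<i. 2 * b k) \<ge> i" for i
  proof (induction i)
    case (Suc i)
    then show ?case using b[of i] by simp
  qed simp
  have step: "r (Suc n) = r n + b n + b (Suc n)" for n by (simp add: r_def)
  have pos1: "r i \<ge> N (\<nu> i) + i" for i using sb[of i] by (simp add: r_def b_def)
  have pos2: "r m + 1 \<ge> r n + N (\<nu> n) + N (\<nu> m) + (m - n)" if "n < m" for n m
    proof -
      have "r (Suc (n + k)) + 1 \<ge> r n + b n + b (Suc (n + k)) + (Suc (n + k) - n)" for k
      proof (induction k)
        case 0
        then show ?case using step[of n] by simp
      next
        case (Suc k)
        then show ?case using step[of "Suc (n + k)"] b[of "Suc (n + k)"] by simp
      qed
      from this[of "m - Suc n"] that show ?thesis by (simp add: b_def)
    qed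
  have pos3: "\<exists>D\<ge>1. \<exists>i. strict_mono i \<and> (\<forall>q. \<nu> (i q) = l \<and> r (i q) \<le> D * (q + 1))" for l
    proof -
      \<comment> \<open>A ruler value at which \<open>l\<close> is accepted.\<close>
      define j where "j = prod_encode (l, N l)"
      have j: "h j = l" using le_prod_encode_2[of "N l" l] by (simp add: h_def j_def)
      define i where "i q = 2 ^ Suc j * q + (2 ^ j - 1)" for q :: nat
      have \<nu>: "\<nu> (i q) = l" for q
        unfolding \<nu>_def i_def ruler_progression by (rule j)
      have mono: "strict_mono i" unfolding i_def by (intro strict_monoI add_strict_right_mono mult_strict_left_mono) auto
      define A where "A = 2 * (1 + N 0)"
      have r_le: "r n \<le> A * (n + 1)" for n
      proof -
        have "r n \<le> (\<Sum>k<Suc n. 2 * b k)" by (simp add: r_def)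
        also have "\<dots> \<le> (\<Sum>k<Suc n. 2 * (ruler k + N 0))"
          unfolding b_def \<nu>_def by (intro sum_mono mult_left_mono Nh) simp
        also have "\<dots> = 2 * (\<Sum>k<Suc n. ruler k) + 2 * N 0 * (n + 1)"
          by (simp only: sum_distrib_left[symmetric] sum.distrib) simp
        also have "\<dots> \<le> A * (n + 1)"
          using ruler_sum_le[of "Suc n"] by (simp add: A_def algebra_simps)
        finally show ?thesis .
      qed
      have "r (i q) \<le> (A * 2 ^ Suc j) * (q + 1)" for q
      proof -
        have "(2::nat) ^ j \<ge> 1" by simp
        then have "i q + 1 \<le> 2 ^ Suc j * (q + 1)" unfolding i_def by (simp add: algebra_simps)
        then have "A * (i q + 1) \<le> A * (2 ^ Suc j * (q + 1))" by (rule mult_left_mono) simp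
        then show ?thesis using r_le[of "i q"] by (simp only: mult.assoc)
      qed
      moreover have "A * 2 ^ Suc j \<ge> 1" by (simp add: A_def Suc_le_eq)
      ultimately show ?thesis using mono \<nu> by blast
    qed
  show ?thesis by (rule that[of \<nu> r, OF pos1 pos2 pos3])
qed

lemma positive_lower_density:
  fixes r :: "nat \<Rightarrow> nat"
  assumes mono: "strict_mono r" and D: "D \<ge> 1" "\<And>q. r q \<le> D * (q + 1)" and P: "\<And>q. P (r q)"
  shows "liminf (\<lambda>N. ereal (real (card {n. n \<le> N \<and> P n}) / real (N + 1))) > 0"
proof -
  have "ereal (1 / (2 * real D)) \<le> ereal (real (card {n. n \<le> N \<and> P n}) / real (N + 1))"
    if N: "N \<ge> 2 * D" for N
  proof -
    have "r ` {..<N div D} \<subseteq> {n. n \<le> N \<and> P n}"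
    proof clarsimp
      fix q assume "q < N div D"
      then have "D * (q + 1) \<le> D * (N div D)" by (intro mult_left_mono) auto
      also have "\<dots> \<le> N" by simp
      finally show "r q \<le> N \<and> P (r q)" using D(2)[of q] P by auto
    qed
    then have "card (r ` {..<N div D}) \<le> card {n. n \<le> N \<and> P n}"
      by (intro card_mono) auto
    then have c: "N div D \<le> card {n. n \<le> N \<and> P n}"
      using mono by (simp add: card_image strict_mono_imp_inj_on inj_on_subset)
    have "N = D * (N div D) + N mod D" "N mod D < D" using D(1) by simp_all
    then have "N + 1 \<le> 2 * (D * (N div D))" using N by linarith
    then have "real (N + 1) \<le> real (2 * (D * (N div D)))" by (rule of_nat_mono)
    then have "real N + 1 \<le> 2 * real D * real (N div D)" by simp
    then have "1 / (2 * real D) \<le> real (N div D) / (real N + 1)"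
      using D(1) by (simp add: field_simps)
    also have "\<dots> \<le> real (card {n. n \<le> N \<and> P n}) / (real N + 1)"
      using c by (intro divide_right_mono) auto
    finally show ?thesis by (simp add: add.commute)
  qed
  then have "ereal (1 / (2 * real D)) \<le> liminf (\<lambda>N. ereal (real (card {n. n \<le> N \<and> P n}) / real (N + 1)))"
    by (intro Liminf_bounded) (auto simp: eventually_sequentially)
  moreover have "ereal (1 / (2 * real D)) > 0" using D(1) by simp
  ultimately show ?thesis by order
qed

section \<open>Dynamics of operators with dense homoclinic orbits\<close>

text \<open>A two-sided orbit that tends to zero in both directions, at a geometric rate on each compact set. The backward
  half replaces the right inverse of the Frequent Hypercyclicity Criterion, and indexing by the integers
  treats both halves by the same estimates.\<close>

definition homoclinic_orbit ::
    "complex set \<Rightarrow> ((complex \<Rightarrow> complex) \<Rightarrow> (complex \<Rightarrow> complex)) \<Rightarrow>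
     (int \<Rightarrow> complex \<Rightarrow> complex) \<Rightarrow> bool" where
  "homoclinic_orbit \<Omega> T x \<longleftrightarrow> (\<forall>d. x d \<in> holo \<Omega> \<and> T (x d) = x (d + 1)) \<and>
     (\<forall>K. compact K \<and> K \<subseteq> \<Omega> \<longrightarrow> (\<exists>C. \<forall>d. \<forall>z\<in>K. norm (x d z) \<le> C * (1 / 2) ^ nat \<bar>d\<bar>))"

lemma homoclinic_orbitD:
  assumes "homoclinic_orbit \<Omega> T x"
  shows "x d \<in> holo \<Omega>" "T (x d) = x (d + 1)"
  using assms by (auto simp: homoclinic_orbit_def)

lemma homoclinic_orbit_bound:
  assumes "homoclinic_orbit \<Omega> T x" "compact K" "K \<subseteq> \<Omega>"
  obtains C where "C > 0" "\<And>d z. z \<in> K \<Longrightarrow> norm (x d z) \<le> C * (1 / 2) ^ nat \<bar>d\<bar>"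
proof -
  have "\<exists>C. \<forall>d. \<forall>z\<in>K. norm (x d z) \<le> C * (1 / 2) ^ nat \<bar>d\<bar>"
    using assms by (simp add: homoclinic_orbit_def)
  then obtain C where C: "\<And>d z. z \<in> K \<Longrightarrow> norm (x d z) \<le> C * (1 / 2) ^ nat \<bar>d\<bar>"
    by blast
  have "norm (x d z) \<le> (\<bar>C\<bar> + 1) * (1 / 2) ^ nat \<bar>d\<bar>" if "z \<in> K" for d z
  proof -
    have "C * (1 / 2) ^ nat \<bar>d\<bar> \<le> (\<bar>C\<bar> + 1) * (1 / 2) ^ nat \<bar>d\<bar>"
      by (intro mult_right_mono) auto
    then show ?thesis using C[OF that, of d] by linarith
  qed
  then show ?thesis using that[of "\<bar>C\<bar> + 1"] by auto
qed

lemma homoclinic_orbit_funpow: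
  assumes "homoclinic_orbit \<Omega> T x"
  shows "(T ^^ n) (x d) = x (d + int n)"
  by (induction n) (use homoclinic_orbitD(2)[OF assms] in \<open>simp_all add: algebra_simps\<close>)

lemma homoclinic_orbit_shift:
  assumes x: "homoclinic_orbit \<Omega> T x"
  shows "homoclinic_orbit \<Omega> T (\<lambda>d. x (d - 1))"
proof -
  have "\<exists>C. \<forall>d. \<forall>z\<in>K. norm (x (d - 1) z) \<le> C * (1 / 2) ^ nat \<bar>d\<bar>"
    if K: "compact K" "K \<subseteq> \<Omega>" for K
  proof -
    obtain C where C: "C > 0" "\<And>d z. z \<in> K \<Longrightarrow> norm (x d z) \<le> C * (1 / 2) ^ nat \<bar>d\<bar>"
      by (rule homoclinic_orbit_bound[OF x K]) (rule that)
    have "norm (x (d - 1) z) \<le> (2 * C) * (1 / 2) ^ nat \<bar>d\<bar>" if "z \<in> K" for d z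
    proof -
      have "(1 / 2 :: real) ^ Suc (nat \<bar>d - 1\<bar>) \<le> (1 / 2) ^ nat \<bar>d\<bar>"
        by (intro power_decreasing) auto
      then have "C * (1 / 2) ^ nat \<bar>d - 1\<bar> \<le> C * (2 * (1 / 2) ^ nat \<bar>d\<bar>)"
        using C(1) by (intro mult_left_mono) auto
      then show ?thesis using C(2)[OF that, of "d - 1"] by (simp add: mult_ac)
    qed
    then show ?thesis by blast
  qed
  then show ?thesis
    using homoclinic_orbitD[OF x] by (simp add: homoclinic_orbit_def)
qed

lemma summable_half_power_int: "(\<lambda>d::int. (1 / 2 :: real) ^ nat \<bar>d\<bar>) summable_on UNIV"
proof -
  have nat: "(\<lambda>n. (1 / 2 :: real) ^ n) summable_on UNIV"
    by (simp add: summable_on_UNIV_nonneg_real_iff)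
  have "(\<lambda>d. (1 / 2 :: real) ^ nat \<bar>d\<bar>) summable_on range int"
    by (subst summable_on_reindex) (use nat in \<open>auto simp: o_def\<close>)
  moreover have "(\<lambda>d. (1 / 2 :: real) ^ nat \<bar>d\<bar>) summable_on range (\<lambda>n. - int n)"
    by (subst summable_on_reindex) (use nat in \<open>auto simp: o_def inj_on_def\<close>)
  moreover have "(UNIV :: int set) = range int \<union> range (\<lambda>n. - int n)"
    by (auto simp: image_iff) (metis int_cases2)
  ultimately show ?thesis using summable_on_union by metis
qed

definition two_sided_sum :: real where
  "two_sided_sum = (\<Sum>\<^sub>\<infinity>d::int. (1 / 2) ^ nat \<bar>d\<bar>)"

text \<open>All series below are dominated by a geometric series in the distance \<open>\<bar>h i\<bar>\<close> to a reference time; distinct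
  indices have distinct signed distances.\<close>

lemma norm_infsum_le_two_sided:
  fixes f :: "'i \<Rightarrow> complex" and h :: "'i \<Rightarrow> int"
  assumes h: "inj_on h I" and c: "c \<ge> 0"
    and f: "\<And>i. i \<in> I \<Longrightarrow> norm (f i) \<le> c * (1 / 2) ^ nat \<bar>h i\<bar>"
  shows "(\<lambda>i. c * (1 / 2) ^ nat \<bar>h i\<bar>) summable_on I"
    and "f summable_on I" "norm (infsum f I) \<le> c * two_sided_sum"
proof -
  let ?w = "\<lambda>d::int. (1 / 2 :: real) ^ nat \<bar>d\<bar>"
  have "?w summable_on h ` I" using summable_half_power_int by (rule summable_on_subset) simp
  then have sw: "(\<lambda>i. ?w (h i)) summable_on I" by (simp add: summable_on_reindex[OF h] o_def)
  then show s: "(\<lambda>i. c * (1 / 2) ^ nat \<bar>h i\<bar>) summable_on I" by (rule summable_on_cmult_right)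
  have "(\<lambda>i. norm (f i)) summable_on I"
    using s by (rule summable_on_comparison_test) (use f in auto)
  then show fs: "f summable_on I" by (rule abs_summable_summable)
  have "norm (infsum f I) \<le> (\<Sum>\<^sub>\<infinity>i\<in>I. c * ?w (h i))"
    using fs s f by (intro norm_infsum_le[OF has_sum_infsum has_sum_infsum]) auto
  also have "\<dots> = c * infsum ?w (h ` I)" by (simp add: infsum_cmult_right' infsum_reindex[OF h] o_def)
  also have "\<dots> \<le> c * two_sided_sum"
    unfolding two_sided_sum_def
    by (intro mult_left_mono infsum_mono2 c summable_half_power_int
        summable_on_subset[OF summable_half_power_int]) auto
  finally show "norm (infsum f I) \<le> c * two_sided_sum" .
qed

lemma eventually_geometric_less:
  fixes C e :: real
  assumes "e > 0"
  shows "\<exists>n0. \<forall>n\<ge>n0. C * (1 / 2) ^ n < e"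
proof -
  have "(\<lambda>n. C * (1 / 2) ^ n) \<longlonglongrightarrow> C * 0"
    by (intro tendsto_mult tendsto_const LIMSEQ_power_zero) auto
  then have "\<forall>\<^sub>F n in sequentially. C * (1 / 2) ^ n < e"
    using assms by (intro order_tendstoD) auto
  then show ?thesis by (simp add: eventually_sequentially)
qed

text \<open>Since \<open>T f z\<close> is a multiple of one value of \<open>f\<close>, the operator commutes with every pointwise
  sum (\<open>T_infsum\<close>); this takes the place of continuity in the dynamical arguments.\<close>

locale weighted_composition =
  fixes \<Omega> :: "complex set" and \<omega> \<psi> :: "complex \<Rightarrow> complex"
  assumes open_domain: "open \<Omega>"
    and multiplier_holomorphic: "\<omega> holomorphic_on \<Omega>"
    and symbol_holomorphic: "\<psi> holomorphic_on \<Omega>"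
    and symbol_into: "\<psi> ` \<Omega> \<subseteq> \<Omega>"
begin

abbreviation "T \<equiv> wcomp \<Omega> \<omega> \<psi>"
abbreviation "X \<equiv> holo_topology \<Omega>"

lemma T_holo: "f \<in> holo \<Omega> \<Longrightarrow> T f \<in> holo \<Omega>"
  using wcomp_in_holo multiplier_holomorphic symbol_holomorphic symbol_into by blast

lemma T_funpow_holo: "f \<in> holo \<Omega> \<Longrightarrow> (T ^^ n) f \<in> holo \<Omega>"
  by (induction n) (auto intro: T_holo)

lemma T_funpow_add: "(T ^^ n) (f + g) = (T ^^ n) f + (T ^^ n) g"
  by (induction n) (simp_all only: funpow.simps o_apply id_apply wcomp_add)

lemma T_infsum: "T (\<lambda>z. \<Sum>\<^sub>\<infinity>i\<in>I. g i z) = (\<lambda>z. \<Sum>\<^sub>\<infinity>i\<in>I. T (g i) z)"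
  by (auto simp: wcomp_def infsum_cmult_right')

lemma T_funpow_infsum: "(T ^^ n) (\<lambda>z. \<Sum>\<^sub>\<infinity>i\<in>I. g i z) = (\<lambda>z. \<Sum>\<^sub>\<infinity>i\<in>I. (T ^^ n) (g i) z)"
  by (induction n) (auto simp: T_infsum)

end

locale homoclinically_dense = weighted_composition +
  fixes x :: "nat \<Rightarrow> int \<Rightarrow> complex \<Rightarrow> complex"
  assumes homoclinic: "\<And>j. homoclinic_orbit \<Omega> T (x j)"
    and dense: "dense_subset X (range (\<lambda>j. x j 0))"
begin

lemma dense_approx:
  assumes "f \<in> holo \<Omega>" "compact K" "K \<subseteq> \<Omega>" "e > 0"
  obtains j where "\<And>z. z \<in> K \<Longrightarrow> dist (x j 0 z) (f z) < e"
proof -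
  have "\<exists>g\<in>range (\<lambda>j. x j 0). \<forall>z\<in>K. dist (g z) (f z) < e"
    using dense[unfolded dense_subset_holo_iff, THEN conjunct2, rule_format, OF assms(1)] assms(2-4)
    by simp
  then show ?thesis using that by auto
qed

lemma open_contains_neighbourhood:
  assumes "openin X U" "U \<noteq> {}"
  obtains j K e where "compact K" "K \<subseteq> \<Omega>" "e > 0" "uniform_ball \<Omega> (x j 0) K e \<subseteq> U"
proof -
  obtain f where "f \<in> U" using assms by blast
  then have "f \<in> X closure_of range (\<lambda>j. x j 0)"
    using dense openin_subset[OF assms(1)] by (auto simp: dense_subset_def)
  then obtain j where "x j 0 \<in> U" using \<open>f \<in> U\<close> assms(1) by (auto simp: in_closure_of)
  then show ?thesis using openin_holo_imp_uniform_ball[OF assms(1)] that by metis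
qed

text \<open>If \<open>u\<close> and \<open>v\<close> have homoclinic orbits, then \<open>u\<close> plus the \<open>k\<close>-th backward iterate of \<open>v\<close> is close to
  \<open>u\<close>, and \<open>T\<^sup>k\<close> sends it to \<open>v\<close> plus a small function.\<close>

theorem mixing: "mixing X T"
  unfolding mixing_def
proof (intro allI impI)
  fix U V assume "openin X U \<and> U \<noteq> {} \<and> openin X V \<and> V \<noteq> {}"
  then have UV: "openin X U" "U \<noteq> {}" "openin X V" "V \<noteq> {}" by auto
  obtain i K e where U: "compact K" "K \<subseteq> \<Omega>" "e > 0" "uniform_ball \<Omega> (x i 0) K e \<subseteq> U"
    by (rule open_contains_neighbourhood[OF UV(1,2)]) (rule that)
  obtain j L d where V: "compact L" "L \<subseteq> \<Omega>" "d > 0" "uniform_ball \<Omega> (x j 0) L d \<subseteq> V"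
    by (rule open_contains_neighbourhood[OF UV(3,4)]) (rule that)
  obtain C where C: "C > 0" "\<And>k z. z \<in> L \<Longrightarrow> norm (x i k z) \<le> C * (1 / 2) ^ nat \<bar>k\<bar>"
    by (rule homoclinic_orbit_bound[OF homoclinic V(1,2)]) (rule that)
  obtain D where D: "D > 0" "\<And>k z. z \<in> K \<Longrightarrow> norm (x j k z) \<le> D * (1 / 2) ^ nat \<bar>k\<bar>"
    by (rule homoclinic_orbit_bound[OF homoclinic U(1,2)]) (rule that)
  obtain n1 where n1: "\<And>n. n \<ge> n1 \<Longrightarrow> C * (1 / 2) ^ n < d"
    using eventually_geometric_less[OF V(3)] by blast
  obtain n2 where n2: "\<And>n. n \<ge> n2 \<Longrightarrow> D * (1 / 2) ^ n < e"
    using eventually_geometric_less[OF U(3)] by blast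
  show "\<exists>n. \<forall>k\<ge>n. (T ^^ k) ` U \<inter> V \<noteq> {}"
  proof (intro exI[of _ "max n1 n2"] allI impI)
    fix k assume k: "k \<ge> max n1 n2"
    \<comment> \<open>Start near \<open>x i 0\<close> and arrive at \<open>x j 0\<close> at time \<open>k\<close>.\<close>
    define w where "w = x i 0 + x j (- int k)"
    have "w \<in> uniform_ball \<Omega> (x i 0) K e"
    proof -
      have "w \<in> holo \<Omega>" unfolding w_def plus_fun_def
        by (intro holo_add homoclinic_orbitD(1)[OF homoclinic])
      moreover have "dist (w z) (x i 0 z) < e" if "z \<in> K" for z
        using D(2)[OF that, of "- int k"] n2[of k] k by (simp add: w_def dist_norm)
      ultimately show ?thesis by (simp add: uniform_ball_def)
    qed
    moreover have "(T ^^ k) w \<in> uniform_ball \<Omega> (x j 0) L d"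
    proof -
      have Tw: "(T ^^ k) w = x i (int k) + x j 0"
        by (simp add: w_def T_funpow_add homoclinic_orbit_funpow[OF homoclinic])
      have "(T ^^ k) w \<in> holo \<Omega>" unfolding Tw plus_fun_def
        by (intro holo_add homoclinic_orbitD(1)[OF homoclinic])
      moreover have "dist ((T ^^ k) w z) (x j 0 z) < d" if "z \<in> L" for z
        using C(2)[OF that, of "int k"] n1[of k] k by (simp add: Tw dist_norm)
      ultimately show ?thesis by (simp add: uniform_ball_def)
    qed
    ultimately show "(T ^^ k) ` U \<inter> V \<noteq> {}" using U(4) V(4) by blast
  qed
qed

text \<open>Summing a homoclinic orbit over all multiples of \<open>r\<close> yields an \<open>r\<close>-periodic point, and for large \<open>r\<close>
  only the term at time 0 matters.\<close>

theorem chaotic: "chaotic X T"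
  unfolding chaotic_def
proof
  show "topologically_transitive X T"
    using mixing unfolding mixing_def topologically_transitive_def by (meson order_refl)
  have "\<exists>g\<in>{f \<in> topspace X. \<exists>r\<ge>1. (T ^^ r) f = f}. \<forall>z\<in>K. dist (g z) (f z) < e"
    if f: "f \<in> holo \<Omega>" and K: "compact K" "K \<subseteq> \<Omega>" and e: "e > 0" for f K e
  proof -
    obtain j where j: "\<And>z. z \<in> K \<Longrightarrow> dist (x j 0 z) (f z) < e / 2"
      using dense_approx[OF f K, of "e / 2"] e by auto
    have bound: "\<exists>C\<ge>0. \<forall>d z. z \<in> L \<longrightarrow> norm (x j d z) \<le> C * (1 / 2) ^ nat \<bar>d\<bar>"
      if L: "compact L" "L \<subseteq> \<Omega>" for L
    proof -
      obtain C where "C > 0" "\<And>d z. z \<in> L \<Longrightarrow> norm (x j d z) \<le> C * (1 / 2) ^ nat \<bar>d\<bar>"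
        by (rule homoclinic_orbit_bound[OF homoclinic L]) (rule that)
      then show ?thesis by (intro exI[of _ C]) auto
    qed
    obtain C where C: "C \<ge> 0" "\<And>d z. z \<in> K \<Longrightarrow> norm (x j d z) \<le> C * (1 / 2) ^ nat \<bar>d\<bar>"
      using bound[OF K] by auto
    obtain m where m: "2 * (C * two_sided_sum) * (1 / 2) ^ m < e"
      using eventually_geometric_less[OF e] by blast
    define r where "r = Suc m"
    define p where "p = (\<lambda>z. \<Sum>\<^sub>\<infinity>d::int. x j (d * int r) z)"
    \<comment> \<open>Since \<open>r = m + 1\<close>, passing from time \<open>d\<close> to time \<open>d * r\<close> gains the factor \<open>(1 / 2)\<^sup>m\<close> if \<open>d \<noteq> 0\<close>.\<close>
    have decay: "norm (x j (d * int r) z) \<le> (C * (1 / 2) ^ k) * (1 / 2) ^ nat \<bar>d\<bar>"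
      if z: "norm (x j (d * int r) z) \<le> C * (1 / 2) ^ nat \<bar>d * int r\<bar>"
        and C: "C \<ge> 0" and k: "nat \<bar>d\<bar> + k \<le> nat \<bar>d * int r\<bar>" for d z k C
    proof -
      have "C * (1 / 2) ^ nat \<bar>d * int r\<bar> \<le> C * (1 / 2) ^ (nat \<bar>d\<bar> + k)"
        using C k by (intro mult_left_mono power_decreasing) auto
      then show ?thesis using z by (simp add: power_add mult_ac)
    qed
    have expand: "nat \<bar>d * int r\<bar> = nat \<bar>d\<bar> + m * nat \<bar>d\<bar>" for d
    proof -
      have "nat \<bar>d * int r\<bar> = nat \<bar>d\<bar> * r" by (simp add: abs_mult nat_mult_distrib)
      then show ?thesis by (simp add: r_def)
    qed
    have "p \<in> holo \<Omega>" unfolding p_def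
    proof (rule holo_infsum[OF open_domain])
      show "x j (d * int r) \<in> holo \<Omega>" for d by (rule homoclinic_orbitD(1)[OF homoclinic])
      fix L assume L: "compact L" "L \<subseteq> \<Omega>"
      then obtain B where B: "B \<ge> 0" "\<And>d z. z \<in> L \<Longrightarrow> norm (x j d z) \<le> B * (1 / 2) ^ nat \<bar>d\<bar>"
        using bound[OF L] by blast
      have "norm (x j (d * int r) z) \<le> B * (1 / 2) ^ nat \<bar>d\<bar>" if "z \<in> L" for d z
        using decay[OF B(2)[OF that] B(1), of d 0] expand[of d] by simp
      then show "\<exists>M. M summable_on UNIV \<and> (\<forall>d\<in>UNIV. \<forall>z\<in>L. norm (x j (d * int r) z) \<le> M d)"
        using summable_on_cmult_right[OF summable_half_power_int, of B] by blast
    qed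
    moreover have "(T ^^ r) p = p"
    proof
      fix z
      have "(T ^^ r) p z = (\<Sum>\<^sub>\<infinity>d. x j ((d + 1) * int r) z)"
        by (simp add: p_def T_funpow_infsum homoclinic_orbit_funpow[OF homoclinic] algebra_simps)
      also have "\<dots> = p z"
        unfolding p_def
        by (rule infsum_reindex_bij_witness[where i = "\<lambda>d. d - 1" and j = "\<lambda>d. d + 1"]) auto
      finally show "(T ^^ r) p z = p z" .
    qed
    moreover have "dist (p z) (f z) < e" if z: "z \<in> K" for z
    proof -
      let ?t = "\<lambda>d::int. x j (d * int r) z"
      have b: "norm (?t d) \<le> (C * (1 / 2) ^ m) * (1 / 2) ^ nat \<bar>d\<bar>" if "d \<in> UNIV - {0}" for d
      proof (rule decay[OF C(2)[OF z] C(1)])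
        have "m * 1 \<le> m * nat \<bar>d\<bar>" using that by (intro mult_left_mono) auto
        then show "nat \<bar>d\<bar> + m \<le> nat \<bar>d * int r\<bar>" using expand[of d] by simp
      qed
      note sums = norm_infsum_le_two_sided[where h = "\<lambda>d. d" and f = ?t, OF _ _ b]
      have "p z = infsum ?t (insert 0 (UNIV - {0}))" by (simp add: p_def insert_UNIV)
      also have "\<dots> = x j 0 z + infsum ?t (UNIV - {0})"
        by (subst infsum_insert) (use sums(2) C(1) in auto)
      finally have "p z - x j 0 z = infsum ?t (UNIV - {0})" by simp
      moreover have "norm (infsum ?t (UNIV - {0})) \<le> C * (1 / 2) ^ m * two_sided_sum"
        using sums(3) C(1) by auto
      ultimately have "2 * dist (p z) (x j 0 z) < e" using m by (simp add: dist_norm mult_ac)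
      then show ?thesis using j[OF z] dist_triangle[of "p z" "f z" "x j 0 z"] by simp
    qed
    ultimately show ?thesis
      by (intro bexI[of _ p]) (auto simp: topspace_holo_topology r_def intro!: exI[of _ "Suc m"])
  qed
  then show "dense_subset X {f \<in> topspace X. \<exists>r\<ge>1. (T ^^ r) f = f}"
    unfolding dense_subset_holo_iff by (auto simp: topspace_holo_topology)
qed

text \<open>The frequently hypercyclic vector superposes homoclinic orbits, the \<open>i\<close>-th one delayed by \<open>r i\<close>. At time \<open>r n\<close>
  the \<open>n\<close>-th orbit passes through its centre, while all others are so far from theirs that their total is
  small.\<close>

theorem frequently_hypercyclic: "frequently_hypercyclic X T"
proof -
  obtain K where K: "\<And>m. compact (K m)" "\<And>m. K m \<subseteq> \<Omega>"
      "\<And>m. K m \<subseteq> interior (K (Suc m))" "\<Union>(range K) = \<Omega>"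
      "\<And>L. \<lbrakk>compact L; L \<subseteq> \<Omega>\<rbrakk> \<Longrightarrow> \<exists>m0. \<forall>m\<ge>m0. L \<subseteq> K m"
    by (rule open_Union_compact_subsets[OF open_domain]) (rule that)
  \<comment> \<open>An enumeration in which every orbit occurs infinitely often.\<close>
  define y where "y l = x (fst (prod_decode l))" for l
  have y: "homoclinic_orbit \<Omega> T (y l)" for l by (simp add: y_def homoclinic)
  have ex: "\<exists>C>0. \<forall>d z. z \<in> K m \<longrightarrow> norm (y k d z) \<le> C * (1 / 2) ^ nat \<bar>d\<bar>" for k m
  proof -
    obtain C where "C > 0" "\<And>d z. z \<in> K m \<Longrightarrow> norm (y k d z) \<le> C * (1 / 2) ^ nat \<bar>d\<bar>"
      by (rule homoclinic_orbit_bound[OF y K(1,2)]) (rule that)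
    then show ?thesis by (intro exI[of _ C]) auto
  qed
  define C where "C k m = (SOME C. C > 0 \<and> (\<forall>d z. z \<in> K m \<longrightarrow> norm (y k d z) \<le> C * (1 / 2) ^ nat \<bar>d\<bar>))" for k m
  have "C k m > 0 \<and> (\<forall>d z. z \<in> K m \<longrightarrow> norm (y k d z) \<le> C k m * (1 / 2) ^ nat \<bar>d\<bar>)" for k m
    unfolding C_def by (rule someI_ex) (rule ex)
  then have C: "\<And>k m. C k m > 0"
      "\<And>k m d z. z \<in> K m \<Longrightarrow> norm (y k d z) \<le> C k m * (1 / 2) ^ nat \<bar>d\<bar>"
    by auto
  define c where "c l = (\<Sum>k\<le>l. \<Sum>m\<le>l. C k m)" for l
  have c: "norm (y k d z) \<le> c l * (1 / 2) ^ nat \<bar>d\<bar>" if "k \<le> l" "m \<le> l" "z \<in> K m" for k l m d z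
  proof -
    have "C k m \<le> (\<Sum>m\<le>l. C k m)" using that C(1) by (intro member_le_sum) (auto intro: less_imp_le)
    also have "\<dots> \<le> c l" unfolding c_def
      using that C(1) by (intro member_le_sum[of k "{..l}" "\<lambda>k. \<Sum>m\<le>l. C k m"]) (auto intro!: sum_nonneg simp: less_imp_le)
    finally have "C k m * (1 / 2) ^ nat \<bar>d\<bar> \<le> c l * (1 / 2) ^ nat \<bar>d\<bar>" by (intro mult_right_mono) auto
    then show ?thesis using C(2)[OF that(3), of k d] by linarith
  qed
  have c_pos: "c l > 0" for l unfolding c_def using C(1) by (intro sum_pos) auto
  \<comment> \<open>At distance \<open>N\<close> or more from time 0, the orbits with labels up to \<open>l\<close> are at most \<open>(1 / 2)\<^sup>l\<close> on \<open>K l\<close>.\<close>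
  have "\<exists>N\<ge>1. c l * (1 / 2) ^ N \<le> (1 / 2) ^ l" for l
  proof -
    obtain n where "\<And>k. k \<ge> n \<Longrightarrow> c l * (1 / 2) ^ k < (1 / 2) ^ l"
      using eventually_geometric_less[of "(1 / 2) ^ l" "c l"] by auto
    from this[of "Suc n"] show ?thesis by (intro exI[of _ "Suc n"]) simp
  qed
  then obtain N where N: "\<And>l. N l \<ge> 1" "\<And>l. c l * (1 / 2) ^ N l \<le> (1 / 2) ^ l" by metis
  obtain \<nu> r where r: "\<And>i. r i \<ge> N (\<nu> i) + i"
      "\<And>n m. n < m \<Longrightarrow> r m + 1 \<ge> r n + N (\<nu> n) + N (\<nu> m) + (m - n)"
      "\<And>l. \<exists>D\<ge>1. \<exists>i. strict_mono i \<and> (\<forall>q. \<nu> (i q) = l \<and> r (i q) \<le> D * (q + 1))"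
    by (rule exists_separated_positions[OF N(1)]) (rule that)
  have sm: "strict_mono r"
  proof (rule strict_mono_Suc_iff[THEN iffD2], rule allI)
    show "r n < r (Suc n)" for n using r(2)[of n "Suc n"] N(1)[of "\<nu> n"] N(1)[of "\<nu> (Suc n)"] by simp
  qed
  have far: "norm (y (\<nu> i) d z) \<le> (1 / 2) ^ max (\<nu> i) m * (1 / 2) ^ k"
    if z: "z \<in> K m" and d: "nat \<bar>d\<bar> \<ge> N (max (\<nu> i) m) + k" for i m k d z
  proof -
    let ?l = "max (\<nu> i) m"
    have "norm (y (\<nu> i) d z) \<le> c ?l * (1 / 2) ^ nat \<bar>d\<bar>" by (rule c[OF _ _ z]) auto
    also have "\<dots> \<le> c ?l * (1 / 2) ^ (N ?l + k)"
      using c_pos[of ?l] d by (intro mult_left_mono power_decreasing) auto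
    also have "\<dots> = (c ?l * (1 / 2) ^ N ?l) * (1 / 2) ^ k" by (simp add: power_add)
    also have "\<dots> \<le> (1 / 2) ^ ?l * (1 / 2) ^ k" by (intro mult_right_mono N(2)) auto
    finally show ?thesis .
  qed
  define f where "f = (\<lambda>z. \<Sum>\<^sub>\<infinity>i. y (\<nu> i) (- int (r i)) z)"
  have "f \<in> holo \<Omega>" unfolding f_def
  proof (rule holo_infsum[OF open_domain])
    show "y (\<nu> i) (- int (r i)) \<in> holo \<Omega>" for i by (rule homoclinic_orbitD(1)[OF y])
    fix L assume L: "compact L" "L \<subseteq> \<Omega>"
    obtain m where m: "L \<subseteq> K m" using K(5)[OF L] by auto
    have "norm (y (\<nu> i) (- int (r i)) z) \<le> (1 + c m) * (1 / 2) ^ i" if "z \<in> L" for i z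
    proof (cases "\<nu> i \<ge> m")
      case True
      then have "norm (y (\<nu> i) (- int (r i)) z) \<le> (1 / 2) ^ \<nu> i * (1 / 2) ^ i"
        using far[of z m i i "- int (r i)"] that m r(1)[of i] by (auto simp: max_absorb1)
      also have "\<dots> \<le> 1 * (1 / 2) ^ i" by (intro mult_right_mono) (auto simp: power_le_one)
      also have "\<dots> \<le> (1 + c m) * (1 / 2) ^ i" using c_pos[of m] by (intro mult_right_mono) auto
      finally show ?thesis .
    next
      case False
      then have "norm (y (\<nu> i) (- int (r i)) z) \<le> c m * (1 / 2) ^ r i"
        using c[of "\<nu> i" m m z "- int (r i)"] that m by auto
      also have "\<dots> \<le> (1 + c m) * (1 / 2) ^ i"
        using c_pos[of m] r(1)[of i] by (intro mult_mono power_decreasing) auto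
      finally show ?thesis .
    qed
    moreover have "(\<lambda>i. (1 + c m) * (1 / 2) ^ i) summable_on UNIV"
      using c_pos[of m] by (simp add: summable_on_UNIV_nonneg_real_iff summable_mult)
    ultimately show "\<exists>M. M summable_on UNIV \<and> (\<forall>i\<in>UNIV. \<forall>z\<in>L. norm (y (\<nu> i) (- int (r i)) z) \<le> M i)"
      by blast
  qed
  \<comment> \<open>At time \<open>r n\<close> the \<open>n\<close>-th summand has arrived, and all others are far from arrival.\<close>
  have close: "dist ((T ^^ r n) f z) (y (\<nu> n) 0 z) \<le> 2 * (1 / 2) ^ \<nu> n * two_sided_sum"
    if z: "z \<in> K (\<nu> n)" for n z
  proof -
    let ?t = "\<lambda>i. y (\<nu> i) (int (r n) - int (r i)) z"
    have b: "norm (?t i) \<le> (2 * (1 / 2) ^ \<nu> n) * (1 / 2) ^ nat \<bar>int n - int i\<bar>" if i: "i \<in> UNIV - {n}" for i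
    proof -
      define k where "k = nat \<bar>int n - int i\<bar> - 1"
      have k: "nat \<bar>int n - int i\<bar> = Suc k" using i by (auto simp: k_def)
      have "nat \<bar>int (r n) - int (r i)\<bar> \<ge> N (\<nu> i) + N (\<nu> n) + k"
      proof (cases "i < n")
        case True
        then show ?thesis using r(2)[of i n] by (simp add: k_def)
      next
        case False
        then show ?thesis using r(2)[of n i] i by (simp add: k_def)
      qed
      then have "norm (?t i) \<le> (1 / 2) ^ max (\<nu> i) (\<nu> n) * (1 / 2) ^ k"
        by (intro far[OF z]) (auto simp: max_def)
      also have "\<dots> \<le> (1 / 2) ^ \<nu> n * (1 / 2) ^ k"
        by (intro mult_right_mono power_decreasing) auto
      also have "\<dots> = (2 * (1 / 2) ^ \<nu> n) * (1 / 2) ^ nat \<bar>int n - int i\<bar>" by (simp add: k)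
      finally show ?thesis .
    qed
    have inj: "inj_on (\<lambda>i. int n - int i) (UNIV - {n})" by (auto simp: inj_on_def)
    note sums = norm_infsum_le_two_sided[where h = "\<lambda>i. int n - int i" and f = ?t, OF inj _ b]
    have "(T ^^ r n) f z = infsum ?t (insert n (UNIV - {n}))"
      by (simp add: f_def T_funpow_infsum homoclinic_orbit_funpow[OF y] insert_UNIV insert_absorb)
    also have "\<dots> = y (\<nu> n) 0 z + infsum ?t (UNIV - {n})"
      by (subst infsum_insert) (use sums(2) in auto)
    finally show ?thesis using sums(3) by (simp add: dist_norm)
  qed
  have "liminf (\<lambda>n. ereal (real (card {k. k \<le> n \<and> (T ^^ k) f \<in> U}) / real (n + 1))) > 0"
    if U: "openin X U" "U \<noteq> {}" for U
  proof -
    obtain j L e where L: "compact L" "L \<subseteq> \<Omega>" "e > 0" "uniform_ball \<Omega> (x j 0) L e \<subseteq> U"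
      by (rule open_contains_neighbourhood[OF U]) (rule that)
    obtain m1 where m1: "\<And>m. m \<ge> m1 \<Longrightarrow> L \<subseteq> K m" using K(5)[OF L(1,2)] by blast
    obtain m2 where m2: "\<And>m. m \<ge> m2 \<Longrightarrow> (2 * two_sided_sum) * (1 / 2) ^ m < e"
      using eventually_geometric_less[OF L(3)] by blast
    define l where "l = prod_encode (j, max m1 m2)"
    have l: "l \<ge> max m1 m2" unfolding l_def by (rule le_prod_encode_2)
    have yl: "y l = x j" by (simp add: y_def l_def)
    obtain D i where D: "D \<ge> 1" "strict_mono i" "\<And>q. \<nu> (i q) = l" "\<And>q. r (i q) \<le> D * (q + 1)"
      using r(3)[of l] by blast
    have "(T ^^ r (i q)) f \<in> U" for q
    proof -
      have "dist ((T ^^ r (i q)) f z) (x j 0 z) < e" if "z \<in> L" for z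
        using close[of z "i q"] that m1[of l] m2[of l] l D(3)[of q] by (auto simp: yl mult_ac)
      then show ?thesis using L(4) T_funpow_holo[OF \<open>f \<in> holo \<Omega>\<close>] by (auto simp: uniform_ball_def)
    qed
    moreover have "strict_mono (r \<circ> i)" using sm D(2) by (rule strict_mono_o)
    ultimately show ?thesis
      using positive_lower_density[of "r \<circ> i" D "\<lambda>k. (T ^^ k) f \<in> U"] D(1,4) by simp
  qed
  then show ?thesis
    using \<open>f \<in> holo \<Omega>\<close> by (auto simp: frequently_hypercyclic_def topspace_holo_topology)
qed

text \<open>The dense set consists of all points with a homoclinic orbit. Injectivity of \<open>T\<close> makes the
  backward orbit unique, so that it is given by a map \<open>S\<close>.\<close>

theorem frequent_hypercyclicity_criterion:
  assumes inj: "inj_on T (holo \<Omega>)"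
  shows "frequent_hypercyclicity_criterion X T"
proof -
  define X0 where "X0 = {y 0 |y. homoclinic_orbit \<Omega> T y}"
  define S where "S = inv_into (holo \<Omega>) T"
  have S: "S (y d) = y (d - 1)" if "homoclinic_orbit \<Omega> T y" for y d
  proof -
    have "T (y (d - 1)) = y d" using homoclinic_orbitD(2)[OF that, of "d - 1"] by simp
    then show ?thesis
      using inv_into_f_f[OF inj homoclinic_orbitD(1)[OF that, of "d - 1"]] by (simp add: S_def)
  qed
  have S_pow: "(S ^^ n) (y 0) = y (- int n)" if "homoclinic_orbit \<Omega> T y" for y n
  proof (induction n)
    case (Suc n)
    have "(S ^^ Suc n) (y 0) = S (y (- int n))" using Suc.IH by simp
    also have "\<dots> = y (- int n - 1)" by (rule S[OF that])
    also have "- int n - 1 = - int (Suc n)" by simp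
    finally show ?case .
  qed simp
  have uc: "unconditionally_convergent X (\<lambda>n. y (s * int n)) {1..}"
    if y: "homoclinic_orbit \<Omega> T y" and s: "\<bar>s\<bar> = 1" for y s
  proof -
    have M: "\<exists>M. M summable_on {1..} \<and> (\<forall>n\<in>{1..}. \<forall>z\<in>K. norm (y (s * int n) z) \<le> M n)"
      if K: "compact K" "K \<subseteq> \<Omega>" for K
    proof -
      obtain C where C: "C > 0" "\<And>d z. z \<in> K \<Longrightarrow> norm (y d z) \<le> C * (1 / 2) ^ nat \<bar>d\<bar>"
        by (rule homoclinic_orbit_bound[OF y K]) (rule that)
      have "(\<lambda>n. C * (1 / 2) ^ n) summable_on UNIV"
        using C(1) by (simp add: summable_on_UNIV_nonneg_real_iff summable_mult)
      then have "(\<lambda>n. C * (1 / 2) ^ n) summable_on {1..}" by (rule summable_on_subset) simp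
      moreover have "norm (y (s * int n) z) \<le> C * (1 / 2) ^ n" if "z \<in> K" for n z
        using C(2)[OF that, of "s * int n"] s by (simp add: abs_mult)
      ultimately show ?thesis by blast
    qed
    have hol: "y d \<in> holo \<Omega>" for d by (rule homoclinic_orbitD(1)[OF y])
    have eq: "sum (\<lambda>n. y (s * int n)) A = (\<lambda>z. \<Sum>n\<in>A. y (s * int n) z)" for A
      by (simp add: fun_eq_iff sum_fun_apply)
    have "limitin X (sum (\<lambda>n. y (s * int n))) (\<lambda>z. \<Sum>\<^sub>\<infinity>n\<in>{1..}. y (s * int n) z) (finite_subsets_at_top {1..})"
    proof (rule limitin_holo_topology)
      show "(\<lambda>z. \<Sum>\<^sub>\<infinity>n\<in>{1..}. y (s * int n) z) \<in> holo \<Omega>"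
        by (rule holo_infsum[OF open_domain hol M])
      show "\<forall>\<^sub>F A in finite_subsets_at_top {1..}. sum (\<lambda>n. y (s * int n)) A \<in> holo \<Omega>"
        unfolding eq by (intro always_eventually allI holo_sum hol)
      show "uniform_limit K (sum (\<lambda>n. y (s * int n))) (\<lambda>z. \<Sum>\<^sub>\<infinity>n\<in>{1..}. y (s * int n) z) (finite_subsets_at_top {1..})"
        if "compact K" "K \<subseteq> \<Omega>" for K
        unfolding eq
        by (rule holomorphic_on_infsum(2)[OF open_domain _ M that]) (use hol in \<open>auto simp: holo_def\<close>)
    qed
    then show ?thesis by (auto simp: unconditionally_convergent_def)
  qed
  show ?thesis
    unfolding frequent_hypercyclicity_criterion_def
  proof (intro exI conjI ballI)
    have sub: "range (\<lambda>j. x j 0) \<subseteq> X0" using homoclinic by (auto simp: X0_def)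
    have "X0 \<subseteq> holo \<Omega>" using homoclinic_orbitD(1) by (auto simp: X0_def)
    moreover have "topspace X \<subseteq> X closure_of X0"
      using dense closure_of_mono[OF sub, of X] unfolding dense_subset_def by (metis (no_types))
    ultimately show "dense_subset X X0"
      using closure_of_subset_topspace[of X X0] by (simp add: dense_subset_def topspace_holo_topology)
    show "S ` X0 \<subseteq> X0"
    proof clarify
      fix f assume "f \<in> X0"
      then obtain y where y: "homoclinic_orbit \<Omega> T y" "f = y 0" by (auto simp: X0_def)
      then have "S f = (\<lambda>d. y (d - 1)) 0" using S[OF y(1), of 0] by simp
      then show "S f \<in> X0" using homoclinic_orbit_shift[OF y(1)] unfolding X0_def
        by (intro CollectI exI[of _ "\<lambda>d. y (d - 1)"] conjI) auto
    qed
    fix f assume "f \<in> X0"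
    then obtain y where y: "homoclinic_orbit \<Omega> T y" and f: "f = y 0" by (auto simp: X0_def)
    show "unconditionally_convergent X (\<lambda>n. (T ^^ n) f) {1..}"
      using uc[OF y, of 1] by (simp add: f homoclinic_orbit_funpow[OF y])
    show "unconditionally_convergent X (\<lambda>n. (S ^^ n) f) {1..}"
      using uc[OF y, of "-1"] by (simp add: f S_pow[OF y])
    show "T (S f) = f" using S[OF y, of 0] homoclinic_orbitD(2)[OF y, of "-1"] by (simp add: f)
  qed
qed

end

lemma frequently_hypercyclic_imp_hypercyclic:
  assumes "frequently_hypercyclic X T" and T: "\<And>f. f \<in> topspace X \<Longrightarrow> T f \<in> topspace X"
  shows "hypercyclic X T"
proof -
  obtain f where f: "f \<in> topspace X" and pos: "\<And>U. openin X U \<Longrightarrow> U \<noteq> {} \<Longrightarrow>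
     liminf (\<lambda>N. ereal (real (card {n. n \<le> N \<and> (T ^^ n) f \<in> U}) / real (N + 1))) > 0"
    using assms(1) unfolding frequently_hypercyclic_def by blast
  have orbit: "(T ^^ n) f \<in> topspace X" for n by (induction n) (auto simp: f T)
  have "\<exists>n. (T ^^ n) f \<in> U" if U: "openin X U" "U \<noteq> {}" for U
  proof (rule ccontr)
    assume "\<nexists>n. (T ^^ n) f \<in> U"
    then have "(\<lambda>N. ereal (real (card {n. n \<le> N \<and> (T ^^ n) f \<in> U}) / real (N + 1))) = (\<lambda>_. 0)"
      by (simp add: zero_ereal_def)
    then show False using pos[OF U] by (simp add: Liminf_const)
  qed
  then have "topspace X \<subseteq> X closure_of {(T ^^ n) f | n. True}"
    by (fastforce simp: in_closure_of)
  then have "dense_subset X {(T ^^ n) f | n. True}"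
    using orbit closure_of_subset_topspace[of X] unfolding dense_subset_def by auto
  then show ?thesis using f by (auto simp: hypercyclic_def)
qed

section \<open>Laurent splitting at the puncture\<close>

lemma cauchy_type_integral_holomorphic:
  assumes t: "t > 0" and f: "continuous_on (sphere 0 t) f"
  shows "(\<lambda>z. contour_integral (circlepath 0 t) (\<lambda>w. f w / (w - z))) holomorphic_on - sphere 0 t"
proof -
  let ?I = "\<lambda>z. contour_integral (circlepath 0 t) (\<lambda>w. f w / (w - z) ^ 1)"
  have im: "path_image (circlepath 0 t) = sphere 0 t" using t by simp
  have int: "((\<lambda>w. f w / (w - z) ^ 1) has_contour_integral ?I z) (circlepath 0 t)"
    if "z \<in> UNIV - path_image (circlepath 0 t)" for z
  proof (rule has_contour_integral_integral, rule contour_integrable_continuous_circlepath)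
    show "continuous_on (path_image (circlepath 0 t)) (\<lambda>w. f w / (w - z) ^ 1)"
      using that f unfolding im by (auto intro!: continuous_intros)
  qed
  have "\<exists>D. (?I has_field_derivative D) (at z)" if "z \<in> - sphere 0 t" for z
  proof -
    have "(?I has_field_derivative (of_nat 1 * contour_integral (circlepath 0 t) (\<lambda>w. f w / (w - z) ^ Suc 1))) (at z)"
      by (rule Cauchy_next_derivative(2)[where S = UNIV and B = "2 * pi * \<bar>t\<bar>"])
         (use f int that im in \<open>auto simp: vector_derivative_circlepath norm_mult\<close>)
    then show ?thesis by blast
  qed
  then show ?thesis by (simp add: holomorphic_on_open open_Compl)
qed

text \<open>Every function holomorphic off an isolated singularity splits into a principal part and a function
  holomorphic across it, also at an essential singularity. The principal part at \<open>z\<close> is minus the residue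
  at \<open>w = 0\<close> of \<open>f w / (w - z)\<close>, that is, a Cauchy integral over a small circle; it decays at infinity, whence the
  form \<open>h (1 / z) / z\<close> with \<open>h\<close> entire.\<close>

lemma laurent_splitting:
  assumes S: "open S" "0 \<in> S" and f: "f holomorphic_on S - {0}"
  obtains h g where "h holomorphic_on UNIV" "g holomorphic_on S"
    "\<And>z. z \<in> S - {0} \<Longrightarrow> f z = h (1 / z) / z + g z"
proof -
  obtain \<rho>' where \<rho>': "\<rho>' > 0" "cball 0 \<rho>' \<subseteq> S" using S open_contains_cball by blast
  define \<rho> where "\<rho> = min \<rho>' 1"
  have \<rho>: "\<rho> > 0" "\<rho> \<le> 1" "cball 0 \<rho> \<subseteq> S" using \<rho>' by (auto simp: \<rho>_def)
  have fb: "f holomorphic_on ball 0 \<rho> - {0}"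
    using f by (rule holomorphic_on_subset) (use \<rho>(3) in auto)
  have fc: "continuous_on (sphere 0 t) f" if "0 < t" "t < \<rho>" for t
    using that by (intro holomorphic_on_imp_continuous_on holomorphic_on_subset[OF fb]) auto
  define I where "I t z = contour_integral (circlepath 0 t) (\<lambda>w. f w / (w - z))" for t z
  \<comment> \<open>The principal part; it can be computed on any circle inside the disc of radius \<open>norm z\<close>.\<close>
  define p where "p z = - residue (\<lambda>w. f w / (w - z)) 0" for z
  have p: "((\<lambda>w. f w / (w - z)) has_contour_integral (- 2 * pi * \<i> * p z)) (circlepath 0 t)"
    if t: "0 < t" "t < \<rho>" "t < norm z" for t z
  proof -
    have "((\<lambda>w. f w / (w - z)) has_contour_integral (2 * pi * \<i> * residue (\<lambda>w. f w / (w - z)) 0)) (circlepath 0 t)"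
    proof (rule base_residue[where s = "ball 0 (min \<rho> (norm z))"])
      show "(\<lambda>w. f w / (w - z)) holomorphic_on ball 0 (min \<rho> (norm z)) - {0}"
        by (intro holomorphic_intros holomorphic_on_subset[OF fb]) auto
    qed (use t \<rho> in auto)
    then show ?thesis by (simp add: p_def)
  qed
  have pI: "p z = - I t z / (2 * pi * \<i>)" if t: "0 < t" "t < \<rho>" "t < norm z" for t z
    using contour_integral_unique[OF p[OF t]] by (simp add: I_def)
  have p_hol: "p holomorphic_on - {0}"
  proof -
    have "p field_differentiable at z" if z: "z \<noteq> 0" for z
    proof -
      define t where "t = min \<rho> (norm z) / 2"
      have t: "0 < t" "t < \<rho>" "t < norm z" using z \<rho> by (auto simp: t_def min_def)
      have "(\<lambda>z. - I t z / (2 * pi * \<i>)) holomorphic_on - cball 0 t"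
        unfolding I_def
        by (intro holomorphic_intros holomorphic_on_subset[OF cauchy_type_integral_holomorphic[OF t(1) fc[OF t(1,2)]]])
          auto
      then have "p holomorphic_on - cball 0 t"
        by (rule holomorphic_transform) (use pI[OF t(1,2)] in auto)
      then show ?thesis
        by (rule holomorphic_on_imp_differentiable_at) (use t in auto)
    qed
    then show ?thesis by (auto simp: holomorphic_on_def intro: field_differentiable_at_within)
  qed
  \<comment> \<open>Inside the circle of radius \<open>s\<close>, the remainder is a Cauchy integral and hence extends over \<open>0\<close>.\<close>
  have near: "2 * pi * \<i> * (f z - p z) = I s z" if s: "0 < s" "s < \<rho>" and z: "z \<noteq> 0" "norm z < s" for s z
  proof -
    have "contour_integral (circlepath 0 s) (\<lambda>w. f w / (w - z)) =
      2 * pi * \<i> * (\<Sum>q\<in>{0, z}. winding_number (circlepath 0 s) q * residue (\<lambda>w. f w / (w - z)) q)"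
    proof (rule Residue_theorem[where S = "ball 0 \<rho>"])
      show "(\<lambda>w. f w / (w - z)) holomorphic_on ball 0 \<rho> - {0, z}"
        by (intro holomorphic_intros holomorphic_on_subset[OF fb]) auto
      show "path_image (circlepath 0 s) \<subseteq> ball 0 \<rho> - {0, z}" using s z by auto
      show "\<forall>w. w \<notin> ball 0 \<rho> \<longrightarrow> winding_number (circlepath 0 s) w = 0"
      proof (intro allI impI)
        fix w :: complex assume "w \<notin> ball 0 \<rho>"
        then show "winding_number (circlepath 0 s) w = 0"
          using s by (intro winding_number_zero_outside[where s = "cball 0 s"]) auto
      qed
    qed auto
    also have "\<dots> = 2 * pi * \<i> * (residue (\<lambda>w. f w / (w - z)) 0 + residue (\<lambda>w. f w / (w - z)) z)"
      using s z by (simp add: winding_number_circlepath)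
    also have "residue (\<lambda>w. f w / (w - z)) z = f z"
      by (rule residue_simple[of "ball 0 \<rho> - {0}"]) (use fb s z in auto)
    finally show ?thesis by (simp add: I_def p_def)
  qed
  \<comment> \<open>The principal part, read in the coordinate \<open>1 / z\<close> and divided by it.\<close>
  define k where "k w = p (1 / w) / w" for w
  have "\<exists>B. \<forall>\<^sub>F w in at 0. norm (k w) \<le> B"
  proof -
    define t where "t = \<rho> / 2"
    have t: "0 < t" "t < \<rho>" "t \<le> 1 / 2" using \<rho> by (auto simp: t_def)
    have "compact (f ` sphere 0 t)" by (intro compact_continuous_image fc t) auto
    then obtain B where B: "B > 0" "\<And>w. norm w = t \<Longrightarrow> norm (f w) \<le> B"
      using bounded_pos[of "f ` sphere 0 t"] compact_imp_bounded by (metis imageI mem_sphere_0)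
    have bound: "norm (k w) \<le> 2 * B * t" if w: "w \<noteq> 0" "norm w < 1" for w
    proof -
      let ?z = "1 / w"
      have z: "norm ?z > 1" using w by (simp add: norm_divide)
      have "norm (- 2 * pi * \<i> * p ?z) \<le> (2 * B / norm ?z) * (2 * pi * t)"
      proof (rule has_contour_integral_bound_circlepath[OF p])
        fix v :: complex assume v: "norm (v - 0) = t"
        have "norm ?z / 2 \<le> norm ?z - norm v" using z t v by simp
        also have "\<dots> \<le> norm (v - ?z)" by (metis norm_minus_commute norm_triangle_ineq2)
        finally have "norm (f v) / norm (v - ?z) \<le> B / (norm ?z / 2)"
          using B v z by (intro frac_le) auto
        then show "norm (f v / (v - ?z)) \<le> 2 * B / norm ?z" by (simp add: norm_divide)
      qed (use t z B in auto)
      then have "(2 * pi) * norm (p ?z) \<le> (2 * pi) * ((2 * B / norm ?z) * t)"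
        by (simp add: norm_mult mult_ac)
      then have "norm (p ?z) \<le> (2 * B / norm ?z) * t" by (rule mult_left_le_imp_le) simp
      then show ?thesis using w by (simp add: k_def norm_divide field_simps)
    qed
    have "\<forall>\<^sub>F w in at 0. norm (k w) \<le> 2 * B * t"
      unfolding eventually_at by (rule exI[of _ 1]) (use bound in auto)
    then show ?thesis by blast
  qed
  moreover have "k holomorphic_on UNIV - {0}"
  proof -
    have "(p \<circ> (\<lambda>w. 1 / w)) holomorphic_on UNIV - {0}"
      by (rule holomorphic_on_compose_gen[OF _ p_hol]) (auto intro!: holomorphic_intros)
    then show ?thesis unfolding k_def by (auto intro!: holomorphic_intros simp: o_def)
  qed
  ultimately obtain h where h: "h holomorphic_on UNIV" "\<And>w. w \<noteq> 0 \<Longrightarrow> h w = k w"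
    using holomorphic_on_extend_bounded[of k UNIV 0] by auto
  have hp: "h (1 / z) / z = p z" if "z \<noteq> 0" for z
    using h(2)[of "1 / z"] that by (simp add: k_def)
  define s where "s = \<rho> / 2"
  have s: "0 < s" "s < \<rho>" using \<rho> by (auto simp: s_def)
  define g where "g z = (if z = 0 then I s 0 / (2 * pi * \<i>) else f z - p z)" for z
  have "g holomorphic_on ball 0 s"
  proof (rule holomorphic_transform)
    show "(\<lambda>z. I s z / (2 * pi * \<i>)) holomorphic_on ball 0 s"
      unfolding I_def
      by (intro holomorphic_intros holomorphic_on_subset[OF cauchy_type_integral_holomorphic[OF s(1) fc[OF s]]])
        auto
    show "I s z / (2 * pi * \<i>) = g z" if "z \<in> ball 0 s" for z
      using near[OF s, of z] that by (auto simp: g_def divide_eq_eq mult_ac)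
  qed
  moreover have "g holomorphic_on S - {0}"
  proof (rule holomorphic_transform)
    show "(\<lambda>z. f z - p z) holomorphic_on S - {0}"
      by (intro holomorphic_intros f holomorphic_on_subset[OF p_hol]) auto
  qed (auto simp: g_def)
  ultimately have "g holomorphic_on ball 0 s \<union> (S - {0})"
    using S by (intro holomorphic_on_Un) auto
  then have "g holomorphic_on S" by (rule holomorphic_on_subset) (use s in auto)
  moreover have "f z = h (1 / z) / z + g z" if "z \<in> S - {0}" for z
    using that hp[of z] by (simp add: g_def)
  ultimately show ?thesis using that h(1) by blast
qed

text \<open>In the splitting, \<open>h (1 / z) / z\<close> without its leading term \<open>h 0 / z\<close> is the derivative of an entire
  function of \<open>1 / z\<close>.\<close>

lemma primitive_up_to_residue:
  assumes F: "F holomorphic_on punctured_disc"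
  obtains a P where "P holomorphic_on punctured_disc"
    "\<And>z. z \<in> punctured_disc \<Longrightarrow> (P has_field_derivative (F z - a / z)) (at z)"
proof -
  obtain h g where h: "h holomorphic_on UNIV" and g: "g holomorphic_on ball 0 1"
    and Fz: "\<And>z. z \<in> punctured_disc \<Longrightarrow> F z = h (1 / z) / z + g z"
    using laurent_splitting[OF open_ball _ F] by auto
  obtain Q where Q: "\<And>z. z \<in> ball 0 1 \<Longrightarrow> (Q has_field_derivative g z) (at z within ball 0 1)"
    by (rule holomorphic_convex_primitive'[OF convex_ball open_ball g]) (rule that)
  \<comment> \<open>The entire function with \<open>h z = h 0 + z * m z\<close>.\<close>
  define m where "m z = (if z = 0 then deriv h 0 else (h z - h 0) / (z - 0))" for z
  have m: "m holomorphic_on UNIV" unfolding m_def by (rule pole_lemma[OF h]) auto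
  obtain M where M: "\<And>z. z \<in> UNIV \<Longrightarrow> (M has_field_derivative m z) (at z within UNIV)"
    by (rule holomorphic_convex_primitive'[OF convex_UNIV open_UNIV m]) (rule that)
  define P where "P z = Q z - M (1 / z)" for z
  have P: "(P has_field_derivative (F z - h 0 / z)) (at z)" if z: "z \<in> punctured_disc" for z
  proof -
    have z0: "z \<noteq> 0" "z \<in> ball 0 1" using z by auto
    have "(Q has_field_derivative g z) (at z)"
      using Q[OF z0(2)] at_within_open[OF z0(2) open_ball] by simp
    moreover have "((\<lambda>z. M (1 / z)) has_field_derivative (m (1 / z) * (- 1 / z ^ 2))) (at z)"
    proof (rule DERIV_chain2[where f = M and g = "\<lambda>z. 1 / z"])
      show "(M has_field_derivative m (1 / z)) (at (1 / z))" using M by simp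
      show "((\<lambda>z. 1 / z) has_field_derivative - 1 / z ^ 2) (at z)"
        using z0 by (auto intro!: derivative_eq_intros simp: power2_eq_square field_simps)
    qed
    ultimately have "(P has_field_derivative (g z - m (1 / z) * (- 1 / z ^ 2))) (at z)"
      unfolding P_def by (rule DERIV_diff)
    moreover have "g z - m (1 / z) * (- 1 / z ^ 2) = F z - h 0 / z"
      using z0 Fz[OF z] by (simp add: m_def field_simps power2_eq_square)
    ultimately show ?thesis by simp
  qed
  moreover have "P holomorphic_on punctured_disc"
  proof -
    have "open punctured_disc" by (auto intro!: open_Diff)
    then show ?thesis unfolding holomorphic_on_open[OF \<open>open punctured_disc\<close>] using P by blast
  qed
  ultimately show ?thesis using that by blast
qed

text \<open>A primitive of the logarithmic derivative exists up to a term \<open>a / z\<close>. In the coordinate \<open>z = exp s\<close> this says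
  that \<open>\<omega> z\<close> is a constant times \<open>exp (a * s + P z)\<close>, and invariance under \<open>s \<mapsto> s + 2 * pi * \<i>\<close> forces \<open>a\<close> to be
  an integer.\<close>

lemma exponential_normal_form:
  assumes \<omega>: "\<omega> holomorphic_on punctured_disc" and nz: "\<And>z. z \<in> punctured_disc \<Longrightarrow> \<omega> z \<noteq> 0"
  obtains k :: int and W where "W holomorphic_on punctured_disc"
    "\<And>z. z \<in> punctured_disc \<Longrightarrow> \<omega> z = z powi k * exp (W z)"
proof -
  have op: "open punctured_disc" by (auto intro!: open_Diff)
  have "(\<lambda>z. deriv \<omega> z / \<omega> z) holomorphic_on punctured_disc"
    by (intro holomorphic_intros holomorphic_deriv[OF \<omega> op] \<omega> nz)
  then obtain a P where P: "P holomorphic_on punctured_disc"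
    "\<And>z. z \<in> punctured_disc \<Longrightarrow> (P has_field_derivative (deriv \<omega> z / \<omega> z - a / z)) (at z)"
    by (rule primitive_up_to_residue) (rule that)
  define H where "H s = \<omega> (exp s) * exp (- P (exp s)) * exp (- a * s)" for s
  have in_disc: "exp s \<in> punctured_disc" if "Re s < 0" for s
    using that by simp
  have "\<exists>C. \<forall>s\<in>{s. Re s < 0}. H s = C"
  proof (rule has_field_derivative_zero_constant)
    show "convex {s. Re s < 0}" by (rule convex_halfspace_Re_lt)
    fix s assume "s \<in> {s. Re s < 0}"
    then have z: "exp s \<in> punctured_disc" using in_disc by simp
    have d\<omega>: "(\<omega> has_field_derivative deriv \<omega> (exp s)) (at (exp s))"
      by (rule holomorphic_derivI[OF \<omega> op z])
    have "((\<lambda>s. \<omega> (exp s)) has_field_derivative deriv \<omega> (exp s) * exp s) (at s)"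
      by (rule DERIV_chain2[OF d\<omega> DERIV_exp])
    moreover have "((\<lambda>s. P (exp s)) has_field_derivative (deriv \<omega> (exp s) / \<omega> (exp s) - a / exp s) * exp s) (at s)"
      by (rule DERIV_chain2[OF P(2)[OF z] DERIV_exp])
    ultimately have "(H has_field_derivative 0) (at s)"
      unfolding H_def using nz[OF z]
      by (auto intro!: derivative_eq_intros simp: field_simps)
    then show "(H has_field_derivative 0) (at s within {s. Re s < 0})"
      by (rule has_field_derivative_at_within)
  qed
  then obtain C where C: "\<And>s. Re s < 0 \<Longrightarrow> H s = C" by auto
  have "C \<noteq> 0" using C[of "-1"] nz[OF in_disc[of "-1"]] by (auto simp: H_def)
  have "H (-1) = H (-1 + 2 * pi * \<i>)" using C[of "-1"] C[of "-1 + 2 * pi * \<i>"] by simp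
  moreover have "exp (-1 + 2 * pi * \<i>) = exp (-1 :: complex)" unfolding exp_add by simp
  ultimately have "\<omega> (exp (-1)) * exp (- P (exp (-1))) * exp (- a * (-1)) =
      \<omega> (exp (-1)) * exp (- P (exp (-1))) * exp (- a * (-1 + 2 * pi * \<i>))"
    by (simp only: H_def)
  then have "exp (- a * (-1)) = exp (- a * (-1 + 2 * pi * \<i>))"
    using nz[OF in_disc[of "-1"]] by (simp only: mult_cancel_left) simp
  then have "exp (2 * pi * \<i> * a) = 1"
    by (simp add: ring_distribs exp_diff exp_add exp_minus field_simps)
  then obtain n :: int where n: "2 * pi * \<i> * a = of_int (2 * n) * pi * \<i>"
    using exp_eq_1[of "2 * pi * \<i> * a"] by (auto simp: complex_eq_iff)
  then have a: "a = of_int n" by simp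
  show ?thesis
  proof (rule that)
    show "(\<lambda>z. Ln C + P z) holomorphic_on punctured_disc"
      by (intro holomorphic_intros P(1))
    fix z assume z: "z \<in> punctured_disc"
    then have eq: "exp (Ln z) = z" "Re (Ln z) < 0" by (auto simp: Re_Ln)
    have "\<omega> z * exp (- P z) * exp (- a * Ln z) = C" using C[OF eq(2)] by (simp add: H_def eq(1))
    moreover have "exp (a * Ln z) = z powi n"
    proof -
      have "exp (a * Ln z) = exp (Ln z) powi n" by (simp add: a exp_power_int)
      then show ?thesis by (simp add: eq(1))
    qed
    ultimately show "\<omega> z = z powi n * exp (Ln C + P z)"
      using \<open>C \<noteq> 0\<close> z by (simp add: exp_add exp_minus exp_diff field_simps)
  qed
qed

section \<open>Linearization and normal form\<close>

text \<open>The symbol extended over the puncture. By the Schwarz lemma the condition on the derivative excludes exactly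
  the rotations.\<close>

locale univalent_contraction =
  fixes \<psi> :: "complex \<Rightarrow> complex"
  assumes holomorphic: "\<psi> holomorphic_on ball 0 1"
    and injective: "inj_on \<psi> (ball 0 1)"
    and into: "\<psi> ` ball 0 1 \<subseteq> ball 0 1"
    and fixes_0: "\<psi> 0 = 0"
    and multiplier_less_1: "norm (deriv \<psi> 0) < 1"
begin

lemma iterate_in_disc: "norm z < 1 \<Longrightarrow> norm ((\<psi> ^^ n) z) < 1"
proof (induction n)
  case (Suc n)
  then have "(\<psi> ^^ n) z \<in> ball 0 1" by simp
  then have "\<psi> ((\<psi> ^^ n) z) \<in> ball 0 1" using imageI[of "(\<psi> ^^ n) z" "ball 0 1" \<psi>] into by (simp add: subset_iff)
  then show ?case by simp
qed simp

lemma iterate_holomorphic: "(\<psi> ^^ n) holomorphic_on ball 0 1"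
proof (induction n)
  case (Suc n)
  have "(\<psi> \<circ> (\<psi> ^^ n)) holomorphic_on ball 0 1"
    by (rule holomorphic_on_compose_gen[OF Suc.IH holomorphic]) (use iterate_in_disc in auto)
  then show ?case by (simp only: funpow.simps)
qed (simp add: id_def)

text \<open>By the Schwarz lemma \<open>\<psi> z / z\<close> has modulus less than 1 everywhere, hence at most some \<open>\<mu> < 1\<close> on the
  smaller disc, which \<open>\<psi>\<close> maps into itself.\<close>

lemma iterates_contract:
  assumes "0 < r" "r < 1"
  obtains \<mu> where "0 < \<mu>" "\<mu> < 1" "\<And>n z. norm z \<le> r \<Longrightarrow> norm ((\<psi> ^^ n) z) \<le> \<mu> ^ n * norm z"
proof -
  obtain u where u: "u holomorphic_on ball 0 1" "\<And>z. norm z < 1 \<Longrightarrow> \<psi> z = z * u z" "deriv \<psi> 0 = u 0"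
    by (rule Schwarz3[OF holomorphic fixes_0]) (rule that)
  \<comment> \<open>Equality in the Schwarz lemma would make \<open>\<psi>\<close> a rotation.\<close>
  have small: "norm (u z) < 1" if z: "norm z < 1" for z
  proof (cases "z = 0")
    case True
    then show ?thesis using u(3) multiplier_less_1 by simp
  next
    case False
    have *: "norm (\<psi> w) < 1" if "norm w < 1" for w
      using iterate_in_disc[OF that, of 1] by simp
    have "norm (\<psi> z) \<le> norm z" by (rule Schwarz_Lemma(1)[OF holomorphic fixes_0 * z])
    moreover have "norm (\<psi> z) \<noteq> norm z"
    proof
      assume "norm (\<psi> z) = norm z"
      then obtain \<alpha> where \<alpha>: "\<And>w. norm w < 1 \<Longrightarrow> \<psi> w = \<alpha> * w" "norm \<alpha> = 1"
        using Schwarz_Lemma(3)[OF holomorphic fixes_0 * z] False z by blast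
      have "(\<psi> has_field_derivative \<alpha>) (at 0)"
      proof (rule has_field_derivative_transform_within_open[of "\<lambda>w. \<alpha> * w" _ _ "ball 0 1"])
        show "((*) \<alpha> has_field_derivative \<alpha>) (at 0)" by (auto intro!: derivative_eq_intros)
      qed (use \<alpha> in auto)
      then show False using \<alpha>(2) multiplier_less_1 by (simp add: DERIV_imp_deriv)
    qed
    ultimately have "norm z * norm (u z) < norm z * 1" using u(2)[OF z] by (simp add: norm_mult)
    then show ?thesis using False by (simp only: mult_less_cancel_left) auto
  qed
  have "continuous_on (cball 0 r) (\<lambda>z. norm (u z))"
    using assms by (intro continuous_intros holomorphic_on_imp_continuous_on holomorphic_on_subset[OF u(1)]) auto
  moreover have "cball (0::complex) r \<noteq> {}" using assms by simp
  ultimately obtain m where m: "m \<in> cball 0 r" "\<And>z. z \<in> cball 0 r \<Longrightarrow> norm (u z) \<le> norm (u m)"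
    using continuous_attains_sup[OF compact_cball] by blast
  \<comment> \<open>The maximum with \<open>1 / 2\<close> ensures that \<open>\<mu>\<close> is positive.\<close>
  define \<mu> where "\<mu> = max (1 / 2) (norm (u m))"
  have \<mu>: "0 < \<mu>" "\<mu> < 1" using small[of m] m(1) assms by (auto simp: \<mu>_def)
  have "norm (\<psi> z) \<le> \<mu> * norm z" if "norm z \<le> r" for z
  proof -
    have "norm (u z) \<le> \<mu>" using m(2)[of z] that by (auto simp: \<mu>_def)
    then have "norm z * norm (u z) \<le> norm z * \<mu>" by (rule mult_left_mono) simp
    then show ?thesis using u(2)[of z] that assms by (simp add: norm_mult mult.commute)
  qed
  then have step: "norm (\<psi> z) \<le> \<mu> * norm z" if "norm z \<le> r" for z using that by auto
  have "norm ((\<psi> ^^ n) z) \<le> \<mu> ^ n * norm z" if z: "norm z \<le> r" for n z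
  proof (induction n)
    case (Suc n)
    have "\<mu> ^ n * norm z \<le> 1 * norm z"
      using \<mu> by (intro mult_right_mono power_le_one) auto
    then have "norm ((\<psi> ^^ n) z) \<le> r" using Suc.IH z by simp
    then have "norm ((\<psi> ^^ Suc n) z) \<le> \<mu> * norm ((\<psi> ^^ n) z)" using step by simp
    also have "\<dots> \<le> \<mu> * (\<mu> ^ n * norm z)" using \<mu> Suc.IH by (intro mult_left_mono) auto
    finally show ?case by (simp add: mult_ac)
  qed simp
  then show ?thesis using that[OF \<mu>] by blast
qed

lemma iterates_tendsto_0:
  assumes "norm z < 1"
  shows "(\<lambda>n. (\<psi> ^^ n) z) \<longlonglongrightarrow> 0"
proof -
  define r where "r = (norm z + 1) / 2"
  have r: "0 < r" "r < 1" "norm z \<le> r"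
    using assms norm_ge_zero[of z] by (auto simp: r_def intro: add_nonneg_pos)
  obtain \<mu> where \<mu>: "0 < \<mu>" "\<mu> < 1" "\<And>n z. norm z \<le> r \<Longrightarrow> norm ((\<psi> ^^ n) z) \<le> \<mu> ^ n * norm z"
    by (rule iterates_contract[OF r(1,2)]) (rule that)
  have "(\<lambda>n. \<mu> ^ n * norm z) \<longlonglongrightarrow> 0 * norm z"
    using \<mu> by (intro tendsto_mult tendsto_const LIMSEQ_power_zero) auto
  then have "(\<lambda>n. \<mu> ^ n * norm z) \<longlonglongrightarrow> 0" by simp
  moreover have "\<forall>\<^sub>F n in sequentially. norm ((\<psi> ^^ n) z) \<le> \<mu> ^ n * norm z"
    by (intro always_eventually allI \<mu>(3) r(3))
  ultimately show ?thesis by (rule Lim_null_comparison[rotated])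
qed

text \<open>The solution is the sum of \<open>q\<close> along forward orbits; it converges because orbits tend to the zero \<open>0\<close> of \<open>q\<close> at a
  geometric rate.\<close>

lemma cohomological_equation:
  assumes q: "q holomorphic_on ball 0 1" "q 0 = 0"
  obtains Q where "Q holomorphic_on ball 0 1" "\<And>z. norm z < 1 \<Longrightarrow> Q z - Q (\<psi> z) = q z"
proof -
  obtain v where v: "v holomorphic_on ball 0 1" "\<And>z. norm z < 1 \<Longrightarrow> q z = z * v z"
    by (rule Schwarz3[OF q]) (rule that)
  define Q where "Q z = (\<Sum>\<^sub>\<infinity>n\<in>UNIV. q ((\<psi> ^^ n) z))" for z
  have bound: "\<exists>M. M summable_on UNIV \<and> (\<forall>n\<in>UNIV. \<forall>z\<in>K. norm (q ((\<psi> ^^ n) z)) \<le> M n)"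
    if K: "compact K" "K \<subseteq> ball 0 1" for K
  proof -
    have "\<exists>r. 0 < r \<and> r < 1 \<and> K \<subseteq> cball 0 r"
    proof (cases "K = {}")
      case False
      obtain m where m: "m \<in> K" "\<And>z. z \<in> K \<Longrightarrow> norm z \<le> norm m"
        using continuous_attains_sup[OF K(1) False, of norm] by (auto intro: continuous_intros)
      have "norm m < 1" using m(1) K by auto
      then have "0 < (norm m + 1) / 2" "(norm m + 1) / 2 < 1" "K \<subseteq> cball 0 ((norm m + 1) / 2)"
        using m(2) norm_ge_zero[of m] by (auto simp: add_nonneg_pos) fastforce
      then show ?thesis by blast
    qed (auto intro!: exI[of _ "1 / 2"])
    then obtain r where r: "0 < r" "r < 1" "K \<subseteq> cball 0 r" by blast
    obtain \<mu> where \<mu>: "0 < \<mu>" "\<mu> < 1" "\<And>n z. norm z \<le> r \<Longrightarrow> norm ((\<psi> ^^ n) z) \<le> \<mu> ^ n * norm z"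
      by (rule iterates_contract[OF r(1,2)]) (rule that)
    have "compact (v ` cball 0 r)"
      using r by (intro compact_continuous_image holomorphic_on_imp_continuous_on holomorphic_on_subset[OF v(1)]) auto
    then obtain B where B: "B > 0" "\<And>z. norm z \<le> r \<Longrightarrow> norm (v z) \<le> B"
      using bounded_pos[of "v ` cball 0 r"] compact_imp_bounded by (metis imageI mem_cball_0)
    have "norm (q ((\<psi> ^^ n) z)) \<le> B * \<mu> ^ n" if "z \<in> K" for n z
    proof -
      let ?w = "(\<psi> ^^ n) z"
      have z: "norm z \<le> r" "norm z \<le> 1" using that r by auto
      have "\<mu> ^ n * norm z \<le> 1 * norm z"
        using \<mu> by (intro mult_right_mono power_le_one) auto
      then have w: "norm ?w \<le> r" "norm ?w < 1" using \<mu>(3)[OF z(1), of n] z r(2) by auto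
      have "norm ?w \<le> \<mu> ^ n * 1" 
        by (rule order_trans[OF \<mu>(3)[OF z(1)] mult_left_mono[OF z(2)]]) (use \<mu>(1) in simp)
      then have "norm ?w * norm (v ?w) \<le> (\<mu> ^ n * 1) * B"
        using B w(1) \<mu>(1) by (intro mult_mono) auto
      then show ?thesis by (simp add: v(2)[OF w(2)] norm_mult mult_ac)
    qed
    moreover have "(\<lambda>n. B * \<mu> ^ n) summable_on UNIV"
      using B(1) \<mu> by (simp add: summable_on_UNIV_nonneg_real_iff summable_mult)
    ultimately show ?thesis by blast
  qed
  have "Q holomorphic_on ball 0 1"
    unfolding Q_def
  proof (rule holomorphic_on_infsum(1)[OF open_ball _ bound])
    show "(\<lambda>z. q ((\<psi> ^^ n) z)) holomorphic_on ball 0 1" for n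
    proof -
      have "(\<psi> ^^ n) ` ball 0 1 \<subseteq> ball 0 1" using iterate_in_disc by auto
      then show ?thesis
        using holomorphic_on_compose_gen[OF iterate_holomorphic[of n] q(1)] by (simp add: o_def)
    qed
  qed
  moreover have "Q z - Q (\<psi> z) = q z" if z: "norm z < 1" for z
  proof -
    obtain M where M: "M summable_on (UNIV :: nat set)" "\<And>n. norm (q ((\<psi> ^^ n) z)) \<le> M n"
      using bound[of "{z}"] z by auto
    have "(\<lambda>n. norm (q ((\<psi> ^^ n) z))) summable_on UNIV"
      using M(1) by (rule summable_on_comparison_test) (use M(2) in auto)
    then have s: "(\<lambda>n. q ((\<psi> ^^ n) z)) summable_on UNIV" by (rule abs_summable_summable)
    have "Q z = (\<Sum>\<^sub>\<infinity>n\<in>insert 0 (range Suc). q ((\<psi> ^^ n) z))"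
      unfolding Q_def by (rule arg_cong[where f = "infsum _"]) (rule UNIV_nat_eq)
    also have "\<dots> = q z + (\<Sum>\<^sub>\<infinity>n\<in>range Suc. q ((\<psi> ^^ n) z))"
      by (subst infsum_insert) (auto intro: summable_on_subset[OF s])
    also have "(\<Sum>\<^sub>\<infinity>n\<in>range Suc. q ((\<psi> ^^ n) z)) = Q (\<psi> z)"
      by (subst infsum_reindex) (auto simp: Q_def o_def funpow_swap1)
    finally show ?thesis by simp
  qed
  ultimately show ?thesis using that by blast
qed

lemma multiplier_nonzero: "deriv \<psi> 0 \<noteq> 0"
  using holomorphic_injective_imp_regular[OF holomorphic open_ball injective] by simp

text \<open>Koenigs' function, obtained from the cohomological equation: if \<open>\<psi> z = l * z * exp (q z)\<close> with
  \<open>l = deriv \<psi> 0\<close> and \<open>Q - Q \<circ> \<psi> = q\<close>, then \<open>z * exp (Q z)\<close> linearizes \<open>\<psi>\<close>.\<close>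

lemma koenigs_linearization:
  obtains \<phi> Q where "\<phi> holomorphic_on ball 0 1" "Q holomorphic_on ball 0 1"
    "\<And>z. norm z < 1 \<Longrightarrow> \<phi> z = z * exp (Q z)"
    "\<And>z. norm z < 1 \<Longrightarrow> \<phi> (\<psi> z) = deriv \<psi> 0 * \<phi> z" "inj_on \<phi> (ball 0 1)"
proof -
  let ?l = "deriv \<psi> 0"
  obtain u where u: "u holomorphic_on ball 0 1" "\<And>z. norm z < 1 \<Longrightarrow> \<psi> z = z * u z" "?l = u 0"
    by (rule Schwarz3[OF holomorphic fixes_0]) (rule that)
  have nz: "u z / ?l \<noteq> 0" if "z \<in> ball 0 1" for z
  proof (cases "z = 0")
    case False
    then have "\<psi> z \<noteq> \<psi> 0" using injective that by (auto simp: inj_on_def)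
    then show ?thesis using u(2)[of z] that multiplier_nonzero by (auto simp: fixes_0)
  qed (use u(3) multiplier_nonzero in auto)
  have hol_u: "(\<lambda>z. u z / ?l) holomorphic_on ball 0 1"
    using multiplier_nonzero by (intro holomorphic_intros u(1)) auto
  obtain g where g: "g holomorphic_on ball 0 1" "\<And>z. z \<in> ball 0 1 \<Longrightarrow> u z / ?l = exp (g z)"
    by (rule contractible_imp_holomorphic_log[OF hol_u convex_imp_contractible[OF convex_ball] nz]) (assumption, rule that)
  define q where "q z = g z - g 0" for z
  have "exp (g 0) = 1" using g(2)[of 0] u(3) multiplier_nonzero by simp
  then have \<psi>q: "\<psi> z = ?l * z * exp (q z)" if "norm z < 1" for z
    using g(2)[of z] u(2)[OF that] that multiplier_nonzero by (simp add: q_def exp_diff field_simps)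
  have "q holomorphic_on ball 0 1" "q 0 = 0"
    unfolding q_def by (auto intro!: holomorphic_intros g(1))
  then obtain Q where Q: "Q holomorphic_on ball 0 1" "\<And>z. norm z < 1 \<Longrightarrow> Q z - Q (\<psi> z) = q z"
    by (rule cohomological_equation) (rule that)
  define \<phi> where "\<phi> z = z * exp (Q z)" for z
  have hol: "\<phi> holomorphic_on ball 0 1"
    unfolding \<phi>_def by (intro holomorphic_intros Q(1))
  have conj: "\<phi> (\<psi> z) = ?l * \<phi> z" if "norm z < 1" for z
  proof -
    have "q z + Q (\<psi> z) = Q z" using Q(2)[OF that] by (simp flip: Q(2)[OF that])
    then have "exp (q z) * exp (Q (\<psi> z)) = exp (Q z)" by (simp flip: exp_add)
    then show ?thesis using \<psi>q[OF that] by (simp add: \<phi>_def mult.assoc)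
  qed
  have conj_n: "\<phi> ((\<psi> ^^ n) z) = ?l ^ n * \<phi> z" if "norm z < 1" for n z
    by (induction n) (use conj iterate_in_disc[OF that] in auto)
  have "(\<phi> has_field_derivative (exp (Q 0))) (at 0)"
  proof -
    have "(Q has_field_derivative deriv Q 0) (at 0)" by (rule holomorphic_derivI[OF Q(1) open_ball]) auto
    then show ?thesis unfolding \<phi>_def by (auto intro!: derivative_eq_intros)
  qed
  then have "deriv \<phi> 0 \<noteq> 0" by (simp add: DERIV_imp_deriv)
  then obtain r where r: "r > 0" "inj_on \<phi> (ball 0 r)"
    using has_complex_derivative_locally_injective[OF hol _ open_ball, of 0] by auto
  \<comment> \<open>Injectivity near \<open>0\<close> spreads to the whole disc, since all orbits of \<open>\<psi>\<close> tend to \<open>0\<close>.\<close>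
  have "inj_on \<phi> (ball 0 1)"
  proof (rule inj_onI)
    fix a b :: complex assume ab: "a \<in> ball 0 1" "b \<in> ball 0 1" "\<phi> a = \<phi> b"
    have ev: "\<forall>\<^sub>F n in sequentially. (\<psi> ^^ n) c \<in> ball 0 r" if "c \<in> ball 0 1" for c
      using tendstoD[OF iterates_tendsto_0, of c r] that r(1) by (simp add: dist_commute)
    have "\<forall>\<^sub>F n in sequentially. (\<psi> ^^ n) a \<in> ball 0 r \<and> (\<psi> ^^ n) b \<in> ball 0 r"
      using ev ab by (auto intro: eventually_conj)
    then obtain n where n: "(\<psi> ^^ n) a \<in> ball 0 r" "(\<psi> ^^ n) b \<in> ball 0 r"
      by (auto simp: eventually_sequentially)
    have "\<phi> ((\<psi> ^^ n) a) = \<phi> ((\<psi> ^^ n) b)" using conj_n ab by simp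
    then have eq: "(\<psi> ^^ n) a = (\<psi> ^^ n) b" using r(2) n by (auto simp: inj_on_def)
    have "inj_on (\<psi> ^^ n) (ball 0 1)" for n
    proof (induction n)
      case (Suc n)
      have "inj_on (\<psi> \<circ> (\<psi> ^^ n)) (ball 0 1)"
        by (intro comp_inj_on Suc.IH inj_on_subset[OF injective]) (use iterate_in_disc in auto)
      then show ?case by (simp only: funpow.simps)
    qed simp
    then show "a = b" using eq ab(1,2) by (auto simp: inj_on_def)
  qed
  then show ?thesis using that[OF hol Q(1)] conj by (simp add: \<phi>_def)
qed

text \<open>A principal part at the puncture cannot be summed along forward orbits. In the linearizing coordinate it is
  however defined on the whole punctured plane and vanishes at infinity, so it can be summed along backward orbits
  \<open>\<phi> z / l\<^sup>n\<close> even where \<open>\<psi>\<close> has no inverse.\<close>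

lemma cohomological_equation_principal:
  assumes h: "h holomorphic_on UNIV" and \<phi>: "\<phi> holomorphic_on ball 0 1"
    and nz: "\<And>z. z \<in> punctured_disc \<Longrightarrow> \<phi> z \<noteq> 0"
    and conj: "\<And>z. norm z < 1 \<Longrightarrow> \<phi> (\<psi> z) = deriv \<psi> 0 * \<phi> z"
  obtains G where "G holomorphic_on punctured_disc"
    "\<And>z. z \<in> punctured_disc \<Longrightarrow> G z - G (\<psi> z) = h (1 / \<phi> z) / \<phi> z"
proof -
  let ?l = "deriv \<psi> 0"
  define m where "m w = w * h w" for w
  \<comment> \<open>The principal part \<open>h (1 / \<phi>) / \<phi>\<close> is \<open>m (1 / \<phi>)\<close>, and replacing \<open>z\<close> by \<open>\<psi> z\<close> lowers the power of \<open>?l\<close> by one.\<close>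
  define G where "G z = - (\<Sum>\<^sub>\<infinity>n\<in>range Suc. m (?l ^ n / \<phi> z))" for z
  have op: "open punctured_disc" by (auto intro!: open_Diff)
  have bound: "\<exists>M. M summable_on UNIV \<and> (\<forall>n\<in>UNIV. \<forall>z\<in>K. norm (m (?l ^ n / \<phi> z)) \<le> M n)"
    if K: "compact K" "K \<subseteq> punctured_disc" for K
  proof -
    have "\<forall>z\<in>K. \<phi> z \<noteq> 0" using K(2) nz by blast
    moreover have "K \<subseteq> ball 0 1" using K(2) by auto
    ultimately have "continuous_on K (\<lambda>z. 1 / \<phi> z)"
      by (intro continuous_intros holomorphic_on_imp_continuous_on holomorphic_on_subset[OF \<phi>])
    then have "bounded ((\<lambda>z. 1 / \<phi> z) ` K)"
      using K(1) compact_continuous_image compact_imp_bounded by blast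
    then obtain R where R: "R > 0" "\<And>z. z \<in> K \<Longrightarrow> norm (1 / \<phi> z) \<le> R"
      using bounded_pos by (metis imageI)
    have "compact (h ` cball 0 R)"
      by (intro compact_continuous_image holomorphic_on_imp_continuous_on holomorphic_on_subset[OF h]) auto
    then obtain B where B: "B > 0" "\<And>z. norm z \<le> R \<Longrightarrow> norm (h z) \<le> B"
      using bounded_pos[of "h ` cball 0 R"] compact_imp_bounded by (metis imageI mem_cball_0)
    have "norm (m (?l ^ n / \<phi> z)) \<le> (R * B) * norm ?l ^ n" if "z \<in> K" for n z
    proof -
      let ?w = "?l ^ n / \<phi> z"
      have w: "norm ?w \<le> norm ?l ^ n * R"
        using mult_left_mono[OF R(2)[OF that], of "norm ?l ^ n"] by (simp add: norm_divide norm_power)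
      also have "\<dots> \<le> 1 * R" using multiplier_less_1 R(1) by (intro mult_right_mono power_le_one) auto
      finally have "norm (h ?w) \<le> B" using B(2) by simp
      then have "norm ?w * norm (h ?w) \<le> (norm ?l ^ n * R) * B"
        using w B(1) R(1) by (intro mult_mono) auto
      then show ?thesis unfolding m_def norm_mult by (simp only: mult_ac)
    qed
    moreover have "(\<lambda>n. (R * B) * norm ?l ^ n) summable_on UNIV"
      using B(1) R(1) multiplier_less_1 by (simp add: summable_on_UNIV_nonneg_real_iff summable_mult)
    ultimately show ?thesis by blast
  qed
  have "(\<lambda>z. \<Sum>\<^sub>\<infinity>n\<in>range Suc. m (?l ^ n / \<phi> z)) holomorphic_on punctured_disc"
  proof (rule holomorphic_on_infsum(1)[OF op])
    fix n
    have "(m \<circ> (\<lambda>z. ?l ^ n / \<phi> z)) holomorphic_on punctured_disc"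
      unfolding m_def using nz
      by (intro holomorphic_on_compose_gen[where t = UNIV] holomorphic_intros holomorphic_on_subset[OF \<phi>] h) auto
    then show "(\<lambda>z. m (?l ^ n / \<phi> z)) holomorphic_on punctured_disc" by (simp add: o_def)
  next
    fix K assume "compact K" "K \<subseteq> punctured_disc"
    then obtain M where "M summable_on (UNIV::nat set)" "\<forall>n\<in>UNIV. \<forall>z\<in>K. norm (m (?l ^ n / \<phi> z)) \<le> M n"
      using bound by meson
    then show "\<exists>M. M summable_on range Suc \<and> (\<forall>n\<in>range Suc. \<forall>z\<in>K. norm (m (?l ^ n / \<phi> z)) \<le> M n)"
      using summable_on_subset[of M UNIV "range Suc"] by (intro exI[of _ M]) auto
  qed
  then have "G holomorphic_on punctured_disc" unfolding G_def by (rule holomorphic_on_minus)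
  moreover have "G z - G (\<psi> z) = h (1 / \<phi> z) / \<phi> z" if z: "z \<in> punctured_disc" for z
  proof -
    let ?t = "\<lambda>n. m (?l ^ n / \<phi> z)"
    obtain M where M: "M summable_on (UNIV :: nat set)" "\<And>n. norm (?t n) \<le> M n"
      using bound[of "{z}"] z by auto
    have "(\<lambda>n. norm (?t n)) summable_on UNIV"
      using M(1) by (rule summable_on_comparison_test) (use M(2) in auto)
    then have s: "?t summable_on UNIV" by (rule abs_summable_summable)
    have "- G (\<psi> z) = (\<Sum>\<^sub>\<infinity>n\<in>range Suc. m (?l ^ n / (?l * \<phi> z)))"
      using z by (simp add: G_def conj)
    also have "\<dots> = infsum ?t UNIV"
      by (subst infsum_reindex) (use multiplier_nonzero in \<open>auto simp: o_def\<close>)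
    also have "\<dots> = infsum ?t (insert 0 (range Suc))"
      by (rule arg_cong[where f = "infsum _"]) (rule UNIV_nat_eq)
    also have "\<dots> = ?t 0 - G z"
      by (subst infsum_insert) (auto intro: summable_on_subset[OF s] simp: G_def)
    finally have "- G (\<psi> z) + G z = h (1 / \<phi> z) / \<phi> z" by (simp add: m_def)
    then show ?thesis by (simp only: diff_conv_add_uminus add.commute)
  qed
  ultimately show ?thesis using that by blast
qed

text \<open>Up to the exponential of a coboundary \<open>G - G \<circ> \<psi>\<close>, the multiplier is a monomial in the linearizing coordinate: after
  splitting the exponent into its principal part and the rest, each part is a coboundary, except for
  the constant \<open>g 0\<close>. Hence conjugation with multiplication by \<open>exp G\<close> turns the operator into
  \<open>f \<mapsto> c * \<phi>\<^sup>k * (f \<circ> \<psi>)\<close>.\<close>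

lemma multiplier_normal_form:
  fixes k :: int
  assumes W: "W holomorphic_on punctured_disc"
    and \<omega>: "\<And>z. z \<in> punctured_disc \<Longrightarrow> \<omega> z = z powi k * exp (W z)"
  obtains \<phi> Q G c where "\<phi> holomorphic_on ball 0 1" "inj_on \<phi> (ball 0 1)"
    "Q holomorphic_on ball 0 1" "\<And>z. norm z < 1 \<Longrightarrow> \<phi> z = z * exp (Q z)"
    "\<And>z. norm z < 1 \<Longrightarrow> \<phi> (\<psi> z) = deriv \<psi> 0 * \<phi> z"
    "G holomorphic_on punctured_disc" "c \<noteq> 0"
    "\<And>z. z \<in> punctured_disc \<Longrightarrow> \<omega> z * exp (G (\<psi> z)) = c * \<phi> z powi k * exp (G z)"
proof -
  obtain \<phi> Q where \<phi>: "\<phi> holomorphic_on ball 0 1" and Q: "Q holomorphic_on ball 0 1"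
    and \<phi>Q: "\<And>z. norm z < 1 \<Longrightarrow> \<phi> z = z * exp (Q z)"
    and conj: "\<And>z. norm z < 1 \<Longrightarrow> \<phi> (\<psi> z) = deriv \<psi> 0 * \<phi> z" and inj: "inj_on \<phi> (ball 0 1)"
    by (rule koenigs_linearization) (rule that)
  have op: "open punctured_disc" by (auto intro!: open_Diff)
  have \<phi>0: "\<phi> 0 = 0" using \<phi>Q[of 0] by simp
  have nz: "\<phi> z \<noteq> 0" if "z \<in> punctured_disc" for z using that \<phi>Q[of z] by auto
  obtain i where i: "i holomorphic_on \<phi> ` ball 0 1" "\<And>z. z \<in> ball 0 1 \<Longrightarrow> i (\<phi> z) = z"
    by (rule holomorphic_has_inverse[OF \<phi> open_ball inj]) (rule that)
  \<comment> \<open>As \<open>\<phi> z = z * exp (Q z)\<close>, the multiplier is \<open>\<phi> powi k * exp V\<close>.\<close>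
  define V where "V z = W z - of_int k * Q z" for z
  have V: "V holomorphic_on punctured_disc"
    unfolding V_def by (intro holomorphic_intros W holomorphic_on_subset[OF Q]) auto
  have "open (\<phi> ` ball 0 1)" by (rule open_mapping_thm3[OF \<phi> open_ball inj])
  moreover have "0 \<in> \<phi> ` ball 0 1" using \<phi>0 by force
  moreover have "(V \<circ> i) holomorphic_on \<phi> ` ball 0 1 - {0}"
  proof (rule holomorphic_on_compose_gen[OF holomorphic_on_subset[OF i(1)] V])
    show "i ` (\<phi> ` ball 0 1 - {0}) \<subseteq> punctured_disc" using i(2) \<phi>0 by auto
  qed auto
  ultimately obtain h g where h: "h holomorphic_on UNIV" and g: "g holomorphic_on \<phi> ` ball 0 1"
    and split: "\<And>w. w \<in> \<phi> ` ball 0 1 - {0} \<Longrightarrow> (V \<circ> i) w = h (1 / w) / w + g w"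
    by (rule laurent_splitting) (rule that)
  have Vz: "V z = h (1 / \<phi> z) / \<phi> z + g (\<phi> z)" if "z \<in> punctured_disc" for z
    using split[of "\<phi> z"] i(2)[of z] nz[OF that] that by auto
  have "(\<lambda>z. g (\<phi> z) - g 0) holomorphic_on ball 0 1"
    using holomorphic_on_compose_gen[OF \<phi> g] by (auto intro!: holomorphic_intros simp: o_def)
  moreover have "g (\<phi> 0) - g 0 = 0" by (simp add: \<phi>0)
  ultimately obtain A where A: "A holomorphic_on ball 0 1" "\<And>z. norm z < 1 \<Longrightarrow> A z - A (\<psi> z) = g (\<phi> z) - g 0"
    by (rule cohomological_equation) (rule that)
  obtain B where B: "B holomorphic_on punctured_disc"
    "\<And>z. z \<in> punctured_disc \<Longrightarrow> B z - B (\<psi> z) = h (1 / \<phi> z) / \<phi> z"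
    by (rule cohomological_equation_principal[OF h \<phi> nz conj]) (assumption, assumption, rule that)
  define G where "G z = A z + B z" for z
  have G: "G holomorphic_on punctured_disc"
    unfolding G_def by (intro holomorphic_intros B(1) holomorphic_on_subset[OF A(1)]) auto
  have "\<omega> z * exp (G (\<psi> z)) = exp (g 0) * \<phi> z powi k * exp (G z)" if z: "z \<in> punctured_disc" for z
  proof -
    have z1: "norm z < 1" using z by auto
    have "W z + G (\<psi> z) = g 0 + of_int k * Q z + G z"
    proof -
      have "V z = (B z - B (\<psi> z)) + (A z - A (\<psi> z) + g 0)" using A(2)[OF z1] B(2)[OF z] Vz[OF z] by simp
      then show ?thesis by (simp add: G_def V_def algebra_simps)
    qed
    then have "exp (W z) * exp (G (\<psi> z)) = exp (g 0) * exp (of_int k * Q z) * exp (G z)"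
      by (simp flip: exp_add)
    moreover have "\<phi> z powi k = z powi k * exp (of_int k * Q z)"
      by (simp add: \<phi>Q[OF z1] power_int_mult_distrib exp_power_int)
    ultimately show ?thesis using \<omega>[OF z] by (simp add: mult_ac)
  qed
  then show ?thesis using that[OF \<phi> inj Q \<phi>Q conj G, of "exp (g 0)"] by simp
qed

end

section \<open>Approximation by Laurent polynomials in a univalent function\<close>

text \<open>Membership depends only on the values on \<open>K\<close>, by the last clause. Stating approximation results for an
  arbitrary such \<open>A\<close> allows them to be applied to closures of countable sets of functions and to be transported
  by a change of variable.\<close>

definition uniform_algebra :: "complex set \<Rightarrow> (complex \<Rightarrow> complex) set \<Rightarrow> bool" where
  "uniform_algebra K A \<longleftrightarrow> (\<forall>c. (\<lambda>z. c) \<in> A) \<and>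
     (\<forall>f\<in>A. \<forall>g\<in>A. (\<lambda>z. f z + g z) \<in> A \<and> (\<lambda>z. f z * g z) \<in> A) \<and>
     (\<forall>f. (\<forall>e>0. \<exists>g\<in>A. \<forall>z\<in>K. dist (g z) (f z) < e) \<longrightarrow> f \<in> A)"

context
  fixes K :: "complex set" and A :: "(complex \<Rightarrow> complex) set"
  assumes alg: "uniform_algebra K A"
begin

lemma algebra_const: "(\<lambda>z. c) \<in> A"
  and algebra_add: "f \<in> A \<Longrightarrow> g \<in> A \<Longrightarrow> (\<lambda>z. f z + g z) \<in> A"
  and algebra_mult: "f \<in> A \<Longrightarrow> g \<in> A \<Longrightarrow> (\<lambda>z. f z * g z) \<in> A"
  and algebra_limit: "(\<And>e. e > 0 \<Longrightarrow> \<exists>g\<in>A. \<forall>z\<in>K. dist (g z) (f z) < e) \<Longrightarrow> f \<in> A"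
  using alg by (auto simp: uniform_algebra_def)

lemma algebra_cong: "g \<in> A \<Longrightarrow> (\<And>z. z \<in> K \<Longrightarrow> f z = g z) \<Longrightarrow> f \<in> A"
  by (rule algebra_limit) (auto intro!: bexI[of _ g])

lemma algebra_scale: "f \<in> A \<Longrightarrow> (\<lambda>z. c * f z) \<in> A"
  using algebra_mult[OF algebra_const] .

lemma algebra_power: "f \<in> A \<Longrightarrow> (\<lambda>z. f z ^ n) \<in> A"
  by (induction n) (auto intro: algebra_const algebra_mult)

lemma algebra_sum: "finite I \<Longrightarrow> (\<And>i. i \<in> I \<Longrightarrow> f i \<in> A) \<Longrightarrow> (\<lambda>z. \<Sum>i\<in>I. f i z) \<in> A"
  by (induction I rule: finite_induct) (auto intro: algebra_const algebra_add)

text \<open>The geometric series converges uniformly.\<close>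

lemma algebra_neumann:
  assumes g: "g \<in> A" and \<rho>: "\<rho> < 1" "\<And>z. z \<in> K \<Longrightarrow> norm (g z) \<le> \<rho>"
  shows "(\<lambda>z. 1 / (1 - g z)) \<in> A"
proof (cases "K = {}")
  case True
  then show ?thesis by (intro algebra_cong[OF g]) auto
next
  case False
  then have \<rho>0: "\<rho> \<ge> 0" using \<rho>(2) norm_ge_zero order_trans by blast
  show ?thesis
  proof (rule algebra_limit)
    fix e :: real assume "e > 0"
    have "(\<lambda>n. \<rho> ^ n / (1 - \<rho>)) \<longlonglongrightarrow> 0 / (1 - \<rho>)"
      using \<rho>0 \<rho>(1) by (intro tendsto_intros LIMSEQ_power_zero) auto
    then have "\<forall>\<^sub>F n in sequentially. \<rho> ^ n / (1 - \<rho>) < e"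
      using \<open>e > 0\<close> by (intro order_tendstoD) auto
    then obtain n where n: "\<rho> ^ n / (1 - \<rho>) < e" by (auto simp: eventually_sequentially)
    have "dist (\<Sum>i<n. g z ^ i) (1 / (1 - g z)) < e" if "z \<in> K" for z
    proof -
      have gz: "norm (g z) \<le> \<rho>" using \<rho>(2) that .
      then have ne: "g z \<noteq> 1" using \<rho>(1) by auto
      have "(\<Sum>i<n. g z ^ i) - 1 / (1 - g z) = - (g z ^ n / (1 - g z))"
        using ne by (simp add: sum_gp_strict diff_divide_distrib)
      then have "dist (\<Sum>i<n. g z ^ i) (1 / (1 - g z)) = norm (g z) ^ n / norm (1 - g z)"
        by (simp add: dist_norm norm_divide norm_power)
      also have "\<dots> \<le> \<rho> ^ n / (1 - \<rho>)"
      proof (intro frac_le power_mono gz)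
        show "1 - \<rho> \<le> norm (1 - g z)"
          using norm_triangle_ineq2[of 1 "g z"] gz by simp
      qed (use \<rho>0 \<rho>(1) in auto)
      finally show ?thesis using n by simp
    qed
    moreover have "(\<lambda>z. \<Sum>i<n. g z ^ i) \<in> A" by (intro algebra_sum algebra_power g) auto
    ultimately show "\<exists>h\<in>A. \<forall>z\<in>K. dist (h z) (1 / (1 - g z)) < e"
      by (intro bexI[of _ "\<lambda>z. \<Sum>i<n. g z ^ i"]) auto
  qed
qed

text \<open>Runge's pole pushing. The reciprocal belongs to \<open>A\<close> for distant poles, and from a pole it can be pushed to all
  nearby poles by a geometric series; connectedness of \<open>S\<close> does the rest.\<close>

lemma algebra_pole_pushing:
  assumes K: "compact K" and \<phi>: "\<phi> \<in> A" "continuous_on K \<phi>"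
    and S: "connected S" "\<not> bounded S" "S \<inter> \<phi> ` K = {}" and a: "a \<in> S"
  shows "(\<lambda>z. 1 / (a - \<phi> z)) \<in> A"
proof -
  have cK: "compact (\<phi> ` K)" using \<phi>(2) K by (rule compact_continuous_image)
  obtain R where R: "R > 0" "\<And>z. z \<in> K \<Longrightarrow> norm (\<phi> z) \<le> R"
    using bounded_pos[of "\<phi> ` K"] compact_imp_bounded[OF cK] by (metis imageI)
  obtain b where b: "b \<in> S" "norm b > 2 * R"
    using S(2) by (auto simp: bounded_iff not_le)
  have far: "(\<lambda>z. 1 / (b - \<phi> z)) \<in> A"
  proof -
    have b0: "b \<noteq> 0" using b R by auto
    have "(\<lambda>z. 1 / (1 - (1 / b) * \<phi> z)) \<in> A"
    proof (rule algebra_neumann[where \<rho> = "1 / 2"])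
      show "norm ((1 / b) * \<phi> z) \<le> 1 / 2" if "z \<in> K" for z
        using R(2)[OF that] b b0 by (simp add: norm_mult norm_divide divide_simps)
    qed (rule algebra_scale[OF \<phi>(1)], simp)
    then have "(\<lambda>z. (1 / b) * (1 / (1 - (1 / b) * \<phi> z))) \<in> A" by (rule algebra_scale)
    moreover have "(1 / b) * (1 / (1 - (1 / b) * \<phi> z)) = 1 / (b - \<phi> z)" for z
      using b0 by (simp add: field_simps)
    ultimately show ?thesis by simp
  qed
  show ?thesis
  proof (rule connected_induction_simple[where P = "\<lambda>a. (\<lambda>z. 1 / (a - \<phi> z)) \<in> A", OF S(1) b(1) a far])
    fix c assume c: "c \<in> S"
    have "c \<notin> \<phi> ` K" using c S(3) by auto
    then have "\<exists>d>0. \<forall>w\<in>\<phi> ` K. d \<le> dist c w"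
      by (rule separate_point_closed[OF compact_imp_closed[OF cK]])
    then obtain d where d: "d > 0" "\<And>z. z \<in> K \<Longrightarrow> d \<le> dist c (\<phi> z)" by auto
    have move: "(\<lambda>z. 1 / (y - \<phi> z)) \<in> A"
      if x: "x \<in> ball c (d / 5)" and y: "y \<in> ball c (d / 5)" and xA: "(\<lambda>z. 1 / (x - \<phi> z)) \<in> A" for x y
    proof -
      have xy: "norm (x - y) \<le> 2 * d / 5"
        using dist_triangle[of x y c] x y by (simp add: dist_norm norm_minus_commute)
      have far: "norm (w - \<phi> z) \<ge> 4 * d / 5" if "z \<in> K" "w \<in> ball c (d / 5)" for z w
        using d(2)[OF that(1)] that(2) dist_triangle[of c "\<phi> z" w] by (simp add: dist_norm)
      \<comment> \<open>The radius \<open>d / 5\<close> keeps the modulus of \<open>(x - y) / (x - \<phi> z)\<close> at most \<open>1 / 2\<close>.\<close>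
      have "(\<lambda>z. 1 / (1 - (x - y) * (1 / (x - \<phi> z)))) \<in> A"
      proof (rule algebra_neumann[where \<rho> = "1 / 2"])
        show "norm ((x - y) * (1 / (x - \<phi> z))) \<le> 1 / 2" if z: "z \<in> K" for z
        proof -
          have "norm (x - y) / norm (x - \<phi> z) \<le> (2 * d / 5) / (4 * d / 5)"
            using xy far[OF z x] d(1) by (intro frac_le) auto
          then show ?thesis using d(1) by (simp add: norm_mult norm_divide)
        qed
      qed (rule algebra_scale[OF xA], simp)
      then have "(\<lambda>z. 1 / (x - \<phi> z) * (1 / (1 - (x - y) * (1 / (x - \<phi> z))))) \<in> A"
        by (rule algebra_mult[OF xA])
      then show ?thesis
      proof (rule algebra_cong)
        fix z assume z: "z \<in> K"
        have "x - \<phi> z \<noteq> 0" "y - \<phi> z \<noteq> 0" using far[OF z x] far[OF z y] d(1) by auto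
        then show "1 / (y - \<phi> z) = 1 / (x - \<phi> z) * (1 / (1 - (x - y) * (1 / (x - \<phi> z))))"
          by (simp add: divide_simps)
      qed
    qed
    show "\<exists>T. openin (top_of_set S) T \<and> c \<in> T \<and>
        (\<forall>x\<in>T. \<forall>y\<in>T. (\<lambda>z. 1 / (x - \<phi> z)) \<in> A \<longrightarrow> (\<lambda>z. 1 / (y - \<phi> z)) \<in> A)"
    proof (intro exI[of _ "S \<inter> ball c (d / 5)"] conjI ballI impI)
      show "openin (top_of_set S) (S \<inter> ball c (d / 5))" by (rule openin_open_Int) simp
      show "c \<in> S \<inter> ball c (d / 5)" using c d(1) by simp
      fix x y assume "x \<in> S \<inter> ball c (d / 5)" "y \<in> S \<inter> ball c (d / 5)" "(\<lambda>z. 1 / (x - \<phi> z)) \<in> A"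
      then show "(\<lambda>z. 1 / (y - \<phi> z)) \<in> A" by (intro move[of x y]) simp_all
    qed
  qed
qed

text \<open>Riemann sums converge uniformly in the parameter.\<close>

lemma algebra_integral:
  fixes H :: "real \<Rightarrow> complex \<Rightarrow> complex"
  assumes K: "compact K" and H: "continuous_on ({0..1} \<times> K) (\<lambda>(t, z). H t z)"
    and HA: "\<And>t. t \<in> {0..1} \<Longrightarrow> H t \<in> A"
  shows "(\<lambda>z. integral {0..1} (\<lambda>t. H t z)) \<in> A"
proof (rule algebra_limit)
  fix e :: real assume e: "e > 0"
  have "uniformly_continuous_on ({0..1} \<times> K) (\<lambda>(t, z). H t z)"
    using H K by (intro compact_uniformly_continuous compact_Times) auto
  then obtain d where d: "d > 0" and unif: "\<And>x y. x \<in> {0..1} \<times> K \<Longrightarrow> y \<in> {0..1} \<times> K \<Longrightarrow>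
      dist y x < d \<Longrightarrow> dist ((\<lambda>(t, z). H t z) y) ((\<lambda>(t, z). H t z) x) < e / 2"
    unfolding uniformly_continuous_on_def using e by (metis half_gt_zero)
  obtain n where "inverse (real (Suc n)) < d" using reals_Archimedean[OF d] by (rule exE)
  then obtain N :: nat where N: "N > 0" "1 / real N < d"
    using that[of "Suc n"] by (simp add: inverse_eq_divide)
  have Hc: "continuous_on {a..b} (\<lambda>t. H t z)" if "z \<in> K" "0 \<le> a" "b \<le> 1" for a b z
  proof -
    have "continuous_on {a..b} (\<lambda>t. (t, z))" by (intro continuous_intros)
    moreover have "(\<lambda>t. (t, z)) ` {a..b} \<subseteq> {0..1} \<times> K" using that by auto
    ultimately show ?thesis using continuous_on_compose2[OF H, of "{a..b}" "\<lambda>t. (t, z)"] by simp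
  qed
  have close: "norm (integral {0..real n / N} (\<lambda>t. H t z) - (\<Sum>i<n. (1 / N) * H (real i / N) z)) \<le> e / 2 * (n / N)"
    if z: "z \<in> K" and "n \<le> N" for z n
    using that(2)
  proof (induction n)
    case (Suc n)
    define a b where "a = real n / N" and "b = real (Suc n) / N"
    have ab: "0 \<le> a" "a \<le> b" "b \<le> 1" "b - a = 1 / N"
      using Suc.prems N by (auto simp: a_def b_def divide_simps)
    have split: "integral {0..a} (\<lambda>t. H t z) + integral {a..b} (\<lambda>t. H t z) = integral {0..b} (\<lambda>t. H t z)"
      using ab z by (intro Henstock_Kurzweil_Integration.integral_combine integrable_continuous_interval Hc) auto
    have "integral {a..b} (\<lambda>t. H t z) - (1 / N) * H a z = integral {a..b} (\<lambda>t. H t z - H a z)"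
      using ab z by (subst integral_diff) (auto intro!: integrable_continuous_interval Hc simp: scaleR_conv_of_real)
    also have "norm \<dots> \<le> e / 2 * (b - a)"
    proof (rule integral_bound)
      fix t assume t: "t \<in> {a..b}"
      have "dist (H t z) (H a z) < e / 2"
        using unif[of "(a, z)" "(t, z)"] t ab z N by (auto simp: dist_Pair_Pair dist_real_def)
      then show "norm (H t z - H a z) \<le> e / 2" by (simp add: dist_norm)
    qed (use ab z in \<open>auto intro!: continuous_intros Hc\<close>)
    finally have step: "norm (integral {a..b} (\<lambda>t. H t z) - (1 / N) * H a z) \<le> e / 2 * (b - a)" .
    have "integral {0..b} (\<lambda>t. H t z) - (\<Sum>i<Suc n. (1 / N) * H (real i / N) z) =
       (integral {0..a} (\<lambda>t. H t z) - (\<Sum>i<n. (1 / N) * H (real i / N) z)) +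
       (integral {a..b} (\<lambda>t. H t z) - (1 / N) * H a z)"
      by (simp add: a_def flip: split)
    moreover have IH: "norm (integral {0..a} (\<lambda>t. H t z) - (\<Sum>i<n. (1 / N) * H (real i / N) z)) \<le> e / 2 * a"
      using Suc.IH Suc.prems by (simp add: a_def)
    ultimately have "norm (integral {0..b} (\<lambda>t. H t z) - (\<Sum>i<Suc n. (1 / N) * H (real i / N) z)) \<le>
       e / 2 * a + e / 2 * (b - a)"
      using norm_triangle_mono[OF IH step] by (simp only:)
    then show ?case by (simp add: b_def algebra_simps)
  qed simp
  have "dist (\<Sum>i<N. (1 / N) * H (real i / N) z) (integral {0..1} (\<lambda>t. H t z)) < e" if "z \<in> K" for z
    using close[OF that, of N] N e by (simp add: dist_norm norm_minus_commute)
  moreover have "(\<lambda>z. \<Sum>i<N. (1 / N) * H (real i / N) z) \<in> A"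
    by (intro algebra_sum algebra_scale HA) (auto simp: N)
  ultimately show "\<exists>g\<in>A. \<forall>z\<in>K. dist (g z) (integral {0..1} (\<lambda>t. H t z)) < e"
    by (intro bexI[of _ "\<lambda>z. \<Sum>i<N. (1 / N) * H (real i / N) z"]) auto
qed

end

text \<open>The kernel \<open>\<phi>' u / (\<phi> u - \<phi> z)\<close> differs from the Cauchy kernel \<open>1 / (u - z)\<close> by a factor
  that is holomorphic in \<open>u\<close> and equals 1 at \<open>u = z\<close>.\<close>

lemma cauchy_formula_univalent:
  assumes \<phi>: "\<phi> holomorphic_on ball 0 1" "inj_on \<phi> (ball 0 1)" and F: "F holomorphic_on ball 0 1"
    and s: "0 < s" "s < 1" "norm z < s"
  shows "contour_integral (circlepath 0 s) (\<lambda>u. F u * deriv \<phi> u / (\<phi> u - \<phi> z)) = 2 * pi * \<i> * F z"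
proof -
  have z: "z \<in> ball 0 1" using s by simp
  \<comment> \<open>The divided difference, zero-free because \<open>\<phi>\<close> is injective.\<close>
  define m where "m u = (if u = z then deriv \<phi> z else (\<phi> u - \<phi> z) / (u - z))" for u
  have m: "m holomorphic_on ball 0 1"
    unfolding m_def by (rule pole_lemma[OF \<phi>(1)]) (use z in \<open>simp add: interior_open\<close>)
  have nz: "m u \<noteq> 0" if "u \<in> ball 0 1" for u
  proof (cases "u = z")
    case True
    then show ?thesis
      using holomorphic_injective_imp_regular[OF \<phi>(1) open_ball \<phi>(2) z] by (simp add: m_def)
  next
    case False
    then show ?thesis using \<phi>(2) that z by (auto simp: m_def inj_on_def)
  qed
  let ?g = "\<lambda>u. F u * deriv \<phi> u / m u"
  have "?g holomorphic_on cball 0 s"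
    by (rule holomorphic_on_subset[of _ "ball 0 1"])
       (use s nz in \<open>auto intro!: holomorphic_intros F m holomorphic_deriv[OF \<phi>(1)]\<close>)
  then have "((\<lambda>u. ?g u / (u - z)) has_contour_integral (2 * of_real pi * \<i> * ?g z)) (circlepath 0 s)"
    by (rule Cauchy_integral_circlepath_simple) (use s in simp)
  then have "((\<lambda>u. F u * deriv \<phi> u / (\<phi> u - \<phi> z)) has_contour_integral (2 * of_real pi * \<i> * ?g z)) (circlepath 0 s)"
    by (rule has_contour_integral_eq) (use s in \<open>auto simp: m_def\<close>)
  moreover have "?g z = F z" using nz[OF z] by (simp add: m_def)
  ultimately show ?thesis by (simp add: contour_integral_unique)
qed

lemma connected_complement_univalent_image:
  assumes \<phi>: "\<phi> holomorphic_on ball 0 1" "inj_on \<phi> (ball 0 1)" and r: "r < 1"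
  shows "connected (- \<phi> ` cball 0 r)"
proof (rule connected_complement_homeomorphic_convex_compact)
  have "continuous_on (cball 0 r) \<phi>" "inj_on \<phi> (cball 0 r)"
    using r by (auto intro!: holomorphic_on_imp_continuous_on holomorphic_on_subset[OF \<phi>(1)] inj_on_subset[OF \<phi>(2)])
  then have "cball (0::complex) r homeomorphic \<phi> ` cball 0 r"
    by (rule homeomorphic_compact[OF compact_cball _ refl])
  then show "\<phi> ` cball 0 r homeomorphic cball (0::complex) r" by (rule homeomorphic_sym[THEN iffD1])
qed auto

text \<open>Runge's theorem for the simply connected domain \<open>\<phi> ` ball 0 1\<close>, in the coordinate of the disc: \<open>F\<close> is an
  integral of functions with one pole each in the variable \<open>\<phi>\<close>, and these poles can be pushed to infinity,
  because the image of a smaller closed disc has connected complement.\<close>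

lemma algebra_contains_holomorphic_disc:
  assumes alg: "uniform_algebra K A" and K: "compact K" "K \<subseteq> cball 0 r" and r: "0 < r" "r < 1"
    and \<phi>: "\<phi> holomorphic_on ball 0 1" "inj_on \<phi> (ball 0 1)" "\<phi> \<in> A"
    and F: "F holomorphic_on ball 0 1"
  shows "F \<in> A"
proof -
  define s where "s = (r + 1) / 2"
  have s: "0 < s" "s < 1" "r < s" using r by (auto simp: s_def)
  define \<gamma> where "\<gamma> = circlepath 0 s"
  have \<gamma>: "norm (\<gamma> t) = s" for t using s by (simp add: \<gamma>_def circlepath norm_mult)
  have d\<phi>: "deriv \<phi> holomorphic_on ball 0 1" by (rule holomorphic_deriv[OF \<phi>(1) open_ball])
  define k where "k t = F (\<gamma> t) * deriv \<phi> (\<gamma> t) * vector_derivative \<gamma> (at t) / (2 * pi * \<i>)" for t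
  have ne: "\<phi> (\<gamma> t) \<noteq> \<phi> z" if "z \<in> cball 0 r" for z t
  proof
    assume "\<phi> (\<gamma> t) = \<phi> z"
    then have "\<gamma> t = z" using \<phi>(2) \<gamma>[of t] that s by (auto simp: inj_on_def)
    then show False using \<gamma>[of t] that s by auto
  qed
  have \<gamma>c: "continuous_on B \<gamma>" for B unfolding \<gamma>_def circlepath by (intro continuous_intros)
  have comp: "continuous_on B (\<lambda>x. g (\<gamma> (p x)))" if "g holomorphic_on ball 0 1" "continuous_on B p" for g p and B :: "'b::topological_space set"
    by (rule continuous_on_compose2[OF holomorphic_on_imp_continuous_on[OF that(1)]])
       (use \<gamma> s continuous_on_compose2[OF \<gamma>c[of UNIV] that(2)] in auto)
  have kc: "continuous_on {0..1} k"
    unfolding k_def using vector_derivative_circlepath[of 0 s]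
    by (auto intro!: continuous_intros comp F d\<phi> simp: \<gamma>_def[symmetric])
  have Fk: "F z = integral {0..1} (\<lambda>t. k t * (1 / (\<phi> (\<gamma> t) - \<phi> z)))" if z: "z \<in> K" for z
  proof -
    have "norm z < s" using z K s by auto
    have "integral {0..1} (\<lambda>t. F (\<gamma> t) * deriv \<phi> (\<gamma> t) / (\<phi> (\<gamma> t) - \<phi> z) * vector_derivative \<gamma> (at t)) = 2 * pi * \<i> * F z"
      using cauchy_formula_univalent[OF \<phi>(1,2) F s(1,2) \<open>norm z < s\<close>]
      by (simp add: contour_integral_integral \<gamma>_def)
    then have "F z = integral {0..1} (\<lambda>t. F (\<gamma> t) * deriv \<phi> (\<gamma> t) / (\<phi> (\<gamma> t) - \<phi> z) * vector_derivative \<gamma> (at t)) / (2 * pi * \<i>)"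
      by simp
    also have "\<dots> = integral {0..1} (\<lambda>t. F (\<gamma> t) * deriv \<phi> (\<gamma> t) / (\<phi> (\<gamma> t) - \<phi> z) * vector_derivative \<gamma> (at t) / (2 * pi * \<i>))"
      by (simp only: integral_divide)
    also have "\<dots> = integral {0..1} (\<lambda>t. k t * (1 / (\<phi> (\<gamma> t) - \<phi> z)))"
      by (rule integral_cong) (simp add: k_def)
    finally show ?thesis .
  qed
  have "(\<lambda>z. integral {0..1} (\<lambda>t. k t * (1 / (\<phi> (\<gamma> t) - \<phi> z)))) \<in> A"
  proof (rule algebra_integral[OF alg K(1)])
    have K1: "K \<subseteq> ball 0 1" using K(2) r by auto
    have "continuous_on ({0..1} \<times> K) (\<lambda>x. k (fst x) * (1 / (\<phi> (\<gamma> (fst x)) - \<phi> (snd x))))"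
    proof (intro continuous_intros comp \<phi>(1) ballI)
      show "continuous_on ({0..1} \<times> K) (\<lambda>x. k (fst x))"
        by (rule continuous_on_compose2[OF kc]) (auto intro!: continuous_intros)
      show "continuous_on ({0..1} \<times> K) (\<lambda>x. \<phi> (snd x))"
        by (rule continuous_on_compose2[OF holomorphic_on_imp_continuous_on[OF \<phi>(1)]])
           (use K1 in \<open>auto intro!: continuous_intros\<close>)
    qed (use ne K(2) in auto)
    then show "continuous_on ({0..1} \<times> K) (\<lambda>(t, z). k t * (1 / (\<phi> (\<gamma> t) - \<phi> z)))"
      by (simp add: case_prod_unfold)
    fix t :: real
    have comp: "compact (\<phi> ` cball 0 r)"
      using r by (intro compact_continuous_image holomorphic_on_imp_continuous_on holomorphic_on_subset[OF \<phi>(1)]) auto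
    have "(\<lambda>z. 1 / (\<phi> (\<gamma> t) - \<phi> z)) \<in> A"
    proof (rule algebra_pole_pushing[OF alg K(1) \<phi>(3)])
      show "connected (- \<phi> ` cball 0 r)" by (rule connected_complement_univalent_image[OF \<phi>(1,2) r(2)])
      show "\<not> bounded (- \<phi> ` cball 0 r)"
        by (rule cobounded_imp_unbounded) (simp add: compact_imp_bounded[OF comp])
      show "continuous_on K \<phi>"
        by (intro holomorphic_on_imp_continuous_on holomorphic_on_subset[OF \<phi>(1)] K1)
    qed (use K(2) ne in auto)
    then show "(\<lambda>z. k t * (1 / (\<phi> (\<gamma> t) - \<phi> z))) \<in> A" by (rule algebra_scale[OF alg])
  qed
  then show ?thesis by (rule algebra_cong[OF alg]) (use Fk in auto)
qed

text \<open>The functions \<open>1 / z\<close> and \<open>1 / \<phi> z\<close> have the same polar part up to a factor, so \<open>1 / z\<close> lies in the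
  algebra by the result for the disc. The principal part of \<open>f\<close> is an entire function of \<open>1 / z\<close>, and the
  result for the disc applies to it as well, after rescaling \<open>1 / z\<close> into a disc.\<close>

lemma algebra_contains_holomorphic_punctured_disc:
  assumes alg: "uniform_algebra K A" and K: "compact K" "K \<subseteq> punctured_disc"
    and \<phi>: "\<phi> holomorphic_on ball 0 1" "inj_on \<phi> (ball 0 1)" "\<phi> 0 = 0"
    and \<phi>A: "\<phi> \<in> A" "(\<lambda>z. 1 / \<phi> z) \<in> A"
    and f: "f holomorphic_on punctured_disc"
  shows "f \<in> A"
proof (cases "K = {}")
  case True
  then show ?thesis by (intro algebra_cong[OF alg \<phi>A(1)]) auto
next
  case False
  obtain m where m: "m \<in> K" "\<And>z. z \<in> K \<Longrightarrow> norm z \<le> norm m"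
    using continuous_attains_sup[OF K(1) False, of norm] by (auto intro: continuous_intros)
  have r: "0 < norm m" "norm m < 1" "K \<subseteq> cball 0 (norm m)" using m K by auto
  note disc = algebra_contains_holomorphic_disc[OF alg K(1) r(3,1,2) \<phi>(1,2) \<phi>A(1)]
  have inv: "(\<lambda>z. 1 / z) \<in> A"
  proof -
    obtain u where u: "u holomorphic_on ball 0 1" "\<And>z. norm z < 1 \<Longrightarrow> \<phi> z = z * u z" "deriv \<phi> 0 = u 0"
      by (rule Schwarz3[OF \<phi>(1,3)]) (rule that)
    have nz: "u z \<noteq> 0" if "norm z < 1" for z
    proof (cases "z = 0")
      case True
      then show ?thesis
        using holomorphic_injective_imp_regular[OF \<phi>(1) open_ball \<phi>(2), of 0] u(3) by simp
    next
      case False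
      then have "\<phi> z \<noteq> \<phi> 0" using \<phi>(2) that by (auto simp: inj_on_def)
      then show ?thesis using u(2)[OF that] \<phi>(3) by auto
    qed
    have "(\<lambda>z. u z - u 0) holomorphic_on ball 0 1" by (intro holomorphic_intros u(1))
    then obtain v where v: "v holomorphic_on ball 0 1" "\<And>z. norm z < 1 \<Longrightarrow> u z - u 0 = z * v z"
      using Schwarz3[of "\<lambda>z. u z - u 0" 1] by auto
    have "(\<lambda>z. v z / u z) \<in> A" by (rule disc) (use nz in \<open>auto intro!: holomorphic_intros u(1) v(1)\<close>)
    then have "(\<lambda>z. u 0 * (1 / \<phi> z) + v z / u z) \<in> A"
      by (intro algebra_add[OF alg] algebra_scale[OF alg] \<phi>A(2))
    then show ?thesis
    proof (rule algebra_cong[OF alg])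
      fix z assume "z \<in> K"
      then have z: "norm z < 1" "z \<noteq> 0" using K(2) by auto
      have "u 0 * (1 / \<phi> z) + v z / u z = (u 0 + z * v z) / (z * u z)"
        using nz[OF z(1)] z(2) by (simp add: u(2)[OF z(1)] divide_simps)
      also have "u 0 + z * v z = u z" by (simp flip: v(2)[OF z(1)])
      finally show "1 / z = u 0 * (1 / \<phi> z) + v z / u z" using nz[OF z(1)] by simp
    qed
  qed
  obtain h g where h: "h holomorphic_on UNIV" and g: "g holomorphic_on ball 0 1"
    and fz: "\<And>z. z \<in> punctured_disc \<Longrightarrow> f z = h (1 / z) / z + g z"
    using laurent_splitting[OF open_ball _ f] by auto
  have "continuous_on K (\<lambda>z. 1 / z)" using K(2) by (auto intro!: continuous_intros)
  then have "compact ((\<lambda>z. 1 / z) ` K)" using K(1) by (rule compact_continuous_image)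
  then obtain R where R: "R > 0" "\<And>z. z \<in> K \<Longrightarrow> norm (1 / z) \<le> R"
    using bounded_pos[of "(\<lambda>z. 1 / z) ` K"] compact_imp_bounded by (metis imageI)
  \<comment> \<open>The coordinate \<open>1 / (2 * R * z)\<close> maps \<open>K\<close> into the disc of radius \<open>1 / 2\<close>.\<close>
  define c where "c z = 1 / (2 * R * z)" for z :: complex
  define A' where "A' = {p. (\<lambda>z. p (c z)) \<in> A}"
  have alg': "uniform_algebra (c ` K) A'"
    unfolding uniform_algebra_def
  proof (intro conjI allI ballI impI)
    fix p assume ap: "\<forall>e>0. \<exists>q\<in>A'. \<forall>z\<in>c ` K. dist (q z) (p z) < e"
    have "(\<lambda>z. p (c z)) \<in> A"
    proof (rule algebra_limit[OF alg])
      fix e :: real assume "e > 0"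
      then obtain q where "q \<in> A'" "\<forall>z\<in>c ` K. dist (q z) (p z) < e" using ap by blast
      then show "\<exists>g\<in>A. \<forall>z\<in>K. dist (g z) (p (c z)) < e"
        by (intro bexI[of _ "\<lambda>z. q (c z)"]) (auto simp: A'_def)
    qed
    then show "p \<in> A'" by (simp add: A'_def)
  qed (auto simp: A'_def intro: algebra_const[OF alg] algebra_add[OF alg] algebra_mult[OF alg])
  have "(\<lambda>w. h (2 * R * w)) \<in> A'"
  proof (rule algebra_contains_holomorphic_disc[OF alg', where r = "1 / 2" and \<phi> = "\<lambda>w. w"])
    show "compact (c ` K)"
      unfolding c_def using K R(1) by (intro compact_continuous_image) (auto intro!: continuous_intros)
    show "c ` K \<subseteq> cball 0 (1 / 2)"
    proof clarify
      fix z assume "z \<in> K"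
      have "norm (c z) = norm (1 / z) / (2 * R)"
        using R(1) by (simp add: c_def norm_divide norm_mult)
      also have "\<dots> \<le> R / (2 * R)" using R(1) R(2)[OF \<open>z \<in> K\<close>] by (intro divide_right_mono) auto
      finally show "c z \<in> cball 0 (1 / 2)" using R(1) by simp
    qed
    show "(\<lambda>w. w) \<in> A'"
      using algebra_scale[OF alg inv, of "1 / (2 * R)"] by (simp add: A'_def c_def)
    show "(\<lambda>w. h (2 * R * w)) holomorphic_on ball 0 1"
      by (rule holomorphic_on_compose_gen[OF _ h, unfolded o_def]) (auto intro!: holomorphic_intros)
  qed auto
  then have "(\<lambda>z. h (2 * R * c z)) \<in> A" by (simp add: A'_def)
  then have "(\<lambda>z. h (2 * R * c z) * (1 / z) + g z) \<in> A"
    by (rule algebra_add[OF alg algebra_mult[OF alg _ inv] disc[OF g]])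
  then show ?thesis
  proof (rule algebra_cong[OF alg])
    fix z assume "z \<in> K"
    then have "z \<in> punctured_disc" using K(2) by auto
    then show "f z = h (2 * R * c z) * (1 / z) + g z" using fz[of z] R(1) by (simp add: c_def)
  qed
qed

section \<open>Homoclinic orbits of the normal form\<close>

text \<open>Rational coefficients make the family countable; a list is used as its code.\<close>

definition laurent_comb ::
    "(complex \<Rightarrow> complex) \<Rightarrow> (int \<times> rat \<times> rat) list \<Rightarrow> complex \<Rightarrow> complex" where
  "laurent_comb \<phi> xs z = (\<Sum>(j, a, b)\<leftarrow>xs. Complex (of_rat a) (of_rat b) * \<phi> z powi j)"

lemma laurent_comb_simps [simp]:
  "laurent_comb \<phi> [] z = 0"
  "laurent_comb \<phi> ((j, a, b) # xs) z = Complex (of_rat a) (of_rat b) * \<phi> z powi j + laurent_comb \<phi> xs z"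
  "laurent_comb \<phi> (xs @ ys) z = laurent_comb \<phi> xs z + laurent_comb \<phi> ys z"
  by (simp_all add: laurent_comb_def)

lemma laurent_comb_mult_monomial:
  assumes "\<phi> z \<noteq> 0"
  shows "laurent_comb \<phi> (map (\<lambda>(j, c, d). (i + j, a * c - b * d, a * d + b * c)) ys) z =
    Complex (of_rat a) (of_rat b) * \<phi> z powi i * laurent_comb \<phi> ys z"
proof (induction ys)
  case (Cons y ys)
  obtain j c d where y: "y = (j, c, d)" by (cases y) auto
  have "Complex (of_rat (a * c - b * d)) (of_rat (a * d + b * c)) =
      Complex (of_rat a) (of_rat b) * Complex (of_rat c) (of_rat d)"
    by (simp add: complex_eq_iff of_rat_mult of_rat_diff of_rat_add)
  then show ?case using Cons.IH assms by (simp add: y power_int_add algebra_simps)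
qed simp

lemma laurent_comb_mult:
  "\<exists>zs. \<forall>z. \<phi> z \<noteq> 0 \<longrightarrow> laurent_comb \<phi> zs z = laurent_comb \<phi> xs z * laurent_comb \<phi> ys z"
proof (induction xs)
  case Nil
  then show ?case by (intro exI[of _ "[]"]) simp
next
  case (Cons x xs)
  obtain i a b where x: "x = (i, a, b)" by (cases x) auto
  obtain zs where zs: "\<And>z. \<phi> z \<noteq> 0 \<Longrightarrow> laurent_comb \<phi> zs z = laurent_comb \<phi> xs z * laurent_comb \<phi> ys z"
    using Cons.IH by auto
  show ?case
    by (rule exI[of _ "map (\<lambda>(j, c, d). (i + j, a * c - b * d, a * d + b * c)) ys @ zs"])
       (simp add: zs x laurent_comb_mult_monomial ring_distribs)
qed

lemma rational_complex_approx:
  assumes "e > 0"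
  obtains a b :: rat where "dist (Complex (of_rat a) (of_rat b)) c < e"
proof -
  obtain a where a: "Re c < of_rat a" "of_rat a < Re c + e / 2"
    using of_rat_dense[of "Re c" "Re c + e / 2"] assms by auto
  obtain b where b: "Im c < of_rat b" "of_rat b < Im c + e / 2"
    using of_rat_dense[of "Im c" "Im c + e / 2"] assms by auto
  have "norm (Complex (of_rat a) (of_rat b) - c) \<le> \<bar>of_rat a - Re c\<bar> + \<bar>of_rat b - Im c\<bar>"
    using cmod_le[of "Complex (of_rat a) (of_rat b) - c"] by simp
  also have "\<dots> < e" using a b by simp
  finally show ?thesis using that[of a b] by (simp add: dist_norm)
qed

lemma laurent_comb_approximable_algebra:
  assumes K: "compact K" and \<phi>: "continuous_on K \<phi>" "\<And>z. z \<in> K \<Longrightarrow> \<phi> z \<noteq> 0"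
  shows "uniform_algebra K {f. \<forall>e>0. \<exists>xs. \<forall>z\<in>K. dist (laurent_comb \<phi> xs z) (f z) < e}"
    (is "uniform_algebra K ?A")
proof -
  have approx: "\<exists>xs. \<forall>z\<in>K. dist (laurent_comb \<phi> xs z) (f z) < e" if "f \<in> ?A" "e > 0" for f e
    using that by simp
  have bounded: "\<exists>B>0. \<forall>z\<in>K. norm (f z) \<le> B" if fA: "f \<in> ?A" for f
  proof -
    obtain xs where xs: "\<And>z. z \<in> K \<Longrightarrow> dist (laurent_comb \<phi> xs z) (f z) < 1"
      using approx[OF fA, of 1] by auto
    have "continuous_on K (laurent_comb \<phi> xs)"
    proof (induction xs)
      case Nil
      then show ?case by simp
    next
      case (Cons x xs)
      obtain i a b where x: "x = (i, a, b)" by (cases x) auto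
      show ?case using Cons.IH \<phi>(2) by (auto simp: x intro!: continuous_intros \<phi>(1))
    qed
    then have "compact (laurent_comb \<phi> xs ` K)" using K by (rule compact_continuous_image)
    then obtain B where B: "B > 0" "\<And>z. z \<in> K \<Longrightarrow> norm (laurent_comb \<phi> xs z) \<le> B"
      using bounded_pos[of "laurent_comb \<phi> xs ` K"] compact_imp_bounded by (metis imageI)
    have "norm (f z) \<le> B + 1" if "z \<in> K" for z
      using B(2)[OF that] xs[OF that] norm_triangle_ineq2[of "f z" "laurent_comb \<phi> xs z"]
      by (simp add: dist_norm norm_minus_commute)
    then show ?thesis using B(1) by (intro exI[of _ "B + 1"]) auto
  qed
  have const: "(\<lambda>z. c) \<in> ?A" for c
  proof (intro CollectI allI impI)
    fix e :: real assume "e > 0"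
    then obtain a b where "dist (Complex (of_rat a) (of_rat b)) c < e" by (rule rational_complex_approx)
    then show "\<exists>xs. \<forall>z\<in>K. dist (laurent_comb \<phi> xs z) c < e"
      by (intro exI[of _ "[(0, a, b)]"]) simp
  qed
  have add: "(\<lambda>z. f z + g z) \<in> ?A" if f: "f \<in> ?A" and g: "g \<in> ?A" for f g
  proof (intro CollectI allI impI)
    fix e :: real assume e: "e > 0"
    obtain xs where xs: "\<And>z. z \<in> K \<Longrightarrow> dist (laurent_comb \<phi> xs z) (f z) < e / 2"
      using approx[OF f, of "e / 2"] e by auto
    obtain ys where ys: "\<And>z. z \<in> K \<Longrightarrow> dist (laurent_comb \<phi> ys z) (g z) < e / 2"
      using approx[OF g, of "e / 2"] e by auto
    have "dist (laurent_comb \<phi> (xs @ ys) z) (f z + g z) < e" if "z \<in> K" for z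
      using xs[OF that] ys[OF that] dist_triangle_add[of "laurent_comb \<phi> xs z" "laurent_comb \<phi> ys z" "f z" "g z"]
      by simp
    then show "\<exists>xs. \<forall>z\<in>K. dist (laurent_comb \<phi> xs z) (f z + g z) < e"
      by (intro exI[of _ "xs @ ys"]) auto
  qed
  have mult: "(\<lambda>z. f z * g z) \<in> ?A" if f: "f \<in> ?A" and g: "g \<in> ?A" for f g
  proof (intro CollectI allI impI)
    fix e :: real assume e: "e > 0"
    obtain B C where B: "B > 0" "\<And>z. z \<in> K \<Longrightarrow> norm (f z) \<le> B" and C: "C > 0" "\<And>z. z \<in> K \<Longrightarrow> norm (g z) \<le> C"
      using bounded[OF f] bounded[OF g] by auto
    \<comment> \<open>Errors \<open>d\<close> in the factors give an error of at most \<open>(B + 1) * d + d * C\<close> in the product.\<close>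
    define d where "d = min 1 (e / (B + C + 2))"
    have BC: "B + C + 2 > 0" using B(1) C(1) by simp
    have "d \<le> e / (B + C + 2)" by (simp add: d_def)
    then have "d * (B + C + 2) \<le> e" using BC by (simp add: pos_le_divide_eq)
    moreover have "d > 0" "d \<le> 1" using e BC by (simp_all add: d_def)
    ultimately have d: "d > 0" "d \<le> 1" "d * (B + C + 2) \<le> e" by auto
    obtain xs where xs: "\<And>z. z \<in> K \<Longrightarrow> dist (laurent_comb \<phi> xs z) (f z) < d"
      using approx[OF f d(1)] by auto
    obtain ys where ys: "\<And>z. z \<in> K \<Longrightarrow> dist (laurent_comb \<phi> ys z) (g z) < d"
      using approx[OF g d(1)] by auto
    obtain zs where zs: "\<And>z. \<phi> z \<noteq> 0 \<Longrightarrow> laurent_comb \<phi> zs z = laurent_comb \<phi> xs z * laurent_comb \<phi> ys z"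
      using laurent_comb_mult[of \<phi> xs ys] by auto
    have "dist (laurent_comb \<phi> zs z) (f z * g z) < e" if z: "z \<in> K" for z
    proof -
      let ?p = "laurent_comb \<phi> xs z" and ?q = "laurent_comb \<phi> ys z"
      have p: "norm ?p \<le> B + 1"
        using B(2)[OF z] xs[OF z] d(2) norm_triangle_ineq2[of ?p "f z"] by (simp add: dist_norm)
      have "?p * ?q - f z * g z = ?p * (?q - g z) + (?p - f z) * g z" by (simp add: algebra_simps)
      then have "norm (?p * ?q - f z * g z) \<le> norm (?p * (?q - g z)) + norm ((?p - f z) * g z)"
        by (simp only: norm_triangle_ineq)
      also have "\<dots> \<le> (B + 1) * d + d * C"
        unfolding norm_mult using p xs[OF z] ys[OF z] C(2)[OF z] B(1) C(1) d(1)
        by (intro add_mono mult_mono) (auto simp: dist_norm)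
      also have "\<dots> < d * (B + C + 2)" using d(1) by (simp add: algebra_simps)
      finally show ?thesis using d(3) zs[OF \<phi>(2)[OF z]] by (simp add: dist_norm)
    qed
    then show "\<exists>xs. \<forall>z\<in>K. dist (laurent_comb \<phi> xs z) (f z * g z) < e" by auto
  qed
  have limit: "f \<in> ?A" if f: "\<forall>e>0. \<exists>g\<in>?A. \<forall>z\<in>K. dist (g z) (f z) < e" for f
  proof (intro CollectI allI impI)
    fix e :: real assume e: "e > 0"
    obtain g where g: "g \<in> ?A" "\<And>z. z \<in> K \<Longrightarrow> dist (g z) (f z) < e / 2"
      using f[rule_format, of "e / 2"] e by auto
    obtain xs where xs: "\<And>z. z \<in> K \<Longrightarrow> dist (laurent_comb \<phi> xs z) (g z) < e / 2"
      using approx[OF g(1), of "e / 2"] e by auto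
    have "dist (laurent_comb \<phi> xs z) (f z) < e" if "z \<in> K" for z
      using xs[OF that] g(2)[OF that] dist_triangle[of "laurent_comb \<phi> xs z" "f z" "g z"] by simp
    then show "\<exists>xs. \<forall>z\<in>K. dist (laurent_comb \<phi> xs z) (f z) < e" by auto
  qed
  show ?thesis unfolding uniform_algebra_def
  proof (intro conjI allI ballI impI)
    show "(\<lambda>z. c) \<in> ?A" for c by (rule const)
    show "(\<lambda>z. f z + g z) \<in> ?A" if "f \<in> ?A" "g \<in> ?A" for f g using that by (rule add)
    show "(\<lambda>z. f z * g z) \<in> ?A" if "f \<in> ?A" "g \<in> ?A" for f g using that by (rule mult)
    show "f \<in> ?A" if "\<forall>e>0. \<exists>g\<in>?A. \<forall>z\<in>K. dist (g z) (f z) < e" for f using that by (rule limit)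
  qed
qed

text \<open>Consecutive terms of \<open>M\<^sup>m * q^(m * (m - 1) div 2)\<close> have quotient \<open>M * q\<^sup>m\<close>, which tends to zero.\<close>

lemma superexponential_decay:
  fixes M q :: real
  assumes M: "M \<ge> 0" and q: "0 \<le> q" "q < 1"
  shows "\<exists>C. \<forall>m::nat. M ^ m * q ^ (m * (m - 1) div 2) \<le> C * (1 / 2) ^ m"
proof -
  define a where "a m = (2 * M) ^ m * q ^ (m * (m - 1) div 2)" for m :: nat
  have a0: "a m \<ge> 0" for m using M q by (simp add: a_def)
  have step: "a (Suc m) = a m * (2 * M * q ^ m)" for m
  proof -
    have "Suc m * m = m * (m - 1) + 2 * m" by (cases m) (auto simp: algebra_simps)
    then have "Suc m * (Suc m - 1) div 2 = m * (m - 1) div 2 + m" by simp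
    then show ?thesis by (simp only: a_def power_add power_Suc) simp
  qed
  have "(\<lambda>m. 2 * M * q ^ m) \<longlonglongrightarrow> 2 * M * 0"
    using q by (intro tendsto_mult tendsto_const LIMSEQ_power_zero) auto
  then have "\<forall>\<^sub>F m in sequentially. 2 * M * q ^ m < 1" by (intro order_tendstoD) auto
  then obtain m0 where m0: "\<And>m. m \<ge> m0 \<Longrightarrow> 2 * M * q ^ m < 1" by (auto simp: eventually_sequentially)
  define C where "C = (\<Sum>i\<le>m0. a i)"
  have "a m \<le> C" for m
  proof (cases "m \<le> m0")
    case True
    then show ?thesis unfolding C_def using a0 by (intro member_le_sum) auto
  next
    case False
    have "a (m0 + k) \<le> C" for k
    proof (induction k)
      case 0
      then show ?case unfolding C_def using a0 by (intro member_le_sum) auto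
    next
      case (Suc k)
      have "a (m0 + k) * (2 * M * q ^ (m0 + k)) \<le> a (m0 + k) * 1"
        using m0[of "m0 + k"] a0 by (intro mult_left_mono) auto
      then show ?case using Suc.IH step[of "m0 + k"] by simp
    qed
    from this[of "m - m0"] False show ?thesis by simp
  qed
  then have "M ^ m * q ^ (m * (m - 1) div 2) \<le> C * (1 / 2) ^ m" for m
    by (simp add: a_def power_mult_distrib power_divide field_simps)
  then show ?thesis by blast
qed

lemma norm_powi_le:
  fixes x :: complex
  assumes "norm x \<le> R" "norm (1 / x) \<le> R"
  shows "norm (x powi d) \<le> R ^ nat \<bar>d\<bar>"
proof (cases "d \<ge> 0")
  case True
  then show ?thesis using assms by (simp add: power_int_def norm_power power_mono)
next
  case False
  have "norm (1 / x) ^ nat (- d) \<le> R ^ nat (- d)" using assms by (intro power_mono) auto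
  then show ?thesis using False by (simp add: power_int_def norm_power norm_inverse norm_divide field_simps)
qed

context weighted_composition
begin

lemma homoclinic_orbit_zero: "homoclinic_orbit \<Omega> T (\<lambda>d z. 0)"
  by (auto simp: homoclinic_orbit_def holo_def wcomp_def intro!: exI[of _ 0])

lemma homoclinic_orbit_scale_add:
  assumes x: "homoclinic_orbit \<Omega> T x" and y: "homoclinic_orbit \<Omega> T y"
  shows "homoclinic_orbit \<Omega> T (\<lambda>d z. c * x d z + y d z)"
  unfolding homoclinic_orbit_def
proof (intro conjI allI impI)
  fix d
  show "(\<lambda>z. c * x d z + y d z) \<in> holo \<Omega>"
    using homoclinic_orbitD(1)[OF x, of d] homoclinic_orbitD(1)[OF y, of d]
    by (auto simp: holo_def intro!: holomorphic_intros)
  have "T (\<lambda>z. c * x d z + y d z) = (\<lambda>z. c * T (x d) z + T (y d) z)"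
    by (auto simp: wcomp_def algebra_simps)
  then show "T (\<lambda>z. c * x d z + y d z) = (\<lambda>z. c * x (d + 1) z + y (d + 1) z)"
    by (simp only: homoclinic_orbitD(2)[OF x] homoclinic_orbitD(2)[OF y])
next
  fix K assume "compact K \<and> K \<subseteq> \<Omega>"
  then have K: "compact K" "K \<subseteq> \<Omega>" by auto
  obtain A where A: "A > 0" "\<And>d z. z \<in> K \<Longrightarrow> norm (x d z) \<le> A * (1 / 2) ^ nat \<bar>d\<bar>"
    by (rule homoclinic_orbit_bound[OF x K]) (rule that)
  obtain B where B: "B > 0" "\<And>d z. z \<in> K \<Longrightarrow> norm (y d z) \<le> B * (1 / 2) ^ nat \<bar>d\<bar>"
    by (rule homoclinic_orbit_bound[OF y K]) (rule that)
  have "norm (c * x d z + y d z) \<le> (norm c * A + B) * (1 / 2) ^ nat \<bar>d\<bar>" if "z \<in> K" for d z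
  proof -
    have "norm (c * x d z + y d z) \<le> norm c * norm (x d z) + norm (y d z)"
      using norm_triangle_ineq[of "c * x d z" "y d z"] by (simp add: norm_mult)
    also have "\<dots> \<le> norm c * (A * (1 / 2) ^ nat \<bar>d\<bar>) + B * (1 / 2) ^ nat \<bar>d\<bar>"
      by (intro add_mono mult_left_mono A(2) B(2) that) auto
    finally show ?thesis by (simp add: algebra_simps)
  qed
  then show "\<exists>C. \<forall>d. \<forall>z\<in>K. norm (c * x d z + y d z) \<le> C * (1 / 2) ^ nat \<bar>d\<bar>" by blast
qed

end

text \<open>The situation reached by \<open>multiplier_normal_form\<close>, with positive exponent \<open>n\<close>. The operator then shifts the
  functions \<open>exp G * \<phi> powi j\<close> by \<open>n\<close> places, with weights \<open>c * l powi j\<close>.\<close>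

locale normal_form = weighted_composition punctured_disc \<omega> \<psi> for \<omega> \<psi> +
  fixes \<phi> G :: "complex \<Rightarrow> complex" and c l :: complex and n :: nat
  assumes \<phi>: "\<phi> holomorphic_on ball 0 1" "inj_on \<phi> (ball 0 1)" "\<phi> 0 = 0"
    and conj: "\<And>z. z \<in> punctured_disc \<Longrightarrow> \<phi> (\<psi> z) = l * \<phi> z"
    and G: "G holomorphic_on punctured_disc"
    and c: "c \<noteq> 0" and l: "l \<noteq> 0" "norm l < 1" and n: "n \<ge> 1"
    and multiplier: "\<And>z. z \<in> punctured_disc \<Longrightarrow> \<omega> z * exp (G (\<psi> z)) = c * \<phi> z ^ n * exp (G z)"
begin

lemma \<phi>_nonzero: "z \<in> punctured_disc \<Longrightarrow> \<phi> z \<noteq> 0"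
  using \<phi>(2,3) by (auto simp: inj_on_def)

text \<open>The orbit of \<open>exp G * \<phi> powi j\<close> under the weighted shift. The exponent of \<open>l\<close> is the sum of the arithmetic
  progression \<open>j, j + n, ...\<close> with \<open>d\<close> terms, and the formula remains correct for negative \<open>d\<close>.\<close>

definition basic_orbit :: "int \<Rightarrow> int \<Rightarrow> complex \<Rightarrow> complex" where
  "basic_orbit j d z = (if z \<in> punctured_disc then
     c powi d * l powi (j * d + int n * (d * (d - 1) div 2)) * exp (G z) * \<phi> z powi (j + int n * d) else 0)"

text \<open>In both directions the weights contain the factor \<open>l\<close> to a power of order \<open>d\<^sup>2\<close>, which beats the geometric
  growth of all other factors. This is where \<open>n \<ge> 1\<close> enters.\<close>

lemma homoclinic_basic_orbit: "homoclinic_orbit punctured_disc T (basic_orbit j)"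
  unfolding homoclinic_orbit_def
proof (intro conjI allI impI)
  fix d
  have "(\<lambda>z. c powi d * l powi (j * d + int n * (d * (d - 1) div 2)) * exp (G z) * \<phi> z powi (j + int n * d))
      holomorphic_on punctured_disc"
    by (intro holomorphic_intros G holomorphic_on_subset[OF \<phi>(1)]) (use \<phi>_nonzero in auto)
  then have "basic_orbit j d holomorphic_on punctured_disc"
    by (rule holomorphic_transform) (simp add: basic_orbit_def)
  then show "basic_orbit j d \<in> holo punctured_disc"
    by (simp add: holo_def basic_orbit_def)
  show "T (basic_orbit j d) = basic_orbit j (d + 1)"
  proof
    fix z show "T (basic_orbit j d) z = basic_orbit j (d + 1) z"
    proof (cases "z \<in> punctured_disc")
      case True
      then have \<psi>z: "\<psi> z \<in> punctured_disc" using symbol_into by blast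
      have tri: "(d + 1) * (d + 1 - 1) div 2 = d * (d - 1) div 2 + d"
      proof -
        have "(d + 1) * (d + 1 - 1) = d * (d - 1) + 2 * d" by (simp add: algebra_simps)
        then show ?thesis by simp
      qed
      let ?t = "d * (d - 1) div 2"
      have "T (basic_orbit j d) z = c powi d * l powi (j * d + int n * ?t) *
          (\<omega> z * exp (G (\<psi> z))) * \<phi> (\<psi> z) powi (j + int n * d)"
        using True \<psi>z by (simp add: wcomp_def basic_orbit_def)
      also have "\<dots> = (c powi d * c) * (l powi (j * d + int n * ?t) * l powi (j + int n * d)) *
          exp (G z) * (\<phi> z powi int n * \<phi> z powi (j + int n * d))"
        unfolding multiplier[OF True] conj[OF True] power_int_mult_distrib by simp
      also have "c powi d * c = c powi (d + 1)" using c by (simp add: power_int_add)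
      also have "l powi (j * d + int n * ?t) * l powi (j + int n * d) =
          l powi (j * (d + 1) + int n * ((d + 1) * (d + 1 - 1) div 2))"
        unfolding tri using l(1) by (subst power_int_add[symmetric]) (auto simp: algebra_simps)
      also have "\<phi> z powi int n * \<phi> z powi (j + int n * d) = \<phi> z powi (j + int n * (d + 1))"
        using \<phi>_nonzero[OF True] by (subst power_int_add[symmetric]) (auto simp: algebra_simps)
      also have "c powi (d + 1) * l powi (j * (d + 1) + int n * ((d + 1) * (d + 1 - 1) div 2)) *
          exp (G z) * \<phi> z powi (j + int n * (d + 1)) = basic_orbit j (d + 1) z"
        using True by (simp only: basic_orbit_def if_True)
      finally show ?thesis .
    next
      case False
      then show ?thesis by (simp only: wcomp_def basic_orbit_def if_False)
    qed
  qed
next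
  fix K assume "compact K \<and> K \<subseteq> punctured_disc"
  then have K: "compact K" "K \<subseteq> punctured_disc" by auto
  have K1: "K \<subseteq> ball 0 1" using K(2) by auto
  have bounded: "\<exists>B>0. \<forall>z\<in>K. norm (f z) \<le> B" if "continuous_on K f" for f :: "complex \<Rightarrow> complex"
    using bounded_pos[of "f ` K"] compact_imp_bounded[OF compact_continuous_image[OF that K(1)]] by auto
  have \<phi>c: "continuous_on K \<phi>"
    using K1 by (intro holomorphic_on_imp_continuous_on holomorphic_on_subset[OF \<phi>(1)])
  have \<phi>0: "\<forall>z\<in>K. \<phi> z \<noteq> 0" using \<phi>_nonzero K(2) by blast
  have "continuous_on K (\<lambda>z. exp (G z))"
    by (intro continuous_intros holomorphic_on_imp_continuous_on holomorphic_on_subset[OF G] K(2))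
  then obtain B where B: "B > 0" "\<forall>z\<in>K. norm (exp (G z)) \<le> B" using bounded by blast
  obtain R1 where R1: "R1 > 0" "\<forall>z\<in>K. norm (\<phi> z) \<le> R1" using bounded[OF \<phi>c] by auto
  have "continuous_on K (\<lambda>z. 1 / \<phi> z)" using \<phi>0 by (intro continuous_intros \<phi>c)
  then obtain R2 where R2: "R2 > 0" "\<forall>z\<in>K. norm (1 / \<phi> z) \<le> R2" using bounded by blast
  define R where "R = max R1 R2"
  have R: "R > 0" "\<And>z. z \<in> K \<Longrightarrow> norm (\<phi> z) \<le> R" "\<And>z. z \<in> K \<Longrightarrow> norm (1 / \<phi> z) \<le> R"
    using R1 R2 by (auto simp: R_def le_max_iff_disj less_max_iff_disj)
  define P where "P = max (norm c) (norm (1 / c))"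
  define Q where "Q = max (norm l) (norm (1 / l))"
  have PQ: "P > 0" "Q > 0" using c l(1) by (auto simp: P_def Q_def less_max_iff_disj)
  define M where "M = P * Q ^ nat \<bar>j\<bar> * R ^ n"
  have "M \<ge> 0" using PQ R(1) by (simp add: M_def)
  then obtain C where C: "\<And>m. M ^ m * norm l ^ (m * (m - 1) div 2) \<le> C * (1 / 2) ^ m"
    using superexponential_decay[of M "norm l"] l(2) by auto
  have "norm (basic_orbit j d z) \<le> (B * R ^ nat \<bar>j\<bar> * C) * (1 / 2) ^ nat \<bar>d\<bar>" if z: "z \<in> K" for d z
  proof -
    define m where "m = nat \<bar>d\<bar>"
    define t where "t = d * (d - 1) div 2"
    have zD: "z \<in> punctured_disc" using z K(2) by auto
    have t: "int (m * (m - 1) div 2) \<le> int n * t"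
    proof -
      have "int (m * (m - 1)) \<le> d * (d - 1)"
      proof (cases "m = 0")
        case False
        then have "int (m * (m - 1)) = \<bar>d\<bar> * (\<bar>d\<bar> - 1)" by (simp add: m_def of_nat_diff)
        also have "\<dots> \<le> d * (d - 1)" by (simp add: abs_if algebra_simps)
        finally show ?thesis .
      qed (simp add: m_def)
      then have "int (m * (m - 1) div 2) \<le> t" unfolding t_def by (simp add: zdiv_int zdiv_mono1)
      moreover from this have "1 * t \<le> int n * t" using n by (intro mult_right_mono) auto
      ultimately show ?thesis by simp
    qed
    then have "nat (int n * t) \<ge> m * (m - 1) div 2" and t0: "int n * t \<ge> 0" by auto
    then have 1: "norm (l powi (int n * t)) \<le> norm l ^ (m * (m - 1) div 2)"
      using l(2) by (simp add: power_int_def norm_power power_decreasing)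
    have 2: "norm (c powi d) \<le> P ^ m" unfolding m_def by (rule norm_powi_le) (auto simp: P_def)
    have "norm (l powi (j * d)) \<le> Q ^ nat \<bar>j * d\<bar>" by (rule norm_powi_le) (auto simp: Q_def)
    then have 3: "norm (l powi (j * d)) \<le> (Q ^ nat \<bar>j\<bar>) ^ m"
      by (simp add: m_def abs_mult nat_mult_distrib power_mult)
    have 4: "norm (\<phi> z powi j) \<le> R ^ nat \<bar>j\<bar>" by (rule norm_powi_le[OF R(2,3)[OF z]])
    have "norm (\<phi> z powi (int n * d)) \<le> R ^ nat \<bar>int n * d\<bar>" by (rule norm_powi_le[OF R(2,3)[OF z]])
    then have 5: "norm (\<phi> z powi (int n * d)) \<le> (R ^ n) ^ m"
      by (simp add: m_def abs_mult nat_mult_distrib power_mult)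
    have "norm (basic_orbit j d z) = norm (c powi d) * (norm (l powi (j * d)) * norm (l powi (int n * t))) *
        norm (exp (G z)) * (norm (\<phi> z powi j) * norm (\<phi> z powi (int n * d)))"
      using zD l(1) \<phi>_nonzero[OF zD] by (simp add: basic_orbit_def power_int_add norm_mult t_def)
    also have "\<dots> \<le> P ^ m * ((Q ^ nat \<bar>j\<bar>) ^ m * norm l ^ (m * (m - 1) div 2)) * B * (R ^ nat \<bar>j\<bar> * (R ^ n) ^ m)"
      using 1 2 3 4 5 B z PQ R(1) by (intro mult_mono mult_nonneg_nonneg) auto
    also have "\<dots> = (B * R ^ nat \<bar>j\<bar>) * (M ^ m * norm l ^ (m * (m - 1) div 2))"
      by (simp add: M_def power_mult_distrib mult_ac)
    also have "\<dots> \<le> (B * R ^ nat \<bar>j\<bar>) * (C * (1 / 2) ^ m)"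
      using C[of m] B(1) R(1) by (intro mult_left_mono) auto
    finally show ?thesis by (simp add: m_def mult_ac)
  qed
  then show "\<exists>C. \<forall>d. \<forall>z\<in>K. norm (basic_orbit j d z) \<le> C * (1 / 2) ^ nat \<bar>d\<bar>" by blast
qed

definition rational_orbit :: "(int \<times> rat \<times> rat) list \<Rightarrow> int \<Rightarrow> complex \<Rightarrow> complex" where
  "rational_orbit xs d z = (\<Sum>(j, a, b)\<leftarrow>xs. Complex (of_rat a) (of_rat b) * basic_orbit j d z)"

lemma homoclinic_rational_orbit: "homoclinic_orbit punctured_disc T (rational_orbit xs)"
proof (induction xs)
  case Nil
  have "rational_orbit [] = (\<lambda>d z. 0)" by (simp add: rational_orbit_def fun_eq_iff)
  then show ?case using homoclinic_orbit_zero by simp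
next
  case (Cons x xs)
  obtain j a b where x: "x = (j, a, b)" by (cases x) auto
  have "rational_orbit (x # xs) = (\<lambda>d z. Complex (of_rat a) (of_rat b) * basic_orbit j d z + rational_orbit xs d z)"
    by (simp add: rational_orbit_def fun_eq_iff x)
  then show ?case using homoclinic_orbit_scale_add[OF homoclinic_basic_orbit Cons.IH] by simp
qed

lemma rational_orbit_0:
  assumes "z \<in> punctured_disc"
  shows "rational_orbit xs 0 z = exp (G z) * laurent_comb \<phi> xs z"
proof (induction xs)
  case Nil
  then show ?case by (simp add: rational_orbit_def)
next
  case (Cons x xs)
  obtain j a b where x: "x = (j, a, b)" by (cases x) auto
  show ?case using Cons.IH assms by (simp add: rational_orbit_def x basic_orbit_def algebra_simps)
qed

lemma rational_orbits_dense:
  "dense_subset (holo_topology punctured_disc) (range (\<lambda>k. rational_orbit (from_nat k) 0))"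
  unfolding dense_subset_holo_iff
proof (intro conjI ballI allI impI)
  show "range (\<lambda>k. rational_orbit (from_nat k) 0) \<subseteq> holo punctured_disc"
    using homoclinic_orbitD(1)[OF homoclinic_rational_orbit] by auto
  fix f K and e :: real
  assume f: "f \<in> holo punctured_disc" and "compact K \<and> K \<subseteq> punctured_disc \<and> e > 0"
  then have K: "compact K" "K \<subseteq> punctured_disc" and e: "e > 0" by auto
  have K1: "K \<subseteq> ball 0 1" using K(2) by auto
  have \<phi>0: "\<phi> z \<noteq> 0" if "z \<in> K" for z using \<phi>_nonzero K(2) that by blast
  have \<phi>c: "continuous_on K \<phi>"
    using K1 by (intro holomorphic_on_imp_continuous_on holomorphic_on_subset[OF \<phi>(1)])
  let ?A = "{f. \<forall>e>0. \<exists>xs. \<forall>z\<in>K. dist (laurent_comb \<phi> xs z) (f z) < e}"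
  have alg: "uniform_algebra K ?A" by (rule laurent_comb_approximable_algebra[OF K(1) \<phi>c \<phi>0])
  \<comment> \<open>It suffices to approximate \<open>f * exp (- G)\<close> by Laurent polynomials in \<open>\<phi>\<close>.\<close>
  have "(\<lambda>z. f z * exp (- G z)) \<in> ?A"
  proof (rule algebra_contains_holomorphic_punctured_disc[OF alg K \<phi>])
    have one: "Complex (of_rat 1) (of_rat 0) = 1" by (simp add: complex_eq_iff)
    have "\<forall>z\<in>K. dist (laurent_comb \<phi> [(1, 1, 0)] z) (\<phi> z) < e" if "e > 0" for e
      using that by (simp only: laurent_comb_simps one) simp
    then show "\<phi> \<in> ?A" by blast
    have "\<forall>z\<in>K. dist (laurent_comb \<phi> [(-1, 1, 0)] z) (1 / \<phi> z) < e" if "e > 0" for e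
      using that by (simp only: laurent_comb_simps one) (simp add: power_int_minus field_simps)
    then show "(\<lambda>z. 1 / \<phi> z) \<in> ?A" by blast
    show "(\<lambda>z. f z * exp (- G z)) holomorphic_on punctured_disc"
      using f by (auto simp: holo_def intro!: holomorphic_intros G)
  qed
  then have mem: "\<forall>e>0. \<exists>xs. \<forall>z\<in>K. dist (laurent_comb \<phi> xs z) (f z * exp (- G z)) < e" by simp
  have "continuous_on K (\<lambda>z. exp (G z))"
    using K(2) by (intro continuous_intros holomorphic_on_imp_continuous_on holomorphic_on_subset[OF G])
  then obtain B where B: "B > 0" "\<And>z. z \<in> K \<Longrightarrow> norm (exp (G z)) \<le> B"
    using bounded_pos[of "(\<lambda>z. exp (G z)) ` K"] compact_imp_bounded[OF compact_continuous_image[OF _ K(1)]] by auto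
  have "e / B > 0" using e B(1) by simp
  then obtain xs where xs: "\<And>z. z \<in> K \<Longrightarrow> dist (laurent_comb \<phi> xs z) (f z * exp (- G z)) < e / B"
    using mem by blast
  have "dist (rational_orbit xs 0 z) (f z) < e" if z: "z \<in> K" for z
  proof -
    have zD: "z \<in> punctured_disc" using z K(2) by auto
    have "f z = exp (G z) * (f z * exp (- G z))" by (simp add: exp_minus)
    then have "rational_orbit xs 0 z - f z = exp (G z) * (laurent_comb \<phi> xs z - f z * exp (- G z))"
      using rational_orbit_0[OF zD, of xs] by (simp add: algebra_simps)
    then have "dist (rational_orbit xs 0 z) (f z) = norm (exp (G z)) * dist (laurent_comb \<phi> xs z) (f z * exp (- G z))"
      by (simp only: dist_norm norm_mult)
    also have "\<dots> \<le> B * dist (laurent_comb \<phi> xs z) (f z * exp (- G z))"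
      by (intro mult_right_mono B(2) z) auto
    also have "\<dots> < B * (e / B)" using xs[OF z] B(1) by (rule mult_strict_left_mono)
    finally show ?thesis using B(1) by simp
  qed
  then show "\<exists>g\<in>range (\<lambda>k. rational_orbit (from_nat k) 0). \<forall>z\<in>K. dist (g z) (f z) < e"
    by (intro bexI[of _ "rational_orbit xs 0"]) (auto intro!: image_eqI[of _ _ "to_nat xs"])
qed

sublocale homoclinically_dense punctured_disc \<omega> \<psi> "\<lambda>k. rational_orbit (from_nat k)"
  by unfold_locales (rule homoclinic_rational_orbit, rule rational_orbits_dense)

end

section \<open>Obstructions to hypercyclicity\<close>

lemma circle_integral_eq_residue:
  assumes "\<And>z. z \<in> punctured_disc \<Longrightarrow> (P has_field_derivative (E z - a / z)) (at z)"
  shows "(E has_contour_integral (2 * pi * \<i> * a)) (circlepath 0 (1 / 2))"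
proof -
  let ?\<gamma> = "circlepath 0 (1 / 2) :: real \<Rightarrow> complex"
  have im: "path_image ?\<gamma> \<subseteq> punctured_disc" by auto
  have "((\<lambda>z. E z - a / z) has_contour_integral (P (pathfinish ?\<gamma>) - P (pathstart ?\<gamma>))) ?\<gamma>"
    by (rule contour_integral_primitive[where S = punctured_disc, OF _ valid_path_circlepath im])
       (rule has_field_derivative_at_within[OF assms])
  then have "((\<lambda>z. E z - a / z) has_contour_integral 0) ?\<gamma>" by simp
  moreover have "((\<lambda>z. a / (z - 0)) has_contour_integral (2 * of_real pi * \<i> * a)) ?\<gamma>"
    by (rule Cauchy_integral_circlepath_simple) auto
  ultimately have "((\<lambda>z. (E z - a / z) + a / (z - 0)) has_contour_integral (0 + 2 * of_real pi * \<i> * a)) ?\<gamma>"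
    by (rule has_contour_integral_add)
  then show ?thesis by simp
qed

lemma circle_integral_bound:
  assumes "continuous_on (sphere 0 (1 / 2)) E" "B \<ge> 0" "\<And>z. norm z = 1 / 2 \<Longrightarrow> norm (E z) \<le> B"
  shows "norm (contour_integral (circlepath 0 (1 / 2)) E) \<le> B * pi"
proof -
  have "E contour_integrable_on circlepath 0 (1 / 2)"
    using assms(1) by (intro contour_integrable_continuous_circlepath) simp
  then have "norm (contour_integral (circlepath 0 (1 / 2)) E) \<le> B * (2 * pi * (1 / 2))"
    using assms(2,3) by (intro has_contour_integral_bound_circlepath[OF has_contour_integral_integral]) auto
  then show ?thesis by simp
qed

text \<open>The form \<open>dz / z\<close> is invariant under rotations, and a rotated circle is the circle with a shifted starting
  point.\<close>

lemma circle_integral_rotation: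
  assumes "norm \<alpha> = 1"
  shows "contour_integral (circlepath 0 r) (\<lambda>z. F (\<alpha> * z) / z) = contour_integral (circlepath 0 r) (\<lambda>z. F z / z)"
proof -
  define a where "a = Arg2pi \<alpha> / (2 * pi)"
  have a: "0 \<le> a" "a \<le> 1" using Arg2pi[of \<alpha>] by (auto simp: a_def divide_simps)
  have \<alpha>: "\<alpha> = exp (2 * pi * \<i> * a)"
    using Arg2pi_eq[of \<alpha>] assms by (simp add: a_def mult_ac)
  have shift: "shiftpath a (circlepath 0 r) = (\<lambda>t. \<alpha> * circlepath 0 r t)"
  proof
    fix t :: real
    have "exp (2 * pi * \<i> * (a + t - 1)) = exp (2 * pi * \<i> * (a + t))"
      by (simp add: algebra_simps exp_add exp_diff)
    then show "shiftpath a (circlepath 0 r) t = \<alpha> * circlepath 0 r t"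
      by (simp add: shiftpath_def circlepath \<alpha> algebra_simps exp_add exp_diff)
  qed
  have \<alpha>0: "\<alpha> \<noteq> 0" using assms by auto
  have vd: "vector_derivative (\<lambda>t. \<alpha> * circlepath 0 r t) (at t) = \<alpha> * vector_derivative (circlepath 0 r) (at t)" for t
    by (rule vector_derivative_at)
       (auto intro!: derivative_eq_intros has_vector_derivative_circlepath simp: vector_derivative_circlepath)
  have "contour_integral (circlepath 0 r) (\<lambda>z. F z / z) = contour_integral (shiftpath a (circlepath 0 r)) (\<lambda>z. F z / z)"
    using a by (intro contour_integral_shiftpath[symmetric]) auto
  also have "\<dots> = contour_integral (circlepath 0 r) (\<lambda>z. F (\<alpha> * z) / z)"
    unfolding contour_integral_integral shift vd using \<alpha>0 by simp
  finally show ?thesis by simp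
qed

lemma (in weighted_composition) hypercyclic_vector:
  assumes "hypercyclic X T"
  obtains f where "f \<in> holo \<Omega>"
    "\<And>g K e. g \<in> holo \<Omega> \<Longrightarrow> compact K \<Longrightarrow> K \<subseteq> \<Omega> \<Longrightarrow> e > 0 \<Longrightarrow> \<exists>n. \<forall>z\<in>K. dist ((T ^^ n) f z) (g z) < e"
proof -
  obtain f where f: "f \<in> topspace X" "dense_subset X {(T ^^ n) f | n. True}"
    using assms by (auto simp: hypercyclic_def)
  have "\<exists>n. \<forall>z\<in>K. dist ((T ^^ n) f z) (g z) < e"
    if "g \<in> holo \<Omega>" "compact K" "K \<subseteq> \<Omega>" "e > 0" for g K e
    using f(2)[unfolded dense_subset_holo_iff, THEN conjunct2, rule_format, OF that(1), of K e] that by auto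
  then show ?thesis using that f(1) by (simp add: topspace_holo_topology)
qed

locale hypercyclic_vector = weighted_composition +
  fixes f :: "complex \<Rightarrow> complex"
  assumes f: "f \<in> holo \<Omega>"
    and orbit_dense: "\<And>g K e. g \<in> holo \<Omega> \<Longrightarrow> compact K \<Longrightarrow> K \<subseteq> \<Omega> \<Longrightarrow> e > 0 \<Longrightarrow>
      \<exists>n. \<forall>z\<in>K. dist ((T ^^ n) f z) (g z) < e"
begin

text \<open>A nonzero continuous linear functional maps a dense orbit to a dense set of scalars.\<close>

lemma functional_orbit_dense:
  fixes L :: "(complex \<Rightarrow> complex) \<Rightarrow> complex"
  assumes K: "compact K" "K \<subseteq> \<Omega>" and C: "C > 0"
    and lip: "\<And>g h d. g \<in> holo \<Omega> \<Longrightarrow> h \<in> holo \<Omega> \<Longrightarrow> d > 0 \<Longrightarrow> (\<And>z. z \<in> K \<Longrightarrow> dist (g z) (h z) \<le> d) \<Longrightarrow>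
        dist (L g) (L h) \<le> C * d"
    and scale: "\<And>s g. g \<in> holo \<Omega> \<Longrightarrow> L (\<lambda>z. s * g z) = s * L g"
    and g0: "g0 \<in> holo \<Omega>" "L g0 \<noteq> 0" and e: "e > 0"
  shows "\<exists>n. dist (L ((T ^^ n) f)) w < e"
proof -
  define g where "g = (\<lambda>z. (w / L g0) * g0 z)"
  have g: "g \<in> holo \<Omega>" using g0(1) by (auto simp: g_def holo_def intro!: holomorphic_intros)
  have Lg: "L g = w" using scale[OF g0(1), of "w / L g0"] g0(2) by (simp add: g_def)
  define d where "d = e / (2 * C)"
  have d: "d > 0" "C * d < e" using e C by (auto simp: d_def)
  obtain n where n: "\<And>z. z \<in> K \<Longrightarrow> dist ((T ^^ n) f z) (g z) < d"
    using orbit_dense[OF g K d(1)] by auto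
  have "dist (L ((T ^^ n) f)) (L g) \<le> C * d"
    by (rule lip[OF T_funpow_holo[OF f] g d(1)]) (use n in \<open>auto intro: less_imp_le\<close>)
  then show ?thesis using d(2) by (intro exI[of _ n]) (simp add: Lg)
qed

text \<open>If \<open>L\<close> vanishes on the range of \<open>T\<close>, its values on the orbit of \<open>f\<close> are \<open>L f\<close> and 0 only. This excludes
  zeros of the multiplier, identifications by the symbol, and symbols that do not fix the puncture.\<close>

lemma no_annihilating_functional:
  fixes L :: "(complex \<Rightarrow> complex) \<Rightarrow> complex"
  assumes K: "compact K" "K \<subseteq> \<Omega>" and C: "C > 0"
    and lip: "\<And>g h d. g \<in> holo \<Omega> \<Longrightarrow> h \<in> holo \<Omega> \<Longrightarrow> d > 0 \<Longrightarrow> (\<And>z. z \<in> K \<Longrightarrow> dist (g z) (h z) \<le> d) \<Longrightarrow>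
        dist (L g) (L h) \<le> C * d"
    and scale: "\<And>s g. g \<in> holo \<Omega> \<Longrightarrow> L (\<lambda>z. s * g z) = s * L g"
    and zero: "\<And>g. g \<in> holo \<Omega> \<Longrightarrow> L (T g) = 0"
    and g0: "g0 \<in> holo \<Omega>"
  shows "L g0 = 0"
proof (rule ccontr)
  assume ne: "L g0 \<noteq> 0"
  \<comment> \<open>A scalar at distance at least 1 from both \<open>L f\<close> and 0.\<close>
  define w where "w = complex_of_real (norm (L f) + 1)"
  have "\<exists>n. dist (L ((T ^^ n) f)) w < 1"
    by (rule functional_orbit_dense[where L = L and ?g0.0 = g0, OF K C])
       (fact lip scale g0 ne zero_less_one)+
  then obtain n where n: "dist (L ((T ^^ n) f)) w < 1" by (rule exE)
  have "L ((T ^^ n) f) = L f \<or> L ((T ^^ n) f) = 0"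
    using zero[OF T_funpow_holo[OF f]] by (cases n) auto
  moreover have "norm w = norm (L f) + 1" by (simp add: w_def del: of_real_add)
  ultimately show False
    using n norm_triangle_ineq2[of w "L ((T ^^ n) f)"] by (auto simp: dist_norm norm_minus_commute)
qed

lemma multiplier_zero_free:
  assumes a: "a \<in> \<Omega>"
  shows "\<omega> a \<noteq> 0"
proof
  assume "\<omega> a = 0"
  define g0 where "g0 z = (if z \<in> \<Omega> then 1 else 0 :: complex)" for z
  have "g0 holomorphic_on \<Omega>" by (rule holomorphic_transform[of "\<lambda>_. 1"]) (auto simp: g0_def)
  then have "g0 \<in> holo \<Omega>" by (simp add: holo_def g0_def)
  have "(\<lambda>g::complex \<Rightarrow> complex. g a) g0 = 0"
    by (rule no_annihilating_functional[where K = "{a}" and C = 1 and L = "\<lambda>g. g a" and ?g0.0 = g0])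
       (use \<open>\<omega> a = 0\<close> a \<open>g0 \<in> holo \<Omega>\<close> in \<open>simp_all add: wcomp_def\<close>)
  then show False using a by (simp add: g0_def)
qed

lemma symbol_injective: "inj_on \<psi> \<Omega>"
proof (rule inj_onI, rule ccontr)
  fix a b assume ab: "a \<in> \<Omega>" "b \<in> \<Omega>" "\<psi> a = \<psi> b" "a \<noteq> b"
  define g0 where "g0 z = (if z \<in> \<Omega> then z - b else 0)" for z
  have "g0 holomorphic_on \<Omega>"
    by (rule holomorphic_transform[of "\<lambda>z. z - b"]) (auto simp: g0_def intro!: holomorphic_intros)
  then have "g0 \<in> holo \<Omega>" by (simp add: holo_def g0_def)
  have "(\<lambda>g::complex \<Rightarrow> complex. \<omega> b * g a - \<omega> a * g b) g0 = 0"
  proof (rule no_annihilating_functional[where K = "{a, b}" and C = "norm (\<omega> a) + norm (\<omega> b) + 1"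
        and L = "\<lambda>g. \<omega> b * g a - \<omega> a * g b" and ?g0.0 = g0])
    fix g h :: "complex \<Rightarrow> complex" and d :: real
    assume d: "\<And>z. z \<in> {a, b} \<Longrightarrow> dist (g z) (h z) \<le> d" "d > (0::real)"
    have "\<omega> b * g a - \<omega> a * g b - (\<omega> b * h a - \<omega> a * h b) = \<omega> b * (g a - h a) - \<omega> a * (g b - h b)"
      by (simp add: algebra_simps)
    then have "dist (\<omega> b * g a - \<omega> a * g b) (\<omega> b * h a - \<omega> a * h b) \<le> norm (\<omega> b) * dist (g a) (h a) + norm (\<omega> a) * dist (g b) (h b)"
      using norm_triangle_ineq4[of "\<omega> b * (g a - h a)" "\<omega> a * (g b - h b)"] by (simp add: dist_norm norm_mult)
    also have "\<dots> \<le> norm (\<omega> b) * d + norm (\<omega> a) * d"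
      using d(1)[of a] d(1)[of b] by (intro add_mono mult_left_mono) auto
    finally show "dist (\<omega> b * g a - \<omega> a * g b) (\<omega> b * h a - \<omega> a * h b) \<le> (norm (\<omega> a) + norm (\<omega> b) + 1) * d"
      using d(2) by (simp add: algebra_simps)
  next
    show "0 < norm (\<omega> a) + norm (\<omega> b) + 1" by (simp add: add_nonneg_pos)
  qed (use ab \<open>g0 \<in> holo \<Omega>\<close> in \<open>simp_all add: wcomp_def algebra_simps\<close>)
  then show False using ab multiplier_zero_free[of b] by (simp add: g0_def)
qed

end

text \<open>The functionals used below are integrals over the circle of radius \<open>1 / 2\<close> against a weight \<open>m\<close>.\<close>

lemma circle_functional_lipschitz:
  assumes m: "continuous_on (sphere 0 (1 / 2)) m"
  shows "\<exists>C>0. \<forall>g\<in>holo punctured_disc. \<forall>h\<in>holo punctured_disc. \<forall>d>0.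
      (\<forall>z\<in>sphere 0 (1 / 2). dist (g z) (h z) \<le> d) \<longrightarrow>
      dist (contour_integral (circlepath 0 (1 / 2)) (\<lambda>z. g z * m z))
           (contour_integral (circlepath 0 (1 / 2)) (\<lambda>z. h z * m z)) \<le> C * d"
proof -
  let ?\<gamma> = "circlepath 0 (1 / 2) :: real \<Rightarrow> complex"
  have "compact (m ` sphere 0 (1 / 2))" using m by (intro compact_continuous_image) auto
  then obtain B where B: "B > 0" "\<And>z. norm z = 1 / 2 \<Longrightarrow> norm (m z) \<le> B"
    using bounded_pos[of "m ` sphere 0 (1 / 2)"] compact_imp_bounded by (metis imageI mem_sphere_0)
  have cont: "continuous_on (sphere 0 (1 / 2)) g" if "g \<in> holo punctured_disc" for g
    by (rule holo_continuous_on[OF that]) auto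
  have "dist (contour_integral ?\<gamma> (\<lambda>z. g z * m z)) (contour_integral ?\<gamma> (\<lambda>z. h z * m z)) \<le> (B * pi) * d"
    if g: "g \<in> holo punctured_disc" and h: "h \<in> holo punctured_disc" and d: "d > 0"
      and gh: "\<And>z. z \<in> sphere 0 (1 / 2) \<Longrightarrow> dist (g z) (h z) \<le> d" for g h d
  proof -
    have int: "(\<lambda>z. g z * m z) contour_integrable_on ?\<gamma>" if "g \<in> holo punctured_disc" for g
      using cont[OF that] m by (intro contour_integrable_continuous_circlepath continuous_intros) auto
    have "contour_integral ?\<gamma> (\<lambda>z. g z * m z) - contour_integral ?\<gamma> (\<lambda>z. h z * m z) =
        contour_integral ?\<gamma> (\<lambda>z. g z * m z - h z * m z)"
      by (rule contour_integral_diff[symmetric, OF int[OF g] int[OF h]])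
    also have "norm \<dots> \<le> (d * B) * pi"
    proof (rule circle_integral_bound)
      fix z :: complex assume z: "norm z = 1 / 2"
      have "norm (g z * m z - h z * m z) = dist (g z) (h z) * norm (m z)"
        by (simp add: dist_norm flip: norm_mult left_diff_distrib)
      also have "\<dots> \<le> d * B" using z gh[of z] B d by (intro mult_mono) auto
      finally show "norm (g z * m z - h z * m z) \<le> d * B" .
    qed (use cont g h m B d in \<open>auto intro!: continuous_intros\<close>)
    finally show ?thesis by (simp add: dist_norm mult_ac)
  qed
  moreover have "B * pi > 0" using B(1) by simp
  ultimately show ?thesis by (intro exI[of _ "B * pi"]) auto
qed

text \<open>The extension over the puncture is injective: a value shared by \<open>0\<close> and \<open>b\<close> would, with all nearby values,
  be attained both near \<open>0\<close> and near \<open>b\<close>, by the open mapping theorem.\<close>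

lemma univalent_extension:
  assumes \<psi>: "\<psi> holomorphic_on punctured_disc" "\<psi> ` punctured_disc \<subseteq> punctured_disc"
    and inj: "inj_on \<psi> punctured_disc"
  obtains \<Psi> where "\<Psi> holomorphic_on ball 0 1" "inj_on \<Psi> (ball 0 1)" "\<Psi> ` ball 0 1 \<subseteq> ball 0 1"
    "\<And>z. z \<in> punctured_disc \<Longrightarrow> \<Psi> z = \<psi> z"
proof -
  have "\<forall>\<^sub>F z in at 0. norm (\<psi> z) \<le> 1"
    unfolding eventually_at
  proof (intro exI[of _ 1] conjI ballI impI)
    fix z :: complex assume "z \<noteq> 0 \<and> dist z 0 < 1"
    then have "\<psi> z \<in> \<psi> ` punctured_disc" by (intro imageI) auto
    then have "\<psi> z \<in> punctured_disc" using \<psi>(2) by auto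
    then show "norm (\<psi> z) \<le> 1" by auto
  qed simp
  moreover have "(0::complex) \<in> interior (ball 0 1)" by simp
  ultimately obtain \<Psi> where \<Psi>: "\<Psi> holomorphic_on ball 0 1" "\<And>z. z \<in> punctured_disc \<Longrightarrow> \<Psi> z = \<psi> z"
    using holomorphic_on_extend_bounded[OF \<psi>(1)] by blast
  have pd: "1 / 2 \<in> punctured_disc" "1 / 3 \<in> punctured_disc" by auto
  have nonconst: "\<not> \<Psi> constant_on ball 0 1"
  proof
    assume "\<Psi> constant_on ball 0 1"
    then have "\<Psi> (1 / 2) = \<Psi> (1 / 3)" by (auto simp: constant_on_def)
    then have "\<psi> (1 / 2) = \<psi> (1 / 3)" using \<Psi>(2) pd by simp
    then show False using inj pd by (auto dest: inj_onD)
  qed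
  have open_image: "open (\<Psi> ` U)" if "open U" "U \<subseteq> ball 0 1" for U
    by (rule open_mapping_thm[OF \<Psi>(1) open_ball _ that nonconst]) simp
  have into: "\<Psi> z \<in> punctured_disc" if "z \<in> punctured_disc" for z using \<psi>(2) \<Psi>(2) that by force
  have new: "\<Psi> 0 \<noteq> \<Psi> b" if b: "b \<in> punctured_disc" for b
  proof
    assume eq: "\<Psi> 0 = \<Psi> b"
    have b': "norm b > 0" "norm b < 1" using b by auto
    define r where "r = min (norm b / 2) (1 - norm b)"
    have r: "r > 0" using b' by (auto simp: r_def)
    have bs: "ball b r \<subseteq> ball 0 1"
    proof
      fix z assume "z \<in> ball b r"
      then show "z \<in> ball 0 1" using norm_triangle_ineq2[of z b] by (simp add: r_def dist_norm norm_minus_commute)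
    qed
    let ?I = "\<Psi> ` ball 0 r \<inter> \<Psi> ` ball b r"
    have "open ?I" using b' bs by (intro open_Int open_image) (auto simp: r_def)
    moreover have "\<Psi> 0 \<in> ?I" using r eq by (metis IntI centre_in_ball imageI)
    ultimately obtain d where d: "d > 0" "ball (\<Psi> 0) d \<subseteq> ?I" using openE by blast
    define w where "w = \<Psi> 0 + d / 2"
    have "w \<in> ball (\<Psi> 0) d" "w \<noteq> \<Psi> 0" using d(1) by (auto simp: w_def dist_norm)
    then obtain u v where uv: "u \<in> ball 0 r" "v \<in> ball b r" "w = \<Psi> u" "w = \<Psi> v" using d(2) by blast
    have uv0: "u \<noteq> 0" "norm u < norm b / 2" "norm v > norm b / 2"
      using uv \<open>w \<noteq> \<Psi> 0\<close> norm_triangle_ineq2[of b v] by (auto simp: r_def dist_norm)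
    then have pd: "u \<in> punctured_disc" "v \<in> punctured_disc" using uv(2) bs b' by auto
    then have "\<psi> u = \<psi> v" using uv \<Psi>(2) by metis
    then have "u = v" using inj pd by (auto dest: inj_onD)
    then show False using uv0 by simp
  qed
  have "inj_on \<Psi> (ball 0 1)"
  proof (rule inj_onI)
    fix a b :: complex assume ab: "a \<in> ball 0 1" "b \<in> ball 0 1" "\<Psi> a = \<Psi> b"
    show "a = b"
    proof (cases "a = 0 \<or> b = 0")
      case True
      then show ?thesis using ab new[of a] new[of b] by (metis DiffI singletonD)
    next
      case False
      then have "\<psi> a = \<psi> b" using ab \<Psi>(2)[of a] \<Psi>(2)[of b] by auto
      then show ?thesis using inj ab False by (auto dest: inj_onD)
    qed
  qed
  moreover have "\<Psi> ` ball 0 1 \<subseteq> ball 0 1"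
  proof -
    have "\<Psi> z \<in> cball 0 1" if "z \<in> ball 0 1" for z
    proof -
      show ?thesis
      proof (cases "z = 0")
        case False
        then show ?thesis using into[of z] that by auto
      next
        case True
        have "(\<Psi> \<longlongrightarrow> \<Psi> 0) (at 0)"
          using \<Psi>(1) holomorphic_on_imp_continuous_on continuous_on_eq_continuous_at[OF open_ball] centre_in_ball
          by (metis isCont_def zero_less_one)
        moreover have "\<forall>\<^sub>F z in at 0. norm (\<Psi> z) \<le> 1"
          unfolding eventually_at using into by (intro exI[of _ 1]) force
        ultimately have "norm (\<Psi> 0) \<le> 1"
          by (intro tendsto_upperbound[of "\<lambda>z. norm (\<Psi> z)"] tendsto_norm) auto
        then show ?thesis using True by simp
      qed
    qed
    then have "\<Psi> ` ball 0 1 \<subseteq> interior (cball 0 1)"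
      by (intro interior_maximal open_image) auto
    then show ?thesis by simp
  qed
  ultimately show ?thesis using that \<Psi> by blast
qed

text \<open>Apply the Schwarz lemma to the map and to its inverse.\<close>

lemma surjective_imp_rotation:
  assumes \<psi>: "\<psi> holomorphic_on ball 0 1" "inj_on \<psi> (ball 0 1)" "\<psi> ` ball 0 1 = ball 0 1" "\<psi> 0 = 0"
  obtains \<alpha> where "norm \<alpha> = 1" "\<And>z. norm z < 1 \<Longrightarrow> \<psi> z = \<alpha> * z"
proof -
  obtain i where i: "i holomorphic_on \<psi> ` ball 0 1" "\<And>z. z \<in> ball 0 1 \<Longrightarrow> i (\<psi> z) = z"
    by (rule holomorphic_has_inverse[OF \<psi>(1) open_ball \<psi>(2)]) (rule that)
  have i': "i holomorphic_on ball 0 1" "i 0 = 0" using i(1) i(2)[of 0] \<psi>(3,4) by simp_all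
  have ib: "norm (i w) < 1" if "norm w < 1" for w
  proof -
    have "w \<in> \<psi> ` ball 0 1" using \<psi>(3) that by simp
    then show ?thesis using i(2) by auto
  qed
  have \<psi>b: "norm (\<psi> z) < 1" if "norm z < 1" for z
    using \<psi>(3) that imageI[of z "ball 0 1" \<psi>] by auto
  have h: "norm (1 / 2 :: complex) < 1" by simp
  have "norm (\<psi> (1 / 2)) \<le> norm (1 / 2 :: complex)"
    by (rule Schwarz_Lemma(1)[OF \<psi>(1,4) \<psi>b h])
  moreover have "norm (i (\<psi> (1 / 2))) \<le> norm (\<psi> (1 / 2))"
    by (rule Schwarz_Lemma(1)[OF i' ib \<psi>b[OF h]])
  ultimately have "norm (\<psi> (1 / 2)) = norm (1 / 2 :: complex)" using i(2)[of "1 / 2"] by simp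
  then have "\<exists>\<alpha>. (\<forall>z. norm z < 1 \<longrightarrow> \<psi> z = \<alpha> * z) \<and> norm \<alpha> = 1"
    by (intro Schwarz_Lemma(3)[OF \<psi>(1,4) \<psi>b h] disjI1 exI[of _ "1 / 2"]) auto
  then show ?thesis using that by blast
qed

lemma circle_functional_scale:
  assumes "continuous_on (sphere 0 (1 / 2)) m" "g \<in> holo punctured_disc"
  shows "contour_integral (circlepath 0 (1 / 2)) (\<lambda>z. s * g z * m z) =
    s * contour_integral (circlepath 0 (1 / 2)) (\<lambda>z. g z * m z)"
proof -
  have "continuous_on (sphere 0 (1 / 2)) g" by (rule holo_continuous_on[OF assms(2)]) auto
  then have "(\<lambda>z. g z * m z) contour_integrable_on circlepath 0 (1 / 2)"
    using assms(1) by (intro contour_integrable_continuous_circlepath continuous_intros) auto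
  then show ?thesis using contour_integral_lmul[of "\<lambda>z. g z * m z" "circlepath 0 (1 / 2)" s]
    by (simp add: mult.assoc)
qed

lemma holo_cutoff:
  assumes "g holomorphic_on \<Omega>"
  shows "(\<lambda>z. if z \<in> \<Omega> then g z else 0) \<in> holo \<Omega>"
proof -
  have "(\<lambda>z. if z \<in> \<Omega> then g z else 0) holomorphic_on \<Omega>"
    by (rule holomorphic_transform[OF assms]) simp
  then show ?thesis by (simp add: holo_def)
qed

locale punctured_disc_hypercyclic = hypercyclic_vector punctured_disc \<omega> \<psi> f for \<omega> \<psi> f
begin

lemma circle_in_domain: "sphere 0 (1 / 2) \<subseteq> punctured_disc" "compact (sphere (0::complex) (1 / 2))"
  by auto

lemma circle_functional_annihilating:
  assumes m: "continuous_on (sphere 0 (1 / 2)) m"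
    and zero: "\<And>g. g \<in> holo punctured_disc \<Longrightarrow>
      contour_integral (circlepath 0 (1 / 2)) (\<lambda>z. T g z * m z) = 0"
    and g0: "g0 \<in> holo punctured_disc"
  shows "contour_integral (circlepath 0 (1 / 2)) (\<lambda>z. g0 z * m z) = 0"
proof -
  let ?L = "\<lambda>g. contour_integral (circlepath 0 (1 / 2)) (\<lambda>z. g z * m z)"
  obtain C where C: "C > 0" and lip': "\<forall>g\<in>holo punctured_disc. \<forall>h\<in>holo punctured_disc. \<forall>d>0.
      (\<forall>z\<in>sphere 0 (1 / 2). dist (g z) (h z) \<le> d) \<longrightarrow> dist (?L g) (?L h) \<le> C * d"
    using circle_functional_lipschitz[OF m] by blast
  have lip: "dist (?L g) (?L h) \<le> C * d"
    if "g \<in> holo punctured_disc" "h \<in> holo punctured_disc" "d > 0"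
      "\<And>z. z \<in> sphere 0 (1 / 2) \<Longrightarrow> dist (g z) (h z) \<le> d" for g h d
    using lip' that by blast
  show ?thesis
    by (rule no_annihilating_functional[where L = ?L and ?g0.0 = g0, OF circle_in_domain(2,1) C])
       (fact lip circle_functional_scale[OF m] zero g0)+
qed

lemma circle_functional_orbit_dense:
  assumes m: "continuous_on (sphere 0 (1 / 2)) m"
    and g0: "g0 \<in> holo punctured_disc" "contour_integral (circlepath 0 (1 / 2)) (\<lambda>z. g0 z * m z) \<noteq> 0"
    and e: "e > 0"
  shows "\<exists>n. dist (contour_integral (circlepath 0 (1 / 2)) (\<lambda>z. (T ^^ n) f z * m z)) w < e"
proof -
  let ?L = "\<lambda>g. contour_integral (circlepath 0 (1 / 2)) (\<lambda>z. g z * m z)"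
  obtain C where C: "C > 0" and lip': "\<forall>g\<in>holo punctured_disc. \<forall>h\<in>holo punctured_disc. \<forall>d>0.
      (\<forall>z\<in>sphere 0 (1 / 2). dist (g z) (h z) \<le> d) \<longrightarrow> dist (?L g) (?L h) \<le> C * d"
    using circle_functional_lipschitz[OF m] by blast
  have lip: "dist (?L g) (?L h) \<le> C * d"
    if "g \<in> holo punctured_disc" "h \<in> holo punctured_disc" "d > 0"
      "\<And>z. z \<in> sphere 0 (1 / 2) \<Longrightarrow> dist (g z) (h z) \<le> d" for g h d
    using lip' that by blast
  show ?thesis
    by (rule functional_orbit_dense[where L = ?L and ?g0.0 = g0, OF circle_in_domain(2,1) C])
       (fact lip circle_functional_scale[OF m] g0 e)+
qed

text \<open>Otherwise \<open>g \<circ> \<Psi>\<close> is holomorphic in the whole disc for every \<open>g\<close>, so the integral of \<open>T g / \<omega>\<close> over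
  a circle vanishes; yet some function divided by \<open>\<omega>\<close> equals \<open>1 / z\<close>.\<close>

lemma extension_fixes_0:
  assumes \<Psi>: "\<Psi> holomorphic_on ball 0 1" "\<Psi> ` ball 0 1 \<subseteq> ball 0 1"
    and eq: "\<And>z. z \<in> punctured_disc \<Longrightarrow> \<Psi> z = \<psi> z"
  shows "\<Psi> 0 = 0"
proof (rule ccontr)
  assume "\<Psi> 0 \<noteq> 0"
  have into: "\<Psi> ` ball 0 1 \<subseteq> punctured_disc"
  proof
    fix w assume "w \<in> \<Psi> ` ball 0 1"
    then obtain z where z: "z \<in> ball 0 1" "w = \<Psi> z" by blast
    show "w \<in> punctured_disc"
    proof (cases "z = 0")
      case True
      have "w \<in> ball 0 1" using \<Psi>(2) \<open>w \<in> \<Psi> ` ball 0 1\<close> by (rule subsetD)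
      then show ?thesis using z True \<open>\<Psi> 0 \<noteq> 0\<close> by simp
    next
      case False
      then have zD: "z \<in> punctured_disc" using z by simp
      have "\<psi> z \<in> punctured_disc" using symbol_into imageI[OF zD, of \<psi>] by (rule subsetD)
      then show ?thesis using eq[OF zD] z by simp
    qed
  qed
  have \<omega>c: "continuous_on (sphere 0 (1 / 2)) \<omega>"
    by (intro holomorphic_on_imp_continuous_on holomorphic_on_subset[OF multiplier_holomorphic] circle_in_domain)
  have \<omega>0: "\<omega> z \<noteq> 0" if "z \<in> sphere 0 (1 / 2)" for z
    using multiplier_zero_free circle_in_domain(1) that by blast
  \<comment> \<open>The integrand becomes \<open>1 / z\<close>.\<close>
  define g0 where "g0 = (\<lambda>z. if z \<in> punctured_disc then \<omega> z / z else 0)"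
  have "contour_integral (circlepath 0 (1 / 2)) (\<lambda>z. g0 z * (1 / \<omega> z)) = 0"
  proof (rule circle_functional_annihilating)
    show "continuous_on (sphere 0 (1 / 2)) (\<lambda>z. 1 / \<omega> z)"
      using \<omega>0 by (auto intro!: continuous_intros \<omega>c)
    show "g0 \<in> holo punctured_disc" unfolding g0_def
      by (intro holo_cutoff holomorphic_intros multiplier_holomorphic) auto
    fix g assume g: "g \<in> holo punctured_disc"
    have "contour_integral (circlepath 0 (1 / 2)) (\<lambda>z. T g z * (1 / \<omega> z)) =
        contour_integral (circlepath 0 (1 / 2)) (\<lambda>z. (g \<circ> \<Psi>) z)"
    proof (rule contour_integral_cong[OF refl])
      fix z :: complex assume "z \<in> path_image (circlepath 0 (1 / 2))"
      then have z: "z \<in> sphere 0 (1 / 2)" by simp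
      then have "z \<in> punctured_disc" using circle_in_domain(1) by blast
      then show "T g z * (1 / \<omega> z) = (g \<circ> \<Psi>) z" using \<omega>0[OF z] eq[of z] by (simp add: wcomp_def)
    qed
    also have "contour_integral (circlepath 0 (1 / 2)) (\<lambda>z. (g \<circ> \<Psi>) z) = 0"
    proof (rule contour_integral_unique)
      have hol: "(g \<circ> \<Psi>) holomorphic_on ball 0 1"
        using g by (intro holomorphic_on_compose_gen[OF \<Psi>(1) _ into]) (simp add: holo_def)
      show "((\<lambda>z. (g \<circ> \<Psi>) z) has_contour_integral 0) (circlepath 0 (1 / 2))"
        by (rule Cauchy_theorem_convex_simple[OF hol convex_ball]) auto
    qed
    finally show "contour_integral (circlepath 0 (1 / 2)) (\<lambda>z. T g z * (1 / \<omega> z)) = 0" .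
  qed
  moreover have "contour_integral (circlepath 0 (1 / 2)) (\<lambda>z. g0 z * (1 / \<omega> z)) =
      contour_integral (circlepath 0 (1 / 2)) (\<lambda>z. 1 / z)"
  proof (rule contour_integral_cong[OF refl])
    fix z :: complex assume "z \<in> path_image (circlepath 0 (1 / 2))"
    then have z: "z \<in> sphere 0 (1 / 2)" by simp
    then have "z \<in> punctured_disc" using circle_in_domain(1) by blast
    then show "g0 z * (1 / \<omega> z) = 1 / z" using \<omega>0[OF z] by (simp add: g0_def)
  qed
  moreover have "contour_integral (circlepath 0 (1 / 2)) (\<lambda>z. 1 / z) = 2 * pi * \<i> * 1"
    by (rule contour_integral_unique, rule circle_integral_eq_residue[where P = "\<lambda>_. 0"]) auto
  ultimately show False by simp
qed

text \<open>For a rotation, the mean of \<open>ln \<bar>T\<^sup>n f\<bar>\<close> over a circle is \<open>n\<close> times the mean of \<open>ln \<bar>\<omega>\<bar>\<close> plus the mean of \<open>ln \<bar>f\<bar>\<close>.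
  It is monotone in \<open>n\<close>, but a dense orbit approximates arbitrarily large and arbitrarily small
  constants.\<close>

lemma not_rotation:
  assumes \<alpha>: "norm \<alpha> = 1" and rot: "\<And>z. z \<in> punctured_disc \<Longrightarrow> \<psi> z = \<alpha> * z"
  shows False
proof -
  let ?C = "sphere 0 (1 / 2) :: complex set"
  define F where "F n z = complex_of_real (ln (norm ((T ^^ n) f z)))" for n z
  define V where "V z = complex_of_real (ln (norm (\<omega> z)))" for z
  define I where "I H = contour_integral (circlepath 0 (1 / 2)) (\<lambda>z. H z / z)" for H :: "complex \<Rightarrow> complex"
  have C: "z \<in> punctured_disc" if "z \<in> ?C" for z using circle_in_domain(1) that by blast
  have \<alpha>C: "\<alpha> * z \<in> ?C" if "z \<in> ?C" for z using that \<alpha> by (simp add: norm_mult)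
  have Tz: "T g z = \<omega> z * g (\<alpha> * z)" if "z \<in> ?C" for g z
    using C[OF that] rot by (simp add: wcomp_def)
  have \<omega>0: "\<omega> z \<noteq> 0" if "z \<in> ?C" for z using multiplier_zero_free[OF C[OF that]] .
  have approx_const: "\<exists>n. \<forall>z\<in>?C. dist ((T ^^ n) f z) a < e" if e: "e > 0" for a e
  proof -
    have "(\<lambda>z. if z \<in> punctured_disc then a else 0) \<in> holo punctured_disc" by (intro holo_cutoff) auto
    then obtain n where n: "\<forall>z\<in>?C. dist ((T ^^ n) f z) (if z \<in> punctured_disc then a else 0) < e"
      using orbit_dense[OF _ circle_in_domain(2,1) e] by blast
    show ?thesis
    proof (intro exI[of _ n] ballI)
      fix z assume z: "z \<in> ?C"
      show "dist ((T ^^ n) f z) a < e" using bspec[OF n z] C[OF z] by (simp only: if_True)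
    qed
  qed
  \<comment> \<open>A zero of \<open>f\<close> on the circle would be carried along the orbit, which comes close to the constant 1.\<close>
  have f0: "f z \<noteq> 0" if z: "z \<in> ?C" for z
  proof
    assume "f z = 0"
    have "\<exists>w\<in>?C. (T ^^ n) f w = 0" for n
    proof (induction n)
      case 0
      then show ?case using \<open>f z = 0\<close> z by auto
    next
      case (Suc n)
      then obtain w where w: "w \<in> ?C" "(T ^^ n) f w = 0" by blast
      have "w / \<alpha> \<in> ?C" "\<alpha> * (w / \<alpha>) = w" using w(1) \<alpha> by (auto simp: norm_divide)
      then show ?case using w(2) Tz[of "w / \<alpha>" "(T ^^ n) f"] by (intro bexI[of _ "w / \<alpha>"]) auto
    qed
    moreover obtain n where n: "\<forall>z\<in>?C. dist ((T ^^ n) f z) 1 < 1" using approx_const[of 1 1] by auto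
    ultimately obtain w where w: "w \<in> ?C" "(T ^^ n) f w = 0" by blast
    show False using bspec[OF n w(1)] w(2) by simp
  qed
  have Tf0: "(T ^^ n) f z \<noteq> 0" if "z \<in> ?C" for n z
    using that
  proof (induction n arbitrary: z)
    case (Suc n)
    then show ?case using Tz[of z "(T ^^ n) f"] \<omega>0[of z] \<alpha>C[of z] by simp
  qed (use f0 in simp)
  have Fc: "continuous_on ?C (F n)" for n
  proof -
    have "continuous_on ?C ((T ^^ n) f)" by (rule holo_continuous_on[OF T_funpow_holo[OF f] circle_in_domain(1)])
    then show ?thesis unfolding F_def using Tf0 by (auto intro!: continuous_intros)
  qed
  have Vc: "continuous_on ?C V"
  proof -
    have "continuous_on ?C \<omega>"
      by (intro holomorphic_on_imp_continuous_on holomorphic_on_subset[OF multiplier_holomorphic] circle_in_domain)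
    then show ?thesis unfolding V_def using \<omega>0 by (auto intro!: continuous_intros)
  qed
  have integrable: "(\<lambda>z. H z / z) contour_integrable_on circlepath 0 (1 / 2)" if "continuous_on ?C H" for H
    using that by (intro contour_integrable_continuous_circlepath continuous_intros) auto
  have I_step: "I (F (Suc n)) = I V + I (F n)" for n
  proof -
    have "continuous_on ?C (\<lambda>z. F n (\<alpha> * z))"
      by (rule continuous_on_compose2[OF Fc[of n]]) (use \<alpha>C in \<open>auto intro!: continuous_intros\<close>)
    note int = integrable[OF Vc] integrable[OF this]
    have "I (F (Suc n)) = contour_integral (circlepath 0 (1 / 2)) (\<lambda>z. V z / z + F n (\<alpha> * z) / z)"
      unfolding I_def
    proof (rule contour_integral_cong[OF refl])
      fix z :: complex assume "z \<in> path_image (circlepath 0 (1 / 2))"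
      then have z: "z \<in> ?C" by simp
      have "F (Suc n) z = V z + F n (\<alpha> * z)"
        using Tz[OF z, of "(T ^^ n) f"] \<omega>0[OF z] Tf0[OF \<alpha>C[OF z], of n]
        by (simp add: F_def V_def norm_mult ln_mult)
      then show "F (Suc n) z / z = V z / z + F n (\<alpha> * z) / z" by (simp add: add_divide_distrib)
    qed
    also have "\<dots> = I V + contour_integral (circlepath 0 (1 / 2)) (\<lambda>z. F n (\<alpha> * z) / z)"
      unfolding I_def by (rule contour_integral_add[OF int])
    also have "contour_integral (circlepath 0 (1 / 2)) (\<lambda>z. F n (\<alpha> * z) / z) = I (F n)"
      unfolding I_def by (rule circle_integral_rotation[OF \<alpha>])
    finally show ?thesis .
  qed
  have I_n: "I (F n) = of_nat n * I V + I (F 0)" for n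
    by (induction n) (simp_all add: I_step algebra_simps)
  \<comment> \<open>The orbit comes so close to the constant \<open>exp c\<close> that \<open>ln \<bar>T\<^sup>n f\<bar>\<close> differs from \<open>c\<close> by at most 1 on the circle.\<close>
  have near: "\<exists>n. \<bar>Im (I (F n)) - 2 * pi * c\<bar> \<le> 2 * pi" for c :: real
  proof -
    obtain n where n: "\<forall>z\<in>?C. dist ((T ^^ n) f z) (of_real (exp c)) < exp c / 2"
      using approx_const[of "exp c / 2" "of_real (exp c)"] by auto
    have Ic: "I (\<lambda>_. of_real c) = 2 * pi * \<i> * c"
      unfolding I_def
      by (rule contour_integral_unique, rule circle_integral_eq_residue[where P = "\<lambda>_. 0"]) auto
    have "I (F n) - I (\<lambda>_. of_real c) = contour_integral (circlepath 0 (1 / 2)) (\<lambda>z. F n z / z - of_real c / z)"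
      unfolding I_def by (rule contour_integral_diff[symmetric]) (intro integrable Fc continuous_intros)+
    also have "norm \<dots> \<le> 2 * pi"
    proof (rule circle_integral_bound)
      show "continuous_on ?C (\<lambda>z. F n z / z - of_real c / z)"
        by (intro continuous_intros Fc) auto
      fix z :: complex assume z: "norm z = 1 / 2"
      let ?v = "norm ((T ^^ n) f z)"
      have d: "norm ((T ^^ n) f z - of_real (exp c)) < exp c / 2" using n z by (simp add: dist_norm)
      have "\<bar>?v - exp c\<bar> \<le> norm ((T ^^ n) f z - of_real (exp c))"
        using norm_triangle_ineq3[of "(T ^^ n) f z" "of_real (exp c)"] by simp
      then have v: "exp c / 2 < ?v" "?v < exp c * (3 / 2)" using d by (auto simp: abs_if split: if_splits)
      have e: "(2::real) \<le> exp 1" using exp_ge_add_one_self[of 1] by simp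
      have v0: "?v > 0" using v(1) exp_gt_zero[of c] by linarith
      have "exp (c - 1) \<le> exp c / 2" using e by (simp add: exp_diff divide_simps)
      then have "c - 1 \<le> ln ?v" using v(1) v0 by (subst ln_ge_iff) auto
      moreover have "?v \<le> exp (c + 1)"
      proof -
        have "exp c * (3 / 2) \<le> exp c * exp 1" using e by (intro mult_left_mono) auto
        then have "?v \<le> exp c * exp 1" using v(2) by linarith
        then show ?thesis by (simp only: exp_add)
      qed
      then have "ln ?v \<le> c + 1" using v0 by (metis ln_exp ln_mono)
      ultimately have "\<bar>ln ?v - c\<bar> \<le> 1" by linarith
      moreover have "F n z / z - of_real c / z = of_real (ln ?v - c) / z"
        by (simp add: F_def diff_divide_distrib)
      ultimately show "norm (F n z / z - of_real c / z) \<le> 2"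
        using z by (simp only: norm_divide norm_of_real) simp
    qed simp
    finally have "\<bar>Im (I (F n) - I (\<lambda>_. of_real c))\<bar> \<le> 2 * pi"
      using abs_Im_le_cmod order_trans by blast
    then show ?thesis unfolding Ic by (intro exI[of _ n]) simp
  qed
  define a where "a = Im (I (F 0))"
  define w where "w = Im (I V)"
  have Im_n: "Im (I (F n)) = real n * w + a" for n by (simp add: I_n[of n] a_def w_def)
  define b where "b = 2 * pi * (\<bar>a\<bar> + 1)"
  have "1 * (\<bar>a\<bar> + 1) \<le> (2 * pi) * (\<bar>a\<bar> + 1)" using pi_gt3 by (intro mult_right_mono) auto
  then have pi: "\<bar>a\<bar> + 1 \<le> b" by (simp add: b_def)
  show False
  proof (cases "w \<ge> 0")
    case True
    obtain n where "\<bar>Im (I (F n)) - 2 * pi * (- \<bar>a\<bar> - 2)\<bar> \<le> 2 * pi" using near by blast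
    then have "Im (I (F n)) \<le> - b" by (simp add: b_def algebra_simps)
    moreover have "real n * w \<ge> 0" using True by simp
    ultimately show False using pi Im_n[of n] by linarith
  next
    case False
    obtain n where "\<bar>Im (I (F n)) - 2 * pi * (\<bar>a\<bar> + 2)\<bar> \<le> 2 * pi" using near by blast
    then have "Im (I (F n)) \<ge> b" by (simp add: b_def algebra_simps)
    moreover have "real n * w \<le> 0" using False by (simp add: mult_nonneg_nonpos)
    ultimately show False using pi Im_n[of n] by linarith
  qed
qed

end

text \<open>Both integrals equal \<open>2 * pi * \<i>\<close> times the residue of \<open>E\<close> at the puncture. For the one on the left,
  \<open>E \<circ> \<psi> * \<psi>'\<close> differs by a derivative from the residue times \<open>\<psi>' / \<psi>\<close>, and \<open>\<psi>' / \<psi>\<close> differs by a derivative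
  from \<open>1 / z\<close>.\<close>

lemma (in univalent_contraction) circle_integral_invariant:
  assumes \<phi>: "\<And>z. norm z < 1 \<Longrightarrow> \<phi> z = z * exp (Q z)" and Q: "Q holomorphic_on ball 0 1"
    and conj: "\<And>z. norm z < 1 \<Longrightarrow> \<phi> (\<psi> z) = deriv \<psi> 0 * \<phi> z"
    and E: "E holomorphic_on punctured_disc"
  shows "contour_integral (circlepath 0 (1 / 2)) (\<lambda>z. E (\<psi> z) * deriv \<psi> z) =
    contour_integral (circlepath 0 (1 / 2)) E"
proof -
  obtain a P where P: "P holomorphic_on punctured_disc"
    "\<And>z. z \<in> punctured_disc \<Longrightarrow> (P has_field_derivative (E z - a / z)) (at z)"
    by (rule primitive_up_to_residue[OF E]) (rule that)
  \<comment> \<open>By the linearization, \<open>\<psi> z = deriv \<psi> 0 * z * exp (q z)\<close>.\<close>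
  define q where "q z = Q z - Q (\<psi> z)" for z
  have Q\<psi>: "(\<lambda>z. Q (\<psi> z)) holomorphic_on ball 0 1"
    using holomorphic_on_compose_gen[OF holomorphic Q into] by (simp add: o_def)
  have q: "q holomorphic_on ball 0 1" unfolding q_def by (intro holomorphic_intros Q Q\<psi>)
  have \<psi>q: "\<psi> z = deriv \<psi> 0 * z * exp (q z)" if "norm z < 1" for z
    using conj[OF that] \<phi>[OF that] \<phi>[OF iterate_in_disc[OF that, of 1, simplified]]
    by (simp add: q_def exp_diff field_simps)
  have "((\<lambda>z. P (\<psi> z) + a * q z) has_field_derivative (E (\<psi> z) * deriv \<psi> z - a / z)) (at z)"
    if z: "z \<in> punctured_disc" for z
  proof -
    have zb: "z \<in> ball 0 1" "norm z < 1" "z \<noteq> 0" using z by auto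
    have \<psi>0: "\<psi> z \<noteq> 0" using \<psi>q[OF zb(2)] zb(3) multiplier_nonzero by simp
    then have \<psi>z: "\<psi> z \<in> punctured_disc" using iterate_in_disc[OF zb(2), of 1] by simp
    have d\<psi>: "(\<psi> has_field_derivative deriv \<psi> z) (at z)"
      by (rule holomorphic_derivI[OF holomorphic open_ball zb(1)])
    have dq: "(q has_field_derivative deriv q z) (at z)"
      by (rule holomorphic_derivI[OF q open_ball zb(1)])
    have "((\<lambda>z. deriv \<psi> 0 * z * exp (q z)) has_field_derivative (\<psi> z * (1 / z + deriv q z))) (at z)"
      unfolding \<psi>q[OF zb(2)] using zb(3) by (auto intro!: derivative_eq_intros dq simp: field_simps)
    then have "(\<psi> has_field_derivative (\<psi> z * (1 / z + deriv q z))) (at z)"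
      by (rule has_field_derivative_transform_within_open[of _ _ _ "ball 0 1"]) (use zb \<psi>q in auto)
    then have "deriv \<psi> z = \<psi> z * (1 / z + deriv q z)" using d\<psi> DERIV_unique by blast
    then have eq: "a * deriv q z = a * (deriv \<psi> z / \<psi> z) - a / z" using \<psi>0 by (simp add: field_simps)
    have "((\<lambda>z. P (\<psi> z) + a * q z) has_field_derivative
        ((E (\<psi> z) - a / \<psi> z) * deriv \<psi> z + a * deriv q z)) (at z)"
      by (intro DERIV_add DERIV_cmult dq DERIV_chain2[OF P(2)[OF \<psi>z] d\<psi>])
    also have "(E (\<psi> z) - a / \<psi> z) * deriv \<psi> z + a * deriv q z = E (\<psi> z) * deriv \<psi> z - a / z"
      unfolding eq by (simp add: algebra_simps)
    finally show ?thesis .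
  qed
  then have "contour_integral (circlepath 0 (1 / 2)) (\<lambda>z. E (\<psi> z) * deriv \<psi> z) = 2 * pi * \<i> * a"
    by (intro contour_integral_unique circle_integral_eq_residue)
  moreover have "contour_integral (circlepath 0 (1 / 2)) E = 2 * pi * \<i> * a"
    by (intro contour_integral_unique circle_integral_eq_residue[OF P(2)])
  ultimately show ?thesis by simp
qed

text \<open>The exponent \<open>k\<close> is the winding number of \<open>\<omega>\<close> around the puncture. Let \<open>L j g\<close> be the coefficient, up to a constant
  factor, of \<open>\<phi> powi (- j)\<close> in the Laurent expansion of \<open>g * exp (- G)\<close> in powers of \<open>\<phi>\<close>. By the normal form, \<open>T\<close> multiplies
  and shifts these coefficients, so \<open>L 0 (T\<^sup>n f)\<close> is an explicit multiple of \<open>L (n * k) f\<close>. For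
  \<open>k = 0\<close> it is \<open>c\<^sup>n * L 0 f\<close>; for \<open>k < 0\<close> the weights decay superexponentially and the sequence is bounded. In
  neither case are its values dense.\<close>

lemma (in punctured_disc_hypercyclic) winding_number_positive:
  fixes k :: int
  assumes contraction: "univalent_contraction \<psi>" and W: "W holomorphic_on punctured_disc"
    and \<omega>: "\<And>z. z \<in> punctured_disc \<Longrightarrow> \<omega> z = z powi k * exp (W z)"
  shows "k \<ge> 1"
proof (rule ccontr)
  assume "\<not> k \<ge> 1"
  interpret univalent_contraction \<psi> by (rule contraction)
  let ?l = "deriv \<psi> 0"
  obtain \<phi> Q G c where \<phi>: "\<phi> holomorphic_on ball 0 1" "inj_on \<phi> (ball 0 1)"
    and Q: "Q holomorphic_on ball 0 1" and \<phi>Q: "\<And>z. norm z < 1 \<Longrightarrow> \<phi> z = z * exp (Q z)"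
    and conj: "\<And>z. norm z < 1 \<Longrightarrow> \<phi> (\<psi> z) = ?l * \<phi> z"
    and G: "G holomorphic_on punctured_disc" and c: "c \<noteq> 0"
    and mult: "\<And>z. z \<in> punctured_disc \<Longrightarrow> \<omega> z * exp (G (\<psi> z)) = c * \<phi> z powi k * exp (G z)"
    by (rule multiplier_normal_form[OF W \<omega>]) (assumption, rule that)
  have l: "?l \<noteq> 0" by (rule multiplier_nonzero)
  have \<phi>0: "\<phi> z \<noteq> 0" if "z \<in> punctured_disc" for z using that \<phi>Q[of z] by auto
  have d\<phi>: "deriv \<phi> holomorphic_on ball 0 1" by (rule holomorphic_deriv[OF \<phi>(1) open_ball])
  define m where "m j z = \<phi> z powi j * exp (- G z) * (deriv \<phi> z / \<phi> z)" for j z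
  have m_hol: "m j holomorphic_on punctured_disc" for j
    unfolding m_def
    by (intro holomorphic_intros G holomorphic_on_subset[OF \<phi>(1)] holomorphic_on_subset[OF d\<phi>])
       (use \<phi>0 in auto)
  have m_cont: "continuous_on (sphere 0 (1 / 2)) (m j)" for j
    by (intro holomorphic_on_imp_continuous_on holomorphic_on_subset[OF m_hol] circle_in_domain)
  define L where "L j g = contour_integral (circlepath 0 (1 / 2)) (\<lambda>z. g z * m j z)" for j g
  \<comment> \<open>The weights are chosen so that \<open>T g * m j\<close> is a multiple of \<open>(g * m (j + k)) \<circ> \<psi> * \<psi>'\<close>.\<close>
  have L_T: "L j (T g) = c * ?l powi (- (j + k)) * L (j + k) g" if g: "g \<in> holo punctured_disc" for j g
  proof -
    let ?E = "\<lambda>z. g z * m (j + k) z"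
    have E: "?E holomorphic_on punctured_disc"
      using g by (intro holomorphic_intros m_hol) (simp add: holo_def)
    have "L j (T g) = contour_integral (circlepath 0 (1 / 2))
        (\<lambda>z. (c * ?l powi (- (j + k))) * (?E (\<psi> z) * deriv \<psi> z))"
      unfolding L_def
    proof (rule contour_integral_cong[OF refl])
      fix z :: complex assume "z \<in> path_image (circlepath 0 (1 / 2))"
      then have "z \<in> sphere 0 (1 / 2)" by simp
      then have z: "z \<in> punctured_disc" using circle_in_domain(1) by blast
      then have z1: "norm z < 1" "z \<in> ball 0 1" by auto
      have \<psi>z: "\<psi> z \<in> punctured_disc" using symbol_into z by blast
      have d\<psi>: "(\<psi> has_field_derivative deriv \<psi> z) (at z)"
        by (rule holomorphic_derivI[OF holomorphic open_ball z1(2)])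
      have d\<phi>: "(\<phi> has_field_derivative deriv \<phi> w) (at w)" if "w \<in> ball 0 1" for w
        by (rule holomorphic_derivI[OF \<phi>(1) open_ball that])
      have "((\<lambda>z. \<phi> (\<psi> z)) has_field_derivative deriv \<phi> (\<psi> z) * deriv \<psi> z) (at z)"
        using \<psi>z by (intro DERIV_chain2[OF d\<phi> d\<psi>]) auto
      then have "((\<lambda>z. ?l * \<phi> z) has_field_derivative deriv \<phi> (\<psi> z) * deriv \<psi> z) (at z)"
        by (rule has_field_derivative_transform_within_open[of _ _ _ "ball 0 1"]) (use z1 conj in auto)
      then have chain: "deriv \<phi> (\<psi> z) * deriv \<psi> z = ?l * deriv \<phi> z"
        using DERIV_cmult[OF d\<phi>[OF z1(2)], of ?l] DERIV_unique by blast
      have "\<omega> z * exp (- G z) = c * \<phi> z powi k * exp (- G (\<psi> z))"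
        using mult[OF z] by (simp add: exp_minus field_simps)
      then have "T g z * m j z = c * \<phi> z powi k * exp (- G (\<psi> z)) * g (\<psi> z) * \<phi> z powi j * (deriv \<phi> z / \<phi> z)"
        using z by (simp add: wcomp_def m_def mult_ac)
      also have "\<dots> = c * \<phi> z powi (j + k) * exp (- G (\<psi> z)) * g (\<psi> z) * (deriv \<phi> z / \<phi> z)"
        using \<phi>0[OF z] by (simp add: power_int_add mult_ac)
      also have "deriv \<phi> z / \<phi> z = (deriv \<phi> (\<psi> z) / \<phi> (\<psi> z)) * deriv \<psi> z"
        using chain l by (simp add: conj[OF z1(1)] field_simps)
      also have "\<phi> z powi (j + k) = ?l powi (- (j + k)) * \<phi> (\<psi> z) powi (j + k)"
      proof -
        have "?l powi (- i) * ?l powi i = 1" for i using l by (simp add: power_int_minus)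
        then show ?thesis
          by (simp only: conj[OF z1(1)] power_int_mult_distrib mult.assoc[symmetric] mult_1_left)
      qed
      finally show "T g z * m j z = (c * ?l powi (- (j + k))) * (?E (\<psi> z) * deriv \<psi> z)"
        by (simp add: m_def mult_ac)
    qed
    also have "\<dots> = (c * ?l powi (- (j + k))) * contour_integral (circlepath 0 (1 / 2)) (\<lambda>z. ?E (\<psi> z) * deriv \<psi> z)"
    proof (rule contour_integral_lmul, rule contour_integrable_continuous_circlepath)
      have "(?E \<circ> \<psi>) holomorphic_on punctured_disc"
        by (rule holomorphic_on_compose_gen[OF symbol_holomorphic E symbol_into])
      then have "(\<lambda>z. ?E (\<psi> z)) holomorphic_on punctured_disc" by (simp add: o_def)
      then have "(\<lambda>z. ?E (\<psi> z) * deriv \<psi> z) holomorphic_on punctured_disc"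
        using holomorphic_deriv[OF symbol_holomorphic open_domain] by (rule holomorphic_on_mult)
      then show "continuous_on (path_image (circlepath 0 (1 / 2))) (\<lambda>z. ?E (\<psi> z) * deriv \<psi> z)"
        by (rule holomorphic_on_imp_continuous_on[OF holomorphic_on_subset]) auto
    qed
    also have "contour_integral (circlepath 0 (1 / 2)) (\<lambda>z. ?E (\<psi> z) * deriv \<psi> z) = L (j + k) g"
      unfolding L_def by (rule circle_integral_invariant[OF \<phi>Q Q conj E])
    finally show ?thesis .
  qed
  have L_n: "L j ((T ^^ n) g) = c ^ n * ?l powi (- (int n * j + k * (int n * (int n + 1) div 2))) * L (j + int n * k) g"
    if g: "g \<in> holo punctured_disc" for j n g
  proof (induction n arbitrary: j)
    case (Suc n)
    have tri: "int (Suc n) * (int (Suc n) + 1) div 2 = int n * (int n + 1) div 2 + (int n + 1)"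
    proof -
      have "int (Suc n) * (int (Suc n) + 1) = int n * (int n + 1) + 2 * (int n + 1)" by (simp add: algebra_simps)
      then show ?thesis by simp
    qed
    have "L j ((T ^^ Suc n) g) = c * ?l powi (- (j + k)) * L (j + k) ((T ^^ n) g)"
      using L_T[OF T_funpow_holo[OF g]] by simp
    also have "\<dots> = c ^ Suc n * (?l powi (- (j + k)) * ?l powi (- (int n * (j + k) + k * (int n * (int n + 1) div 2)))) *
        L ((j + k) + int n * k) g"
      unfolding Suc.IH by simp
    also have "?l powi (- (j + k)) * ?l powi (- (int n * (j + k) + k * (int n * (int n + 1) div 2))) =
        ?l powi (- (int (Suc n) * j + k * (int (Suc n) * (int (Suc n) + 1) div 2)))"
      unfolding tri using l by (subst power_int_add[symmetric]) (auto simp: algebra_simps)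
    also have "(j + k) + int n * k = j + int (Suc n) * k" by (simp add: algebra_simps)
    finally show ?case .
  qed simp
  \<comment> \<open>For this function the integrand is \<open>\<phi>' / \<phi>\<close>, whose residue is 1.\<close>
  define g0 where "g0 = (\<lambda>z. if z \<in> punctured_disc then exp (G z) else 0)"
  have g0: "g0 \<in> holo punctured_disc" unfolding g0_def by (intro holo_cutoff holomorphic_intros G)
  have L_g0: "L 0 g0 \<noteq> 0"
  proof -
    have "L 0 g0 = contour_integral (circlepath 0 (1 / 2)) (\<lambda>z. deriv \<phi> z / \<phi> z)"
      unfolding L_def
    proof (rule contour_integral_cong[OF refl])
      fix z :: complex assume "z \<in> path_image (circlepath 0 (1 / 2))"
      then have "z \<in> sphere 0 (1 / 2)" by simp
      then have z: "z \<in> punctured_disc" using circle_in_domain(1) by blast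
      then show "g0 z * m 0 z = deriv \<phi> z / \<phi> z" by (simp add: g0_def m_def exp_minus)
    qed
    also have "\<dots> = 2 * pi * \<i> * 1"
    proof (rule contour_integral_unique, rule circle_integral_eq_residue)
      fix z assume z: "z \<in> punctured_disc"
      then have z1: "norm z < 1" "z \<in> ball 0 1" "z \<noteq> 0" by auto
      have dQ: "(Q has_field_derivative deriv Q z) (at z)" by (rule holomorphic_derivI[OF Q open_ball z1(2)])
      have "((\<lambda>z. z * exp (Q z)) has_field_derivative (\<phi> z * (1 / z + deriv Q z))) (at z)"
        unfolding \<phi>Q[OF z1(1)] using z1(3) by (auto intro!: derivative_eq_intros dQ simp: field_simps)
      then have "(\<phi> has_field_derivative (\<phi> z * (1 / z + deriv Q z))) (at z)"
        by (rule has_field_derivative_transform_within_open[of _ _ _ "ball 0 1"]) (use z1 \<phi>Q in auto)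
      then have "deriv \<phi> z / \<phi> z - 1 / z = deriv Q z" using \<phi>0[OF z] by (simp add: DERIV_imp_deriv)
      then show "(Q has_field_derivative (deriv \<phi> z / \<phi> z - 1 / z)) (at z)" using dQ by simp
    qed
    finally show ?thesis by simp
  qed
  have dense: "\<exists>n. dist (L 0 ((T ^^ n) f)) w < e" if "e > 0" for w e
    unfolding L_def
    by (rule circle_functional_orbit_dense[OF m_cont g0 _ that]) (use L_g0 in \<open>simp add: L_def\<close>)
  have unbounded: False if B: "\<And>n. norm (L 0 ((T ^^ n) f)) \<le> B" for B
  proof -
    obtain n where n: "dist (L 0 ((T ^^ n) f)) (of_real (\<bar>B\<bar> + 1)) < 1" using dense[of 1] by auto
    have "\<bar>B\<bar> + 1 - norm (L 0 ((T ^^ n) f)) \<le> norm (of_real (\<bar>B\<bar> + 1) - L 0 ((T ^^ n) f))"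
      using norm_triangle_ineq2[of "complex_of_real (\<bar>B\<bar> + 1)" "L 0 ((T ^^ n) f)"] by (simp del: of_real_add)
    then show False using n B[of n] by (simp add: dist_norm norm_minus_commute)
  qed
  show False
  proof (cases "k = 0")
    case True
    then have Ln: "norm (L 0 ((T ^^ n) f)) = norm c ^ n * norm (L 0 f)" for n
      using L_n[OF f, of 0 n] by (simp add: norm_mult norm_power)
    show False
    proof (cases "norm c \<le> 1 \<or> L 0 f = 0")
      case True
      have "norm (L 0 ((T ^^ n) f)) \<le> norm (L 0 f)" for n
      proof (cases "L 0 f = 0")
        case False
        then have "norm c ^ n * norm (L 0 f) \<le> 1 * norm (L 0 f)"
          using True by (intro mult_right_mono power_le_one) auto
        then show ?thesis by (simp add: Ln)
      qed (simp add: Ln)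
      then show False by (rule unbounded)
    next
      case False
      then obtain n where "dist (L 0 ((T ^^ n) f)) 0 < norm (L 0 f)" using dense[of "norm (L 0 f)" 0] by auto
      moreover have "1 * norm (L 0 f) \<le> norm c ^ n * norm (L 0 f)"
        using False by (intro mult_right_mono one_le_power) auto
      ultimately show False by (simp add: Ln)
    qed
  next
    case False
    define p where "p = nat (- k)"
    have p: "p \<ge> 1" "k = - int p" using False \<open>\<not> k \<ge> 1\<close> by (auto simp: p_def)
    have bounded: "\<exists>B>0. \<forall>z\<in>sphere 0 (1 / 2). norm (g z) \<le> B" if "continuous_on (sphere 0 (1 / 2)) g" for g :: "complex \<Rightarrow> complex"
      using bounded_pos[of "g ` sphere 0 (1 / 2)"]
        compact_imp_bounded[OF compact_continuous_image[OF that compact_sphere]] by auto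
    have \<phi>c: "continuous_on (sphere 0 (1 / 2)) \<phi>"
      by (rule holomorphic_on_imp_continuous_on[OF holomorphic_on_subset[OF \<phi>(1)]]) auto
    have \<phi>0': "\<phi> z \<noteq> 0" if "z \<in> sphere 0 (1 / 2)" for z using \<phi>0 circle_in_domain(1) that by blast
    obtain R1 where R1: "R1 > 0" "\<forall>z\<in>sphere 0 (1 / 2). norm (\<phi> z) \<le> R1" using bounded[OF \<phi>c] by blast
    have "continuous_on (sphere 0 (1 / 2)) (\<lambda>z. 1 / \<phi> z)" using \<phi>0' by (intro continuous_intros \<phi>c) blast
    then obtain R2 where R2: "R2 > 0" "\<forall>z\<in>sphere 0 (1 / 2). norm (1 / \<phi> z) \<le> R2" using bounded by blast
    define R where "R = max R1 R2"
    have R: "R > 0" "\<And>z. z \<in> sphere 0 (1 / 2) \<Longrightarrow> norm (\<phi> z) \<le> R"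
        "\<And>z. z \<in> sphere 0 (1 / 2) \<Longrightarrow> norm (1 / \<phi> z) \<le> R"
      using R1 R2 unfolding R_def by (auto simp: le_max_iff_disj less_max_iff_disj simp del: mem_sphere_0)
    have fc: "continuous_on (sphere 0 (1 / 2)) f" by (rule holo_continuous_on[OF f circle_in_domain(1)])
    have "continuous_on (sphere 0 (1 / 2)) (\<lambda>z. f z * m 0 z)" by (intro continuous_intros fc m_cont)
    then obtain B where B: "B > 0" "\<forall>z\<in>sphere 0 (1 / 2). norm (f z * m 0 z) \<le> B" using bounded by blast
    have L_bound: "norm (L (int n * k) f) \<le> (R ^ (n * p) * B) * pi" for n
      unfolding L_def
    proof (rule circle_integral_bound)
      show "continuous_on (sphere 0 (1 / 2)) (\<lambda>z. f z * m (int n * k) z)"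
        by (intro continuous_intros fc m_cont)
      show "0 \<le> R ^ (n * p) * B" using R(1) B(1) by simp
      fix z :: complex assume "norm z = 1 / 2"
      then have z: "z \<in> sphere 0 (1 / 2)" by simp
      have "norm (\<phi> z powi (int n * k)) \<le> R ^ nat \<bar>int n * k\<bar>" by (rule norm_powi_le[OF R(2,3)[OF z]])
      also have "nat \<bar>int n * k\<bar> = n * p" by (simp add: p(2) abs_mult nat_mult_distrib)
      finally have "norm (\<phi> z powi (int n * k)) * norm (f z * m 0 z) \<le> R ^ (n * p) * B"
        using B z R(1) by (intro mult_mono) auto
      moreover have "f z * m (int n * k) z = \<phi> z powi (int n * k) * (f z * m 0 z)" by (simp add: m_def)
      ultimately show "norm (f z * m (int n * k) z) \<le> R ^ (n * p) * B" by (simp only: norm_mult)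
    qed
    define M where "M = norm c * R ^ p"
    have "M \<ge> 0" using R(1) by (simp add: M_def)
    then obtain C where C: "\<And>n. M ^ n * norm ?l ^ (n * (n - 1) div 2) \<le> C * (1 / 2) ^ n"
      using superexponential_decay[of M "norm ?l"] multiplier_less_1 by auto
    have "C \<ge> 0" using C[of 0] by simp
    have "norm (L 0 ((T ^^ n) f)) \<le> C * (B * pi)" for n
    proof -
      define t where "t = nat (int p * (int n * (int n + 1) div 2))"
      have nn: "int n * (int n + 1) div 2 \<ge> int (n * (n - 1) div 2)"
      proof -
        have "int (n * (n - 1)) \<le> int n * (int n + 1)" by (cases n) (auto simp: algebra_simps)
        then show ?thesis by (simp add: zdiv_int zdiv_mono1)
      qed
      have "1 * (int n * (int n + 1) div 2) \<le> int p * (int n * (int n + 1) div 2)"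
        using p(1) nn by (intro mult_right_mono) auto
      then have t: "n * (n - 1) div 2 \<le> t" "int t = int p * (int n * (int n + 1) div 2)"
        using nn by (auto simp: t_def)
      have "norm (?l powi int t) \<le> norm ?l ^ (n * (n - 1) div 2)"
        using t(1) multiplier_less_1 by (simp add: norm_power power_decreasing)
      moreover have "L 0 ((T ^^ n) f) = c ^ n * ?l powi int t * L (int n * k) f"
        using L_n[OF f, of 0 n] by (simp add: t(2) p(2))
      ultimately have "norm (L 0 ((T ^^ n) f)) \<le> norm c ^ n * norm ?l ^ (n * (n - 1) div 2) * ((R ^ (n * p) * B) * pi)"
        using L_bound[of n]
        by (simp only: norm_mult norm_power) (intro mult_mono mult_nonneg_nonneg zero_le_power norm_ge_zero order_refl)
      also have "\<dots> = (M ^ n * norm ?l ^ (n * (n - 1) div 2)) * (B * pi)"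
        by (simp add: M_def power_mult_distrib power_mult[symmetric] mult_ac)
      also have "\<dots> \<le> (C * (1 / 2) ^ n) * (B * pi)" using C[of n] B(1) by (intro mult_right_mono) auto
      also have "\<dots> \<le> (C * 1) * (B * pi)"
        using \<open>C \<ge> 0\<close> B(1) by (intro mult_right_mono mult_left_mono power_le_one) auto
      finally show ?thesis by simp
    qed
    then show False by (rule unbounded)
  qed
qed

section \<open>Characterization of hypercyclicity\<close>

lemma open_punctured_disc: "open punctured_disc"
  by (auto intro!: open_Diff)

text \<open>The identity theorem on the open image of the symbol.\<close>

lemma wcomp_inj_on_holo:
  assumes \<psi>: "\<psi> holomorphic_on punctured_disc" "\<psi> ` punctured_disc \<subseteq> punctured_disc" "inj_on \<psi> punctured_disc"
    and \<omega>: "\<And>z. z \<in> punctured_disc \<Longrightarrow> \<omega> z \<noteq> 0"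
  shows "inj_on (wcomp punctured_disc \<omega> \<psi>) (holo punctured_disc)"
proof (rule inj_onI)
  fix g h assume g: "g \<in> holo punctured_disc" and h: "h \<in> holo punctured_disc"
    and eq: "wcomp punctured_disc \<omega> \<psi> g = wcomp punctured_disc \<omega> \<psi> h"
  have pd: "1 / 2 \<in> punctured_disc" by auto
  have conn: "connected punctured_disc" by (rule connected_open_delete) auto
  have diff: "(\<lambda>z. g z - h z) holomorphic_on punctured_disc"
    using g h by (auto simp: holo_def intro!: holomorphic_intros)
  have op: "open (\<psi> ` punctured_disc)" by (rule open_mapping_thm3[OF \<psi>(1) open_punctured_disc \<psi>(3)])
  have mem: "\<psi> (1 / 2) \<in> \<psi> ` punctured_disc" using pd by (rule imageI)
  have zero: "g w - h w = 0" if w: "w \<in> \<psi> ` punctured_disc" for w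
  proof -
    obtain z where z: "z \<in> punctured_disc" "w = \<psi> z" using w by blast
    then have "\<omega> z * g w = \<omega> z * h w" using fun_cong[OF eq, of z] by (simp add: wcomp_def)
    then show ?thesis using \<omega>[OF z(1)] by simp
  qed
  show "g = h"
  proof
    fix z show "g z = h z"
    proof (cases "z \<in> punctured_disc")
      case True
      have "\<psi> (1 / 2) islimpt \<psi> ` punctured_disc" 
        by (rule interior_limit_point) (simp only: interior_open[OF op] mem)
      then have "g z - h z = 0"
        using analytic_continuation[OF diff open_punctured_disc conn \<psi>(2), of "\<psi> (1 / 2)" z] zero mem \<psi>(2) True
        by blast
      then show ?thesis by simp
    next
      case False
      then show ?thesis using g h by (simp add: holo_def)
    qed
  qed
qed

lemma univalent_contraction_or_rotation:
  assumes \<Psi>: "\<Psi> holomorphic_on ball 0 1" "inj_on \<Psi> (ball 0 1)" "\<Psi> ` ball 0 1 \<subseteq> ball 0 1" "\<Psi> 0 = 0"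
  obtains "univalent_contraction \<Psi>"
  | \<alpha> where "norm \<alpha> = 1" "\<And>z. norm z < 1 \<Longrightarrow> \<Psi> z = \<alpha> * z"
proof -
  have b: "norm (\<Psi> z) < 1" if "norm z < 1" for z
    using subsetD[OF \<Psi>(3) imageI[of z]] that by simp
  have le: "norm (deriv \<Psi> 0) \<le> 1" by (rule Schwarz_Lemma(2)[OF \<Psi>(1,4) b, of 0]) auto
  show ?thesis
  proof (cases "norm (deriv \<Psi> 0) = 1")
    case True
    have "\<exists>\<alpha>. (\<forall>z. norm z < 1 \<longrightarrow> \<Psi> z = \<alpha> * z) \<and> norm \<alpha> = 1"
      by (rule Schwarz_Lemma(3)[OF \<Psi>(1,4) b, of 0]) (use True in auto)
    then show ?thesis using that(2) by blast
  next
    case False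
    then have "univalent_contraction \<Psi>" using \<Psi> le by unfold_locales auto
    then show ?thesis by (rule that(1))
  qed
qed

lemma at_0_within_punctured_disc: "at 0 within punctured_disc = at 0"
  by (rule at_within_nhd[of 0 "ball 0 1"]) auto

lemma extension_tendsto:
  assumes "\<Psi> holomorphic_on ball 0 1" "\<And>z. z \<in> punctured_disc \<Longrightarrow> \<Psi> z = \<psi> z"
  shows "(\<psi> \<longlongrightarrow> \<Psi> 0) (at 0 within punctured_disc)"
proof -
  have "continuous_on (ball 0 1) \<Psi>" using assms(1) by (rule holomorphic_on_imp_continuous_on)
  then have "isCont \<Psi> 0" using continuous_on_eq_continuous_at[OF open_ball, of 0 1 \<Psi>] by simp
  then have "(\<Psi> \<longlongrightarrow> \<Psi> 0) (at 0)" by (simp add: isCont_def)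
  then show ?thesis unfolding at_0_within_punctured_disc
    by (rule Lim_transform_within_open[OF _ open_ball[of 0 1]]) (use assms(2) in auto)
qed

lemma normal_form_conditions_imp_dynamics:
  assumes \<omega>: "\<omega> holomorphic_on punctured_disc" and \<psi>: "\<psi> holomorphic_on punctured_disc" "\<psi> ` punctured_disc \<subseteq> punctured_disc"
    and W: "W holomorphic_on punctured_disc" "n \<ge> 1" "\<And>z. z \<in> punctured_disc \<Longrightarrow> \<omega> z = z ^ n * exp (W z)"
    and inj: "inj_on \<psi> punctured_disc" and nonsurj: "\<psi> ` punctured_disc \<noteq> punctured_disc"
    and lim: "(\<psi> \<longlongrightarrow> 0) (at 0 within punctured_disc)"
  shows "frequent_hypercyclicity_criterion (holo_topology punctured_disc) (wcomp punctured_disc \<omega> \<psi>)"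
    and "frequently_hypercyclic (holo_topology punctured_disc) (wcomp punctured_disc \<omega> \<psi>)"
    and "mixing (holo_topology punctured_disc) (wcomp punctured_disc \<omega> \<psi>)"
    and "chaotic (holo_topology punctured_disc) (wcomp punctured_disc \<omega> \<psi>)"
proof -
  obtain \<Psi> where \<Psi>: "\<Psi> holomorphic_on ball 0 1" "inj_on \<Psi> (ball 0 1)" "\<Psi> ` ball 0 1 \<subseteq> ball 0 1"
    and eq: "\<And>z. z \<in> punctured_disc \<Longrightarrow> \<Psi> z = \<psi> z"
    by (rule univalent_extension[OF \<psi> inj]) (rule that)
  have \<Psi>0: "\<Psi> 0 = 0"
  proof (rule tendsto_unique)
    show "at (0::complex) within punctured_disc \<noteq> bot" unfolding at_0_within_punctured_disc by simp
    show "(\<psi> \<longlongrightarrow> \<Psi> 0) (at 0 within punctured_disc)" using \<Psi>(1) eq by (rule extension_tendsto)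
  qed (rule lim)
  have contraction: "univalent_contraction \<Psi>"
  proof (rule univalent_contraction_or_rotation[OF \<Psi> \<Psi>0])
    fix \<alpha> assume \<alpha>: "norm \<alpha> = 1" "\<And>z. norm z < 1 \<Longrightarrow> \<Psi> z = \<alpha> * z"
    have "punctured_disc \<subseteq> \<psi> ` punctured_disc"
    proof
      fix w assume w: "w \<in> punctured_disc"
      then have "w / \<alpha> \<in> punctured_disc" using \<alpha>(1) by (auto simp: norm_divide)
      moreover from this have "\<psi> (w / \<alpha>) = w" using \<alpha> eq[of "w / \<alpha>"] by auto
      ultimately show "w \<in> \<psi> ` punctured_disc" by (metis imageI)
    qed
    then show ?thesis using nonsurj \<psi>(2) by blast
  qed
  interpret univalent_contraction \<Psi> by (rule contraction)
  have W': "\<omega> z = z powi int n * exp (W z)" if "z \<in> punctured_disc" for z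
    using W(3)[OF that] by simp
  obtain \<phi> Q G c where \<phi>: "\<phi> holomorphic_on ball 0 1" "inj_on \<phi> (ball 0 1)"
    and Q: "Q holomorphic_on ball 0 1" "\<And>z. norm z < 1 \<Longrightarrow> \<phi> z = z * exp (Q z)"
    and conj: "\<And>z. norm z < 1 \<Longrightarrow> \<phi> (\<Psi> z) = deriv \<Psi> 0 * \<phi> z"
    and G: "G holomorphic_on punctured_disc" and c: "c \<noteq> 0"
    and mult: "\<And>z. z \<in> punctured_disc \<Longrightarrow> \<omega> z * exp (G (\<Psi> z)) = c * \<phi> z powi int n * exp (G z)"
    by (rule multiplier_normal_form[OF W(1) W']) (assumption, rule that)
  interpret nf: normal_form \<omega> \<psi> \<phi> G c "deriv \<Psi> 0" n
  proof
    show "\<phi> (\<psi> z) = deriv \<Psi> 0 * \<phi> z" if "z \<in> punctured_disc" for z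
      using conj[of z] eq[OF that] that by simp
    show "\<omega> z * exp (G (\<psi> z)) = c * \<phi> z ^ n * exp (G z)" if "z \<in> punctured_disc" for z
      using mult[OF that] eq[OF that] by simp
    show "\<phi> 0 = 0" using Q(2)[of 0] by simp
  qed (fact open_punctured_disc \<omega> \<psi> \<phi> G c multiplier_nonzero multiplier_less_1 W(2))+
  have "\<omega> z \<noteq> 0" if "z \<in> punctured_disc" for z using W(3)[OF that] that by auto
  then have "inj_on (wcomp punctured_disc \<omega> \<psi>) (holo punctured_disc)"
    by (rule wcomp_inj_on_holo[OF \<psi> inj])
  then show "frequent_hypercyclicity_criterion (holo_topology punctured_disc) (wcomp punctured_disc \<omega> \<psi>)"
    by (rule nf.frequent_hypercyclicity_criterion)
  show "frequently_hypercyclic (holo_topology punctured_disc) (wcomp punctured_disc \<omega> \<psi>)"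
    by (rule nf.frequently_hypercyclic)
  show "mixing (holo_topology punctured_disc) (wcomp punctured_disc \<omega> \<psi>)" by (rule nf.mixing)
  show "chaotic (holo_topology punctured_disc) (wcomp punctured_disc \<omega> \<psi>)" by (rule nf.chaotic)
qed

lemma hypercyclic_imp_normal_form_conditions:
  assumes \<omega>: "\<omega> holomorphic_on punctured_disc" and \<psi>: "\<psi> holomorphic_on punctured_disc" "\<psi> ` punctured_disc \<subseteq> punctured_disc"
    and hyp: "hypercyclic (holo_topology punctured_disc) (wcomp punctured_disc \<omega> \<psi>)"
  shows "\<exists>W n. W holomorphic_on punctured_disc \<and> n \<ge> (1::nat) \<and> (\<forall>z\<in>punctured_disc. \<omega> z = z ^ n * exp (W z))"
    and "inj_on \<psi> punctured_disc" and "\<psi> ` punctured_disc \<noteq> punctured_disc"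
    and "(\<psi> \<longlongrightarrow> 0) (at 0 within punctured_disc)"
proof -
  interpret weighted_composition punctured_disc \<omega> \<psi>
    by unfold_locales (fact open_punctured_disc \<omega> \<psi>)+
  obtain f where f: "f \<in> holo punctured_disc"
    "\<And>g K e. g \<in> holo punctured_disc \<Longrightarrow> compact K \<Longrightarrow> K \<subseteq> punctured_disc \<Longrightarrow> e > 0 \<Longrightarrow>
      \<exists>n. \<forall>z\<in>K. dist ((T ^^ n) f z) (g z) < e"
    by (rule hypercyclic_vector[OF hyp]) (rule that)
  interpret h: punctured_disc_hypercyclic \<omega> \<psi> f
    by unfold_locales (fact f)+
  show inj: "inj_on \<psi> punctured_disc" by (rule h.symbol_injective)
  obtain \<Psi> where \<Psi>: "\<Psi> holomorphic_on ball 0 1" "inj_on \<Psi> (ball 0 1)" "\<Psi> ` ball 0 1 \<subseteq> ball 0 1"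
    and eq: "\<And>z. z \<in> punctured_disc \<Longrightarrow> \<Psi> z = \<psi> z"
    by (rule univalent_extension[OF \<psi> inj]) (rule that)
  have \<Psi>0: "\<Psi> 0 = 0" by (rule h.extension_fixes_0[OF \<Psi>(1,3) eq])
  show "(\<psi> \<longlongrightarrow> 0) (at 0 within punctured_disc)"
    using extension_tendsto[OF \<Psi>(1) eq] \<Psi>0 by simp
  have no_rotation: False if "norm \<alpha> = 1" "\<And>z. norm z < 1 \<Longrightarrow> \<Psi> z = \<alpha> * z" for \<alpha>
    by (rule h.not_rotation[OF that(1)]) (use that(2) eq in force)
  show "\<psi> ` punctured_disc \<noteq> punctured_disc"
  proof
    assume surj: "\<psi> ` punctured_disc = punctured_disc"
    have "\<Psi> ` punctured_disc = punctured_disc" using eq surj by (metis image_cong)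
    then have "\<Psi> ` insert 0 punctured_disc = insert 0 punctured_disc" by (simp only: image_insert \<Psi>0)
    moreover have "insert 0 punctured_disc = ball (0::complex) 1" by auto
    ultimately have onto: "\<Psi> ` ball 0 1 = ball 0 1" by simp
    show False
      by (rule surjective_imp_rotation[OF \<Psi>(1,2) onto \<Psi>0]) (rule no_rotation)
  qed
  have contraction: "univalent_contraction \<Psi>"
    by (rule univalent_contraction_or_rotation[OF \<Psi> \<Psi>0]) (assumption, use no_rotation in blast)
  have T: "wcomp punctured_disc \<omega> \<Psi> = T" by (auto simp: wcomp_def fun_eq_iff eq)
  interpret H: punctured_disc_hypercyclic \<omega> \<Psi> f
  proof
    show "\<Psi> holomorphic_on punctured_disc" by (rule holomorphic_on_subset[OF \<Psi>(1)]) auto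
    show "\<Psi> ` punctured_disc \<subseteq> punctured_disc" using eq \<psi>(2) by (metis image_cong)
    show "\<exists>n. \<forall>z\<in>K. dist ((wcomp punctured_disc \<omega> \<Psi> ^^ n) f z) (g z) < e"
      if "g \<in> holo punctured_disc" "compact K" "K \<subseteq> punctured_disc" "e > 0" for g K e
      unfolding T using that by (rule f(2))
  qed (fact open_punctured_disc \<omega> f(1))+
  obtain k W where W: "W holomorphic_on punctured_disc" "\<And>z. z \<in> punctured_disc \<Longrightarrow> \<omega> z = z powi k * exp (W z)"
    by (rule exponential_normal_form[OF \<omega> h.multiplier_zero_free]) (assumption, rule that)
  have "k \<ge> 1" by (rule H.winding_number_positive[OF contraction W])
  then have "\<omega> z = z ^ nat k * exp (W z)" if "z \<in> punctured_disc" for z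
    using W(2)[OF that] by (simp add: power_int_def)
  then show "\<exists>W n. W holomorphic_on punctured_disc \<and> n \<ge> (1::nat) \<and> (\<forall>z\<in>punctured_disc. \<omega> z = z ^ n * exp (W z))"
    using W(1) \<open>k \<ge> 1\<close> by (intro exI[of _ W] exI[of _ "nat k"]) auto
qed

theorem theorem1p4:
  fixes \<omega> \<psi> :: "complex \<Rightarrow> complex"
  assumes "\<omega> holomorphic_on punctured_disc"
    and "\<psi> holomorphic_on punctured_disc"
    and "\<psi> ` punctured_disc \<subseteq> punctured_disc"
  shows "(hypercyclic (holo_topology punctured_disc) (wcomp punctured_disc \<omega> \<psi>) \<longleftrightarrow>
            frequent_hypercyclicity_criterion (holo_topology punctured_disc) (wcomp punctured_disc \<omega> \<psi>) \<and>
            frequently_hypercyclic (holo_topology punctured_disc) (wcomp punctured_disc \<omega> \<psi>) \<and>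
            mixing (holo_topology punctured_disc) (wcomp punctured_disc \<omega> \<psi>) \<and>
            chaotic (holo_topology punctured_disc) (wcomp punctured_disc \<omega> \<psi>)) \<and>
         (hypercyclic (holo_topology punctured_disc) (wcomp punctured_disc \<omega> \<psi>) \<longleftrightarrow>
            (\<exists>W n. W holomorphic_on punctured_disc \<and> n \<ge> (1::nat) \<and>
               (\<forall>z\<in>punctured_disc. \<omega> z = z ^ n * exp (W z))) \<and>
            inj_on \<psi> punctured_disc \<and> \<psi> ` punctured_disc \<noteq> punctured_disc \<and>
            (\<psi> \<longlongrightarrow> 0) (at 0 within punctured_disc))"
    (is "(?hyp \<longleftrightarrow> ?dyn) \<and> (?hyp \<longleftrightarrow> ?fun)")
proof -
  have 1: ?hyp if ?dyn
  proof (rule frequently_hypercyclic_imp_hypercyclic)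
    show "frequently_hypercyclic (holo_topology punctured_disc) (wcomp punctured_disc \<omega> \<psi>)" using that by blast
    show "wcomp punctured_disc \<omega> \<psi> f \<in> topspace (holo_topology punctured_disc)"
      if "f \<in> topspace (holo_topology punctured_disc)" for f
      using that wcomp_in_holo[OF assms] by (simp add: topspace_holo_topology)
  qed
  have 2: ?fun if ?hyp using hypercyclic_imp_normal_form_conditions[OF assms that] by (intro conjI)
  have 3: ?dyn if ?fun
  proof -
    obtain W n where W: "W holomorphic_on punctured_disc" "n \<ge> 1" "\<forall>z\<in>punctured_disc. \<omega> z = z ^ n * exp (W z)"
      using \<open>?fun\<close> by (elim conjE exE)
    show ?thesis
      using normal_form_conditions_imp_dynamics[OF assms W(1,2) W(3)[rule_format]] \<open>?fun\<close> by (intro conjI) simp_all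
  qed
  from 1 2 3 show ?thesis by argo
qed

end
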